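(* Let $(M,\xi=\ker\alpha)$ be a contact manifold and let $N \subset M$ be a submanifold. If $\delta_{\alpha}$ is non-degenerate on $\mathcal{L}(N)$, then $N$ is contact coisotropic.
   Context: $\alpha$ is a fixed contact form defining the co-oriented contact structure $\xi$. $N \subset M$ is contact coisotropic if for every $p\in N$, $(T_pN\cap\xi_p)^{\perp_{d\alpha}}\subset T_pN\cap \xi_p$, where $\perp_{d\alpha}$ denotes the symplectic orthogonal complement inside $\xi_p$ with respect to the non-degenerate form $d\alpha|_{\xi}$. $\mathrm{Cont}_0(M,\xi)$ is the identity component of the group of contactomorphisms of $(M,\xi)$ (diffeomorphisms $\phi$ with $\phi^*\alpha=e^g\alpha$, $g$ smooth). A contact isotopy $\phi_t$ starting at the identity is generated by a unique contact Hamiltonian $H:M\times[0,1]\to\mathbb{R}$, namely $H_t=\alpha(X_t)$ where $X_t$ is the time-dependent vector field generating $\phi_t$; write $\phi_t=\phi_H^t$. For $\phi\in\mathrm{Cont}_0(M,\xi)$ set $\|\phi\|_\alpha=\inf_{\phi_H^1=\phi}\int_0^1\max_M|H(\cdot,t)|\,dt$ (Shelukhin's norm). $\mathcal{L}(N)=\{\phi(N)\mid\phi\in\mathrm{Cont}_0(M,\xi)\}$, and for $L_1,L_2\in\mathcal{L}(N)$, $\delta_\alpha(L_1,L_2)=\inf\{\|\phi\|_\alpha\mid\phi\in\mathrm{Cont}_0(M,\xi),\ \phi(L_1)=L_2\}$. Non-degenerate means $\delta_\alpha(L_1,L_2)=0$ implies $L_1=L_2$. *)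

theory Defs
  imports "HOL-Analysis.Analysis"
begin

section \<open>Smooth functions between Euclidean spaces\<close>

primrec iter_deriv :: "'a::real_normed_vector list \<Rightarrow> ('a \<Rightarrow> 'b::real_normed_vector) \<Rightarrow> 'a \<Rightarrow> 'b" where
  "iter_deriv [] f = f"
| "iter_deriv (v # vs) f = (\<lambda>x. frechet_derivative (iter_deriv vs f) (at x) v)"

text \<open>On an arbitrary set, such as the product of an open set with \<open>{0..1}\<close>, smooth means
  locally extendable to a smooth function on an open set.\<close>

definition smooth_on :: "'a::euclidean_space set \<Rightarrow> ('a \<Rightarrow> 'b::euclidean_space) \<Rightarrow> bool" where
  "smooth_on S f \<longleftrightarrow> (\<forall>x\<in>S. \<exists>W g. open W \<and> x \<in> W
      \<and> (\<forall>vs. \<forall>y\<in>W. iter_deriv vs g differentiable (at y))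
      \<and> (\<forall>y\<in>S \<inter> W. f y = g y))"

section \<open>Smooth manifolds\<close>

text \<open>A chart is a domain together with a coordinate map; the values of the map outside the
  domain are irrelevant. A manifold is a whole type \<open>'m\<close> with an atlas; it has no boundary.\<close>

type_synonym ('m, 'e) chart = "'m set \<times> ('m \<Rightarrow> 'e)"

abbreviation chart_inv :: "('m, 'e) chart \<Rightarrow> 'e \<Rightarrow> 'm" where
  "chart_inv c \<equiv> inv_into (fst c) (snd c)"

definition is_chart :: "('m::topological_space, 'e::euclidean_space) chart \<Rightarrow> bool" where
  "is_chart c \<longleftrightarrow> open (fst c) \<and> open (snd c ` fst c)
     \<and> homeomorphism (fst c) (snd c ` fst c) (snd c) (chart_inv c)"

definition compatible :: "('m::topological_space, 'e::euclidean_space) chart \<Rightarrow> ('m, 'e) chart \<Rightarrow> bool" where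
  "compatible c c' \<longleftrightarrow> smooth_on (snd c ` (fst c \<inter> fst c')) (snd c' \<circ> chart_inv c)
     \<and> smooth_on (snd c' ` (fst c \<inter> fst c')) (snd c \<circ> chart_inv c')"

text \<open>The smooth structure is given by a maximal atlas.\<close>

definition smooth_manifold ::
    "('m::{t2_space,second_countable_topology}, 'e::euclidean_space) chart set \<Rightarrow> bool" where
  "smooth_manifold A \<longleftrightarrow> (\<forall>c\<in>A. is_chart c) \<and> (\<Union>c\<in>A. fst c) = UNIV
     \<and> (\<forall>c\<in>A. \<forall>c'\<in>A. compatible c c')
     \<and> (\<forall>c. is_chart c \<and> (\<forall>c'\<in>A. compatible c c') \<longrightarrow> c \<in> A)"

definition euclidean_atlas :: "('e::euclidean_space, 'e) chart set" where
  "euclidean_atlas = {(UNIV, id)}"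

definition prod_atlas ::
    "('m, 'e) chart set \<Rightarrow> ('n, 'f) chart set \<Rightarrow> ('m \<times> 'n, 'e \<times> 'f) chart set" where
  "prod_atlas A B = {(fst c \<times> fst d, map_prod (snd c) (snd d)) | c d. c \<in> A \<and> d \<in> B}"

definition smooth_map_on :: "('m::topological_space, 'e::euclidean_space) chart set \<Rightarrow>
    ('n::topological_space, 'f::euclidean_space) chart set \<Rightarrow> 'm set \<Rightarrow> ('m \<Rightarrow> 'n) \<Rightarrow> bool" where
  "smooth_map_on A B S f \<longleftrightarrow> continuous_on S f
     \<and> (\<forall>c\<in>A. \<forall>d\<in>B. smooth_on (snd c ` (S \<inter> fst c \<inter> f -` fst d)) (snd d \<circ> f \<circ> chart_inv c))"

definition diffeomorphism :: "('m::topological_space, 'e::euclidean_space) chart set \<Rightarrow> ('m \<Rightarrow> 'm) \<Rightarrow> bool" where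
  "diffeomorphism A f \<longleftrightarrow> bij f \<and> smooth_map_on A A UNIV f \<and> smooth_map_on A A UNIV (inv f)"

section \<open>Tangent vectors and one-forms\<close>

text \<open>A tangent vector at \<open>p\<close> is the family of its coordinate representatives, one for each chart
  around \<open>p\<close>, transforming by the derivatives of the transition maps; it is \<open>0\<close> at all other
  arguments, so that equal tangent vectors are equal functions.\<close>

type_synonym ('m, 'e) tvec = "('m, 'e) chart \<Rightarrow> 'e"

definition charts_at :: "('m, 'e) chart set \<Rightarrow> 'm \<Rightarrow> ('m, 'e) chart set" where
  "charts_at A p = {c \<in> A. p \<in> fst c}"

definition chart_at :: "('m, 'e) chart set \<Rightarrow> 'm \<Rightarrow> ('m, 'e) chart" where
  "chart_at A p = (SOME c. c \<in> charts_at A p)"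

definition tangent_space :: "('m, 'e::euclidean_space) chart set \<Rightarrow> 'm \<Rightarrow> ('m, 'e) tvec set" where
  "tangent_space A p = {v. (\<forall>c. c \<notin> charts_at A p \<longrightarrow> v c = 0)
     \<and> (\<forall>c\<in>charts_at A p. \<forall>c'\<in>charts_at A p.
          v c' = frechet_derivative (snd c' \<circ> chart_inv c) (at (snd c p)) (v c))}"

text \<open>The tangent vector at \<open>p\<close> whose representative in the chart \<open>c\<close> is \<open>e\<close>.\<close>

definition coord_vec :: "('m, 'e::euclidean_space) chart set \<Rightarrow> ('m, 'e) chart \<Rightarrow> 'm \<Rightarrow> 'e \<Rightarrow> ('m, 'e) tvec" where
  "coord_vec A c p e = (\<lambda>c'. if c' \<in> charts_at A p
     then frechet_derivative (snd c' \<circ> chart_inv c) (at (snd c p)) e else 0)"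

definition velocity :: "('m, 'e::euclidean_space) chart set \<Rightarrow> real set \<Rightarrow> (real \<Rightarrow> 'm) \<Rightarrow> real \<Rightarrow> ('m, 'e) tvec" where
  "velocity A I \<gamma> t = (\<lambda>c. if c \<in> charts_at A (\<gamma> t)
     then vector_derivative (snd c \<circ> \<gamma>) (at t within I) else 0)"

text \<open>The choice of chart in \<open>differential\<close> and \<open>ext_deriv\<close> does not affect the value.\<close>

definition differential :: "('m, 'e::euclidean_space) chart set \<Rightarrow> ('m \<Rightarrow> 'm) \<Rightarrow> 'm \<Rightarrow> ('m, 'e) tvec \<Rightarrow> ('m, 'e) tvec" where
  "differential A f p v = (\<lambda>c'. if c' \<in> charts_at A (f p)
     then (let c = chart_at A p in
             frechet_derivative (snd c' \<circ> f \<circ> chart_inv c) (at (snd c p)) (v c))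
     else 0)"

type_synonym ('m, 'e) form1 = "'m \<Rightarrow> ('m, 'e) tvec \<Rightarrow> real"

text \<open>The expression of a one-form in the chart \<open>c\<close>. The values of a one-form outside the tangent
  spaces are irrelevant; linearity on the tangent space at \<open>p\<close> is expressed through the
  isomorphism \<open>coord_vec A c p\<close>.\<close>

definition local_form :: "('m, 'e::euclidean_space) chart set \<Rightarrow> ('m, 'e) form1 \<Rightarrow> ('m, 'e) chart \<Rightarrow> 'e \<Rightarrow> 'e \<Rightarrow> real" where
  "local_form A \<alpha> c x e = \<alpha> (chart_inv c x) (coord_vec A c (chart_inv c x) e)"

definition one_form :: "('m, 'e::euclidean_space) chart set \<Rightarrow> ('m, 'e) form1 \<Rightarrow> bool" where
  "one_form A \<alpha> \<longleftrightarrow> (\<forall>c\<in>A. (\<forall>x\<in>snd c ` fst c. linear (local_form A \<alpha> c x))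
     \<and> (\<forall>e. smooth_on (snd c ` fst c) (\<lambda>x. local_form A \<alpha> c x e)))"

definition ext_deriv :: "('m, 'e::euclidean_space) chart set \<Rightarrow> ('m, 'e) form1 \<Rightarrow> 'm \<Rightarrow> ('m, 'e) tvec \<Rightarrow> ('m, 'e) tvec \<Rightarrow> real" where
  "ext_deriv A \<alpha> p v w = (let c = chart_at A p in
     frechet_derivative (\<lambda>x. local_form A \<alpha> c x (w c)) (at (snd c p)) (v c)
     - frechet_derivative (\<lambda>x. local_form A \<alpha> c x (v c)) (at (snd c p)) (w c))"

section \<open>Contact manifolds\<close>

definition contact_plane :: "('m, 'e::euclidean_space) chart set \<Rightarrow> ('m, 'e) form1 \<Rightarrow> 'm \<Rightarrow> ('m, 'e) tvec set" where
  "contact_plane A \<alpha> p = {v \<in> tangent_space A p. \<alpha> p v = 0}"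

definition contact_form :: "('m, 'e::euclidean_space) chart set \<Rightarrow> ('m, 'e) form1 \<Rightarrow> bool" where
  "contact_form A \<alpha> \<longleftrightarrow> one_form A \<alpha>
     \<and> (\<forall>p. (\<exists>v\<in>tangent_space A p. \<alpha> p v \<noteq> 0)
          \<and> (\<forall>v\<in>contact_plane A \<alpha> p.
               (\<forall>w\<in>contact_plane A \<alpha> p. ext_deriv A \<alpha> p v w = 0) \<longrightarrow> v = (\<lambda>_. 0)))"

definition contactomorphisms ::
    "('m::topological_space, 'e::euclidean_space) chart set \<Rightarrow> ('m, 'e) form1 \<Rightarrow> ('m \<Rightarrow> 'm) set" where
  "contactomorphisms A \<alpha> = {f. diffeomorphism A f
     \<and> (\<exists>g. smooth_map_on A (euclidean_atlas :: (real, real) chart set) UNIV g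
          \<and> (\<forall>p. \<forall>v\<in>tangent_space A p. \<alpha> (f p) (differential A f p v) = exp (g p) * \<alpha> p v))}"

text \<open>The \<open>C\<^sup>\<infinity>\<close> compact-open (weak Whitney) topology on the smooth self-maps: uniform convergence on
  compact subsets of charts of all iterated partial derivatives of the coordinate expressions.\<close>

definition smooth_nhd :: "('m::topological_space, 'e::euclidean_space) chart set \<Rightarrow> ('m \<Rightarrow> 'm) \<Rightarrow>
    ('m, 'e) chart \<Rightarrow> ('m, 'e) chart \<Rightarrow> 'm set \<Rightarrow> 'e list \<Rightarrow> real \<Rightarrow> ('m \<Rightarrow> 'm) set" where
  "smooth_nhd A f c d K vs \<epsilon> = {g. smooth_map_on A A UNIV g \<and> g ` K \<subseteq> fst d
     \<and> (\<forall>x\<in>snd c ` K. dist (iter_deriv vs (snd d \<circ> g \<circ> chart_inv c) x)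
                            (iter_deriv vs (snd d \<circ> f \<circ> chart_inv c) x) < \<epsilon>)}"

definition smooth_topology :: "('m::topological_space, 'e::euclidean_space) chart set \<Rightarrow> ('m \<Rightarrow> 'm) topology" where
  "smooth_topology A = topology_generated_by
     {smooth_nhd A f c d K vs \<epsilon> | f c d K vs \<epsilon>.
        smooth_map_on A A UNIV f \<and> c \<in> A \<and> d \<in> A \<and> compact K \<and> K \<subseteq> fst c \<and> f ` K \<subseteq> fst d
        \<and> set vs \<subseteq> Basis \<and> 0 < \<epsilon>}"

definition Cont0 :: "('m::topological_space, 'e::euclidean_space) chart set \<Rightarrow> ('m, 'e) form1 \<Rightarrow> ('m \<Rightarrow> 'm) set" where
  "Cont0 A \<alpha> = connected_component_of_set
     (subtopology (smooth_topology A) (contactomorphisms A \<alpha>)) id"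

definition contact_isotopy ::
    "('m::topological_space, 'e::euclidean_space) chart set \<Rightarrow> ('m, 'e) form1 \<Rightarrow> (real \<Rightarrow> 'm \<Rightarrow> 'm) \<Rightarrow> bool" where
  "contact_isotopy A \<alpha> \<Phi> \<longleftrightarrow> \<Phi> 0 = id \<and> (\<forall>t\<in>{0..1}. \<Phi> t \<in> contactomorphisms A \<alpha>)
     \<and> smooth_map_on (prod_atlas A (euclidean_atlas :: (real, real) chart set)) A
         (UNIV \<times> {0..1}) (\<lambda>(p, t). \<Phi> t p)"

definition isotopy_field ::
    "('m, 'e::euclidean_space) chart set \<Rightarrow> (real \<Rightarrow> 'm \<Rightarrow> 'm) \<Rightarrow> real \<Rightarrow> 'm \<Rightarrow> ('m, 'e) tvec" where
  "isotopy_field A \<Phi> t q = velocity A {0..1} (\<lambda>s. \<Phi> s (inv (\<Phi> t) q)) t"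

definition contact_hamiltonian ::
    "('m, 'e::euclidean_space) chart set \<Rightarrow> ('m, 'e) form1 \<Rightarrow> (real \<Rightarrow> 'm \<Rightarrow> 'm) \<Rightarrow> real \<Rightarrow> 'm \<Rightarrow> real" where
  "contact_hamiltonian A \<alpha> \<Phi> t q = \<alpha> q (isotopy_field A \<Phi> t q)"

text \<open>On a non-compact manifold the maximum is read as a supremum, possibly infinite; an infimum
  over the empty set is infinite. Isotopies correspond bijectively to their Hamiltonians, so the
  infimum is taken over isotopies.\<close>

definition shelukhin_norm ::
    "('m::topological_space, 'e::euclidean_space) chart set \<Rightarrow> ('m, 'e) form1 \<Rightarrow> ('m \<Rightarrow> 'm) \<Rightarrow> ennreal" where
  "shelukhin_norm A \<alpha> f = (INF \<Phi>\<in>{\<Phi>. contact_isotopy A \<alpha> \<Phi> \<and> \<Phi> 1 = f}.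
     \<integral>\<^sup>+t\<in>{0..1}. (SUP q. ennreal \<bar>contact_hamiltonian A \<alpha> \<Phi> t q\<bar>) \<partial>lborel)"

definition orbit :: "('m::topological_space, 'e::euclidean_space) chart set \<Rightarrow> ('m, 'e) form1 \<Rightarrow> 'm set \<Rightarrow> 'm set set" where
  "orbit A \<alpha> N = (\<lambda>f. f ` N) ` Cont0 A \<alpha>"

definition delta ::
    "('m::topological_space, 'e::euclidean_space) chart set \<Rightarrow> ('m, 'e) form1 \<Rightarrow> 'm set \<Rightarrow> 'm set \<Rightarrow> ennreal" where
  "delta A \<alpha> L1 L2 = (INF f\<in>{f \<in> Cont0 A \<alpha>. f ` L1 = L2}. shelukhin_norm A \<alpha> f)"

definition delta_nondegenerate ::
    "('m::topological_space, 'e::euclidean_space) chart set \<Rightarrow> ('m, 'e) form1 \<Rightarrow> 'm set \<Rightarrow> bool" where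
  "delta_nondegenerate A \<alpha> N \<longleftrightarrow>
     (\<forall>L1\<in>orbit A \<alpha> N. \<forall>L2\<in>orbit A \<alpha> N. delta A \<alpha> L1 L2 = 0 \<longrightarrow> L1 = L2)"

section \<open>Submanifolds\<close>

text \<open>Embedded submanifolds without boundary, not necessarily closed as subsets, described by
  slice charts.\<close>

definition submanifold :: "('m, 'e::euclidean_space) chart set \<Rightarrow> 'm set \<Rightarrow> bool" where
  "submanifold A N \<longleftrightarrow> (\<exists>k. \<forall>p\<in>N. \<exists>c\<in>charts_at A p. \<exists>S.
     subspace S \<and> dim S = k \<and> snd c ` (fst c \<inter> N) = snd c ` fst c \<inter> S)"

text \<open>The tangent space of a submanifold consists of the velocities of the smooth curves in it.\<close>

definition sub_tangent_space ::
    "('m::topological_space, 'e::euclidean_space) chart set \<Rightarrow> 'm set \<Rightarrow> 'm \<Rightarrow> ('m, 'e) tvec set" where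
  "sub_tangent_space A N p = {velocity A {-\<epsilon><..<\<epsilon>} \<gamma> 0 | \<gamma> \<epsilon>. 0 < \<epsilon>
     \<and> smooth_map_on (euclidean_atlas :: (real, real) chart set) A {-\<epsilon><..<\<epsilon>} \<gamma>
     \<and> \<gamma> ` {-\<epsilon><..<\<epsilon>} \<subseteq> N \<and> \<gamma> 0 = p}"

definition symplectic_orth ::
    "('m, 'e::euclidean_space) chart set \<Rightarrow> ('m, 'e) form1 \<Rightarrow> 'm \<Rightarrow> ('m, 'e) tvec set \<Rightarrow> ('m, 'e) tvec set" where
  "symplectic_orth A \<alpha> p W = {v \<in> contact_plane A \<alpha> p. \<forall>w\<in>W. ext_deriv A \<alpha> p v w = 0}"

definition contact_coisotropic ::
    "('m::topological_space, 'e::euclidean_space) chart set \<Rightarrow> ('m, 'e) form1 \<Rightarrow> 'm set \<Rightarrow> bool" where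
  "contact_coisotropic A \<alpha> N \<longleftrightarrow> (\<forall>p\<in>N.
     symplectic_orth A \<alpha> p (sub_tangent_space A N p \<inter> contact_plane A \<alpha> p)
       \<subseteq> sub_tangent_space A N p \<inter> contact_plane A \<alpha> p)"

end

theory Submission imports Defs begin

text \<open>If \<open>H\<close> is a compactly supported function vanishing on \<open>N\<close>, the contact flow of \<open>H\<close> preserves
  \<open>{H = 0}\<close>, and along that set the contact field of \<open>H\<close> agrees with the one of \<open>\<epsilon> sin (H / \<epsilon>)\<close>,
  since the two functions have the same 1-jets there. Hence the time-one map of \<open>H\<close> moves \<open>N\<close> to the same
  set as an isotopy of energy at most \<open>\<epsilon>\<close>, and non-degeneracy forces the flow of \<open>H\<close> to preserve \<open>N\<close>;
  in particular its contact field is tangent to \<open>N\<close>. Every \<open>v \<in> (T\<^sub>pN \<inter> \<xi>\<^sub>p)\<^sup>\<bottom>\<close> is the value at \<open>p\<close>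
  of such a field: \<open>- d\<alpha>(v, \<cdot>)\<close> on \<open>\<xi>\<^sub>p\<close> and \<open>0\<close> on \<open>T\<^sub>pN\<close> agree on the intersection, so they
  extend to a covector, which is the differential of a function vanishing on \<open>N\<close>.\<close>

section \<open>Smooth functions and families\<close>


text \<open>The definitions shape the work. A contact isotopy must be smooth jointly in time and
  point, a member of \<open>Cont0\<close> must be joined to the identity inside the smooth topology,
  and a tangent vector of \<open>N\<close> is the velocity of a curve on an open interval around 0.
  So the flow of \<open>H\<close> has to be jointly smooth, for negative times too; this is drawn
  from smooth dependence of solutions of differential equations on initial values. The manifold may
  be non-compact, so \<open>H\<close> is supported in a compact part of one chart near the given
  point: its field then has a global flow and bounded energy, and everything up to the extension by
  the identity is calculus on an open subset of Euclidean space. Sine has two separate roles. In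
  \<open>\<epsilon> * sin (H / \<epsilon>)\<close> it is a bounded smooth function with value 0 and
  derivative 1 at 0. In \<open>flow\<close> it reparametrises time: \<open>flow s\<close> moves by
  \<open>sin s\<close>, so the time-one map of the overview is in truth the map of time
  \<open>sin 1\<close>, and multiples of \<open>H\<close> account for all other times.\<close>

abbreviation ddir :: "('a::real_normed_vector \<Rightarrow> 'b::real_normed_vector) \<Rightarrow> 'a \<Rightarrow> 'a \<Rightarrow> 'b" where
  "ddir f x v \<equiv> frechet_derivative f (at x) v"

text \<open>\<open>ck k T W f\<close>: all directional derivatives of \<open>f t\<close> of order up to \<open>k\<close> exist on \<open>W\<close> and are
  continuous in \<open>(t, x)\<close>; nothing is said about derivatives in \<open>t\<close>.\<close>

primrec ck :: "nat \<Rightarrow> real set \<Rightarrow> 'a::euclidean_space set \<Rightarrow> (real \<Rightarrow> 'a \<Rightarrow> 'b::euclidean_space) \<Rightarrow> bool" where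
  "ck 0 T W f \<longleftrightarrow> continuous_on (T \<times> W) (\<lambda>p. f (fst p) (snd p))"
| "ck (Suc k) T W f \<longleftrightarrow> continuous_on (T \<times> W) (\<lambda>p. f (fst p) (snd p))
     \<and> (\<forall>t\<in>T. \<forall>x\<in>W. f t differentiable (at x)) \<and> (\<forall>v. ck k T W (\<lambda>t x. ddir (f t) x v))"

lemma ck_cont: "ck k T W f \<Longrightarrow> continuous_on (T \<times> W) (\<lambda>p. f (fst p) (snd p))"
  by (cases k) auto

lemma ck_ddir: "ck (Suc k) T W f \<Longrightarrow> ck k T W (\<lambda>t x. ddir (f t) x v)"
  by simp

lemma ck_hd: "ck (Suc k) T W f \<Longrightarrow> t \<in> T \<Longrightarrow> x \<in> W \<Longrightarrow> (f t has_derivative ddir (f t) x) (at x)"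
  by (simp add: frechet_derivative_works)

lemma ck_cong:
  assumes "open W" "\<And>t x. t \<in> T \<Longrightarrow> x \<in> W \<Longrightarrow> f t x = g t x" "ck k T W f"
  shows "ck k T W g"
  using assms(2,3)
proof (induction k arbitrary: f g)
  case 0
  have "continuous_on (T \<times> W) (\<lambda>p. f (fst p) (snd p)) \<longleftrightarrow> continuous_on (T \<times> W) (\<lambda>p. g (fst p) (snd p))"
    by (rule continuous_on_cong) (use 0 in auto)
  then show ?case using 0 by simp
next
  case (Suc k)
  have c: "continuous_on (T \<times> W) (\<lambda>p. f (fst p) (snd p)) \<longleftrightarrow> continuous_on (T \<times> W) (\<lambda>p. g (fst p) (snd p))"
    by (rule continuous_on_cong) (use Suc in auto)
  have d: "(g t has_derivative ddir (f t) x) (at x)" if "t \<in> T" "x \<in> W" for t x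
    using ck_hd[OF Suc.prems(2) that] has_derivative_transform_within_open[OF _ assms(1) that(2)] Suc.prems(1)[OF that(1)]
    by blast
  then have e: "ddir (g t) x = ddir (f t) x" if "t \<in> T" "x \<in> W" for t x
    using frechet_derivative_at[OF d[OF that]] by simp
  have "ck k T W (\<lambda>t x. ddir (g t) x v)" for v
    by (rule Suc.IH[of "\<lambda>t x. ddir (f t) x v"]) (use e Suc.prems in auto)
  then show ?case using c d Suc.prems by (auto simp: differentiable_def)
qed

text \<open>Derivatives arise in closed form, while \<open>ddir\<close> is a choice operator;
  uniqueness of the derivative lets any explicit formula \<open>f'\<close> serve in its
  place.\<close>

lemma ck_SucI:
  assumes "open W" "continuous_on (T \<times> W) (\<lambda>p. f (fst p) (snd p))"
    "\<And>t x. t \<in> T \<Longrightarrow> x \<in> W \<Longrightarrow> (f t has_derivative f' t x) (at x)"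
    "\<And>v. ck k T W (\<lambda>t x. f' t x v)"
  shows "ck (Suc k) T W f"
proof -
  have e: "ddir (f t) x = f' t x" if "t \<in> T" "x \<in> W" for t x
    using frechet_derivative_at[OF assms(3)[OF that]] by simp
  have "ck k T W (\<lambda>t x. ddir (f t) x v)" for v
    by (rule ck_cong[OF assms(1) _ assms(4)[of v]]) (use e in auto)
  then show ?thesis using assms by (auto simp: differentiable_def)
qed

lemma ck_Suc_imp: "ck (Suc k) T W f \<Longrightarrow> ck k T W f"
proof (induction k arbitrary: f)
  case (Suc k)
  have "ck k T W (\<lambda>t x. ddir (f t) x v)" for v
    by (rule Suc.IH[OF ck_ddir[OF Suc.prems]])
  moreover have "\<forall>t\<in>T. \<forall>x\<in>W. f t differentiable (at x)" using Suc.prems by simp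
  ultimately show ?case using ck_cont[OF Suc.prems] by simp
qed simp

lemma ck_mono: "ck k T W f \<Longrightarrow> j \<le> k \<Longrightarrow> ck j T W f"
proof (induction k)
  case (Suc k) then show ?case by (metis ck_Suc_imp le_SucE)
qed simp

lemma ck_subset: "ck k T W f \<Longrightarrow> T' \<subseteq> T \<Longrightarrow> W' \<subseteq> W \<Longrightarrow> ck k T' W' f"
proof (induction k arbitrary: f)
  case 0 then show ?case by (auto intro: continuous_on_subset)
next
  case (Suc k)
  have "continuous_on (T' \<times> W') (\<lambda>p. f (fst p) (snd p))"
    using Suc.prems by (auto intro: continuous_on_subset[of "T \<times> W"])
  moreover have "ck k T' W' (\<lambda>t x. ddir (f t) x v)" for v
    by (rule Suc.IH[OF ck_ddir[OF Suc.prems(1)] Suc.prems(2,3)])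
  moreover have "\<forall>t\<in>T. \<forall>x\<in>W. f t differentiable (at x)" using Suc.prems(1) by simp
  ultimately show ?case using Suc.prems(2,3) by (auto simp: subset_iff)
qed

lemma ck_const: "open W \<Longrightarrow> ck k T W (\<lambda>t x. c)"
proof (induction k arbitrary: c)
  case (Suc k) then show ?case by (auto intro!: ck_SucI[where f'="\<lambda>t x v. 0"])
qed simp

lemma ck_bounded_linear: 
  assumes "bounded_linear L" "open W"
  shows "ck k T W (\<lambda>t. L)"
proof (cases k)
  case 0
  then show ?thesis
    by (auto intro!: bounded_linear.continuous_on[OF assms(1)] continuous_on_snd continuous_on_id)
next
  case (Suc j)
  show ?thesis unfolding Suc
    by (rule ck_SucI[where f'="\<lambda>t x. L", OF assms(2)])
      (auto intro!: bounded_linear.continuous_on[OF assms(1)] bounded_linear_imp_has_derivative[OF assms(1)] continuous_on_snd continuous_on_id ck_const assms(2))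
qed

lemma ck_id: "open W \<Longrightarrow> ck k T W (\<lambda>t x. x)"
  by (rule ck_bounded_linear[OF bounded_linear_ident])

lemma ck_add:
  assumes "open W" "ck k T W f" "ck k T W g"
  shows "ck k T W (\<lambda>t x. f t x + g t x)"
  using assms(2,3)
proof (induction k arbitrary: f g)
  case 0 then show ?case by (auto intro!: continuous_intros)
next
  case (Suc k)
  show ?case
  proof (rule ck_SucI[OF assms(1)])
    show "continuous_on (T \<times> W) (\<lambda>p. f (fst p) (snd p) + g (fst p) (snd p))"
      using Suc.prems[THEN ck_cont] by (rule continuous_on_add)
    show "((\<lambda>x. f t x + g t x) has_derivative (\<lambda>v. ddir (f t) x v + ddir (g t) x v)) (at x)"
      if "t \<in> T" "x \<in> W" for t x
      using Suc.prems[THEN ck_hd, OF that] by (rule has_derivative_add)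
    show "ck k T W (\<lambda>t x. ddir (f t) x v + ddir (g t) x v)" for v
      using Suc by simp
  qed
qed

lemma ck_linear_comp:
  assumes "open W" "bounded_linear L" "ck k T W f"
  shows "ck k T W (\<lambda>t x. L (f t x))"
  using assms(3)
proof (induction k arbitrary: f)
  case 0 then show ?case by (auto intro!: bounded_linear.continuous_on[OF assms(2)])
next
  case (Suc k)
  show ?case
  proof (rule ck_SucI[OF assms(1)])
    show "continuous_on (T \<times> W) (\<lambda>p. L (f (fst p) (snd p)))"
      using Suc.prems[THEN ck_cont] by (rule bounded_linear.continuous_on[OF assms(2)])
    show "((\<lambda>x. L (f t x)) has_derivative (\<lambda>v. L (ddir (f t) x v))) (at x)"
      if "t \<in> T" "x \<in> W" for t x
      using Suc.prems[THEN ck_hd, OF that] by (rule bounded_linear.has_derivative[OF assms(2)])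
    show "ck k T W (\<lambda>t x. L (ddir (f t) x v))" for v
      using Suc by simp
  qed
qed

lemma ck_bilinear:
  assumes "open W" "bounded_bilinear B" "ck k T W f" "ck k T W g"
  shows "ck k T W (\<lambda>t x. B (f t x) (g t x))"
  using assms(3,4)
proof (induction k arbitrary: f g)
  case 0 then show ?case by (auto intro!: bounded_bilinear.continuous_on[OF assms(2)])
next
  case (Suc k)
  show ?case
  proof (rule ck_SucI[OF assms(1)])
    show "continuous_on (T \<times> W) (\<lambda>p. B (f (fst p) (snd p)) (g (fst p) (snd p)))"
      using Suc.prems[THEN ck_cont] by (rule bounded_bilinear.continuous_on[OF assms(2)])
    show "((\<lambda>x. B (f t x) (g t x)) has_derivative (\<lambda>v. B (f t x) (ddir (g t) x v) + B (ddir (f t) x v) (g t x))) (at x)"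
      if "t \<in> T" "x \<in> W" for t x
      using Suc.prems[THEN ck_hd, OF that] by (rule bounded_bilinear.FDERIV[OF assms(2)])
    have "ck k T W f" "ck k T W g" using Suc.prems ck_Suc_imp by blast+
    then show "ck k T W (\<lambda>t x. B (f t x) (ddir (g t) x v) + B (ddir (f t) x v) (g t x))" for v
      using Suc by (intro ck_add assms(1) Suc.IH) auto
  qed
qed

lemmas ck_scaleR = ck_bilinear[OF _ bounded_bilinear_scaleR]
lemmas ck_mult = ck_bilinear[OF _ bounded_bilinear_mult]
lemmas ck_inner = ck_bilinear[OF _ bounded_bilinear_inner]
lemmas ck_minus = ck_linear_comp[OF _ bounded_linear_minus[OF bounded_linear_ident]]

lemma ck_diff:
  assumes "open W" "ck k T W f" "ck k T W g"
  shows "ck k T W (\<lambda>t x. f t x - g t x)"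
  using ck_add[OF assms(1,2) ck_minus[OF assms(1,3)]] by simp

lemma ck_sum:
  assumes "open W" "finite I" "\<And>i. i \<in> I \<Longrightarrow> ck k T W (f i)"
  shows "ck k T W (\<lambda>t x. \<Sum>i\<in>I. f i t x)"
  using assms(2,3)
  by (induction I rule: finite_induct) (auto intro!: ck_const ck_add assms(1))

lemma ck_Pair:
  assumes "open W" "ck k T W f" "ck k T W g"
  shows "ck k T W (\<lambda>t x. (f t x, g t x))"
  using ck_add[OF assms(1) ck_linear_comp[OF assms(1) _ assms(2), of "\<lambda>y. (y,0)"]
      ck_linear_comp[OF assms(1) _ assms(3), of "\<lambda>y. (0,y)"]]
  by (simp add: bounded_linear_Pair bounded_linear_ident bounded_linear_zero)

text \<open>\<open>ck\<close> controls derivatives in fixed directions only. The expansion turns a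
  derivative in a direction that varies with the point into a finite sum of products of controlled
  functions; \<open>ck_compose\<close> and \<open>variational_ck\<close> rely on it.\<close>

lemma ddir_basis:
  assumes "f differentiable (at x)"
  shows "ddir f x v = (\<Sum>b\<in>Basis. (v \<bullet> b) *\<^sub>R ddir f x b)"
proof -
  have "linear (ddir f x)" using assms by (rule linear_frechet_derivative)
  then have "ddir f x (\<Sum>b\<in>Basis. (v \<bullet> b) *\<^sub>R b) = (\<Sum>b\<in>Basis. (v \<bullet> b) *\<^sub>R ddir f x b)"
    by (simp add: linear_sum linear_scale)
  then show ?thesis by (simp add: euclidean_representation)
qed

lemma linear_bound_basis:
  fixes f :: "'a::euclidean_space \<Rightarrow> 'b::real_normed_vector"
  assumes f: "linear f" and C: "\<And>b. b \<in> Basis \<Longrightarrow> norm (f b) \<le> C b"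
  shows "norm (f v) \<le> (\<Sum>b\<in>Basis. C b) * norm v"
proof -
  have "f v = (\<Sum>b\<in>Basis. (v \<bullet> b) *\<^sub>R f b)"
    using linear_sum[OF f, of "\<lambda>b. (v \<bullet> b) *\<^sub>R b" Basis] linear_scale[OF f]
    by (simp add: euclidean_representation)
  also have "norm \<dots> \<le> (\<Sum>b\<in>(Basis::'a set). norm v * C b)"
    by (rule sum_norm_le) (auto intro!: mult_mono C Basis_le_norm)
  also have "\<dots> = (\<Sum>b\<in>Basis. C b) * norm v" by (simp add: sum_distrib_left mult.commute)
  finally show ?thesis .
qed

lemma ck_compose:
  fixes f :: "real \<Rightarrow> 'a::euclidean_space \<Rightarrow> 'b::euclidean_space" and g :: "real \<Rightarrow> 'b \<Rightarrow> 'c::euclidean_space"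
  assumes "open W" "open Y" "ck k T Y g" "ck k T W f" "\<And>t x. t \<in> T \<Longrightarrow> x \<in> W \<Longrightarrow> f t x \<in> Y"
  shows "ck k T W (\<lambda>t x. g t (f t x))"
  using assms(3,4)
proof (induction k arbitrary: g)
  case 0
  have "continuous_on (T \<times> W) ((\<lambda>p. g (fst p) (snd p)) \<circ> (\<lambda>p. (fst p, f (fst p) (snd p))))"
    by (rule continuous_on_compose)
      (use 0 assms(5) in \<open>auto intro!: continuous_intros continuous_on_subset[where s="T \<times> Y"]\<close>)
  then show ?case by (simp add: o_def)
next
  case (Suc k)
  have fk: "ck k T W f" using Suc.prems ck_Suc_imp by blast
  have gk: "ck k T Y g" using Suc.prems ck_Suc_imp by blast
  have c: "continuous_on (T \<times> W) ((\<lambda>p. g (fst p) (snd p)) \<circ> (\<lambda>p. (fst p, f (fst p) (snd p))))"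
    by (rule continuous_on_compose)
      (use Suc.prems[THEN ck_cont] assms(5) in \<open>auto intro!: continuous_intros continuous_on_subset[where s="T \<times> Y"]\<close>)
  show ?case
  proof (rule ck_SucI[OF assms(1)])
    show "continuous_on (T \<times> W) (\<lambda>p. g (fst p) (f (fst p) (snd p)))"
      using c by (simp add: o_def)
    show "((\<lambda>x. g t (f t x)) has_derivative
       (\<lambda>v. \<Sum>b\<in>Basis. (ddir (f t) x v \<bullet> b) *\<^sub>R ddir (g t) (f t x) b)) (at x)"
      if "t \<in> T" "x \<in> W" for t x
    proof -
      have "((\<lambda>x. g t (f t x)) has_derivative (\<lambda>v. ddir (g t) (f t x) (ddir (f t) x v))) (at x)"
        using has_derivative_compose[OF ck_hd[OF Suc.prems(2) that] ck_hd[OF Suc.prems(1) that(1) assms(5)[OF that]]] .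
      moreover have "g t differentiable at (f t x)" using Suc.prems(1) that assms(5) by simp
      ultimately show ?thesis by (subst (asm) ddir_basis) auto
    qed
    show "ck k T W (\<lambda>t x. \<Sum>b\<in>Basis. (ddir (f t) x v \<bullet> b) *\<^sub>R ddir (g t) (f t x) b)" for v
      using Suc.prems fk by (intro ck_sum ck_scaleR ck_inner ck_const assms(1) Suc.IH) auto
  qed
qed

text \<open>A constant family over a dummy time set, so that the closure properties of
  \<open>ck\<close> carry over. Openness is part of the notion because derivatives are taken in a
  full neighbourhood.\<close>

definition sm :: "'a::euclidean_space set \<Rightarrow> ('a \<Rightarrow> 'b::euclidean_space) \<Rightarrow> bool" where
  "sm W f \<longleftrightarrow> open W \<and> (\<forall>k. ck k UNIV W (\<lambda>_. f))"

lemma sm_open: "sm W f \<Longrightarrow> open W"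
  by (simp add: sm_def)

lemma sm_ck: "sm W f \<Longrightarrow> ck k T W (\<lambda>_. f)"
  using ck_subset unfolding sm_def by blast

lemma sm_hd: "sm W f \<Longrightarrow> x \<in> W \<Longrightarrow> (f has_derivative ddir f x) (at x)"
  using ck_hd[of 0 UNIV W "\<lambda>_. f"] by (auto simp: sm_def simp del: ck.simps)

lemma sm_differentiable: "sm W f \<Longrightarrow> x \<in> W \<Longrightarrow> f differentiable (at x)"
  using sm_hd differentiable_def by blast

lemma sm_ddir: "sm W f \<Longrightarrow> sm W (\<lambda>x. ddir f x v)"
  unfolding sm_def using ck_ddir by blast

lemma sm_subset: "sm W f \<Longrightarrow> open W' \<Longrightarrow> W' \<subseteq> W \<Longrightarrow> sm W' f"
  unfolding sm_def by (meson ck_subset subset_refl)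

lemma sm_cong: "sm W f \<Longrightarrow> (\<And>x. x \<in> W \<Longrightarrow> f x = g x) \<Longrightarrow> sm W g"
  unfolding sm_def using ck_cong[where f="\<lambda>_. f" and g="\<lambda>_. g"] by blast

lemma sm_continuous_on: "sm W f \<Longrightarrow> continuous_on W f"
  by (meson differentiable_imp_continuous_on differentiable_at_imp_differentiable_on sm_differentiable)

lemma sm_const: "open W \<Longrightarrow> sm W (\<lambda>x. c)"
  by (simp add: sm_def ck_const)

lemma sm_bounded_linear: "bounded_linear L \<Longrightarrow> open W \<Longrightarrow> sm W L"
  by (simp add: sm_def ck_bounded_linear)

lemma sm_ident: "open W \<Longrightarrow> sm W (\<lambda>x. x)"
  by (simp add: sm_bounded_linear)

lemma sm_add: "sm W f \<Longrightarrow> sm W g \<Longrightarrow> sm W (\<lambda>x. f x + g x)"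
  by (simp add: sm_def ck_add)

lemma sm_diff: "sm W f \<Longrightarrow> sm W g \<Longrightarrow> sm W (\<lambda>x. f x - g x)"
  by (simp add: sm_def ck_diff)

lemma sm_minus: "sm W f \<Longrightarrow> sm W (\<lambda>x. - f x)"
  by (simp add: sm_def ck_minus)

lemma sm_sum: "open W \<Longrightarrow> finite I \<Longrightarrow> (\<And>i. i \<in> I \<Longrightarrow> sm W (f i)) \<Longrightarrow> sm W (\<lambda>x. \<Sum>i\<in>I. f i x)"
  by (simp add: sm_def ck_sum)

lemma sm_bilinear: "bounded_bilinear B \<Longrightarrow> sm W f \<Longrightarrow> sm W g \<Longrightarrow> sm W (\<lambda>x. B (f x) (g x))"
  unfolding sm_def using ck_bilinear[where f="\<lambda>_. f" and g="\<lambda>_. g"] by blast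

lemmas sm_scaleR = sm_bilinear[OF bounded_bilinear_scaleR]
lemmas sm_mult = sm_bilinear[OF bounded_bilinear_mult]
lemmas sm_inner = sm_bilinear[OF bounded_bilinear_inner]

lemma sm_Pair: "sm W f \<Longrightarrow> sm W g \<Longrightarrow> sm W (\<lambda>x. (f x, g x))"
  by (simp add: sm_def ck_Pair)

lemma sm_compose:
  "sm Y g \<Longrightarrow> sm W f \<Longrightarrow> (\<And>x. x \<in> W \<Longrightarrow> f x \<in> Y) \<Longrightarrow> sm W (\<lambda>x. g (f x))"
  unfolding sm_def using ck_compose[where Y=Y and g="\<lambda>_. g" and f="\<lambda>_. f"] by blast

lemma sm_linear_comp: "bounded_linear L \<Longrightarrow> sm W f \<Longrightarrow> sm W (\<lambda>x. L (f x))"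
  by (rule sm_compose[OF sm_bounded_linear[where W=UNIV]]) auto

text \<open>The induction generalises \<open>f\<close>: by \<open>sm_ddir\<close> a directional
  derivative satisfies the same local hypothesis on the same neighbourhoods.\<close>

lemma sm_local:
  assumes "open W" "\<And>x. x \<in> W \<Longrightarrow> \<exists>Y. x \<in> Y \<and> sm Y f"
  shows "sm W f"
proof -
  have c: "continuous_on (UNIV \<times> W) (\<lambda>p :: real \<times> 'a. f (snd p))"
    if "\<And>x. x \<in> W \<Longrightarrow> \<exists>Y. x \<in> Y \<and> sm Y f" for f :: "'a \<Rightarrow> 'b"
  proof -
    have "continuous_on W f"
    proof (rule continuous_at_imp_continuous_on, rule ballI)
      fix x assume "x \<in> W"
      with that obtain Y where "x \<in> Y" "sm Y f" by blast
      then show "isCont f x" using sm_hd has_derivative_continuous by blast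
    qed
    then show ?thesis by (auto intro!: continuous_on_compose2[of W f] continuous_intros)
  qed
  have "ck k UNIV W (\<lambda>_. f)" for k
    using assms(2)
  proof (induction k arbitrary: f)
    case 0
    then show ?case using c by simp
  next
    case (Suc k)
    have "ck k UNIV W (\<lambda>_ x. ddir f x v)" for v
      by (rule Suc.IH) (use Suc.prems sm_ddir in blast)
    moreover have "f differentiable (at x)" if "x \<in> W" for x
      using Suc.prems[OF that] sm_differentiable by blast
    ultimately show ?case using c[OF Suc.prems] by simp
  qed
  then show ?thesis using assms(1) by (simp add: sm_def)
qed

text \<open>\<open>W\<close> and the complement of \<open>K\<close> form an open cover, and
  \<open>f\<close> is smooth on both. In this way Hamiltonians, their fields and conformal
  exponents, built near one point, become functions on the whole coordinate space.\<close>

lemma sm_extend_zero: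
  assumes f: "sm W f" and K: "closed K" "K \<subseteq> W" and off: "\<And>x. x \<notin> K \<Longrightarrow> f x = 0"
  shows "sm UNIV f"
proof (rule sm_local)
  have "open (- K)" using K(1) by auto
  then have "sm (- K) f" by (rule sm_cong[OF sm_const]) (simp add: off)
  then show "\<exists>Y. x \<in> Y \<and> sm Y f" for x
    using f K(2) by (cases "x \<in> W") blast+
qed simp

text \<open>The head of the list in \<open>iter_deriv\<close> is the outermost derivative, whereas
  \<open>ck\<close> recurses on the innermost one. Peeling the list from its end matches the two
  recursions.\<close>

lemma iter_deriv_append: "iter_deriv (vs @ [v]) f = iter_deriv vs (\<lambda>x. ddir f x v)"
  by (induction vs) auto

lemma sm_iter_deriv: "sm W f \<Longrightarrow> sm W (iter_deriv vs f)"
  by (induction vs) (auto simp: sm_ddir)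

lemma sm_iff_iter_deriv:
  assumes "open W"
  shows "sm W f \<longleftrightarrow> (\<forall>vs. \<forall>y\<in>W. iter_deriv vs f differentiable (at y))"
proof
  show "sm W f \<Longrightarrow> \<forall>vs. \<forall>y\<in>W. iter_deriv vs f differentiable (at y)"
    using sm_differentiable[OF sm_iter_deriv] by blast
next
  assume a: "\<forall>vs. \<forall>y\<in>W. iter_deriv vs f differentiable (at y)"
  have "ck k UNIV W (\<lambda>_. f)" for k
    using a
  proof (induction k arbitrary: f)
    case 0
    have "continuous_on W f"
      using 0[THEN spec, of "[]"] by (simp add: continuous_at_imp_continuous_on differentiable_imp_continuous_within)
    then have "continuous_on (UNIV \<times> W) (\<lambda>p. f (snd p))"
      by (auto intro!: continuous_on_compose2[of W f] continuous_intros)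
    then show ?case by simp
  next
    case (Suc k)
    have d: "\<forall>y\<in>W. f differentiable at y" using Suc.prems[THEN spec, of "[]"] by simp
    then have "continuous_on W f"
      by (simp add: continuous_at_imp_continuous_on differentiable_imp_continuous_within)
    then have c: "continuous_on (UNIV \<times> W) (\<lambda>p. f (snd p))"
      by (auto intro!: continuous_on_compose2[of W f] continuous_intros)
    have "ck k UNIV W (\<lambda>_ x. ddir f x v)" for v
      by (rule Suc.IH) (use Suc.prems in \<open>auto simp: iter_deriv_append[symmetric]\<close>)
    with c d show ?case by simp
  qed
  then show "sm W f" using assms by (simp add: sm_def)
qed

lemma smooth_on_open_iff:
  assumes "open S"
  shows "smooth_on S f \<longleftrightarrow> sm S f"
proof
  assume "sm S f"
  then have *: "\<forall>vs. \<forall>y\<in>S. iter_deriv vs f differentiable (at y)"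
    unfolding sm_iff_iter_deriv[OF assms] .
  show "smooth_on S f" unfolding smooth_on_def
  proof (rule ballI, rule exI[where x=S], rule exI[where x=f], intro conjI)
    show "\<forall>vs. \<forall>y\<in>S. iter_deriv vs f differentiable (at y)" by (rule *)
  qed (rule assms | assumption | (rule ballI, rule refl))+
next
  assume a: "smooth_on S f"
  show "sm S f"
  proof (rule sm_local[OF assms])
    fix x assume "x \<in> S"
    from bspec[OF a[unfolded smooth_on_def] this]
    obtain W g where W: "open W" "x \<in> W" "\<forall>vs. \<forall>y\<in>W. iter_deriv vs g differentiable (at y)"
      "\<forall>y\<in>S \<inter> W. f y = g y" by (elim exE conjE) (rule that)
    have "sm W g" using W(3) unfolding sm_iff_iter_deriv[OF W(1)] .
    then have "sm (S \<inter> W) f"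
      using sm_cong[of "S \<inter> W" g f] sm_subset[of W g "S \<inter> W"] W assms by auto
    then show "\<exists>Y. x \<in> Y \<and> sm Y f" using W \<open>x \<in> S\<close> by blast
  qed
qed

lemma smooth_onI:
  assumes "\<And>x. x \<in> S \<Longrightarrow> \<exists>W g. x \<in> W \<and> sm W g \<and> (\<forall>y\<in>S \<inter> W. f y = g y)"
  shows "smooth_on S f"
  unfolding smooth_on_def
proof
  fix x assume "x \<in> S"
  from assms[OF this]
  obtain W g where g: "x \<in> W" "sm W g" "\<forall>y\<in>S \<inter> W. f y = g y" by (elim exE conjE) (rule that)
  have *: "\<forall>vs. \<forall>y\<in>W. iter_deriv vs g differentiable (at y)"
    using g(2) unfolding sm_iff_iter_deriv[OF sm_open[OF g(2)]] .
  show "\<exists>W g. open W \<and> x \<in> W \<and> (\<forall>vs. \<forall>y\<in>W. iter_deriv vs g differentiable (at y))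
      \<and> (\<forall>y\<in>S \<inter> W. f y = g y)"
  proof (rule exI[where x=W], rule exI[where x=g], intro conjI)
    show "\<forall>vs. \<forall>y\<in>W. iter_deriv vs g differentiable (at y)" by (rule *)
  qed (rule g sm_open[OF g(2)])+
qed

text \<open>Differentiability does not enter: functions that agree near \<open>x\<close> have the
  same candidate derivatives there, so the choice operator behind \<open>frechet_derivative\<close>
  returns the same map.\<close>

lemma iter_deriv_cong:
  assumes "open W" "\<And>x. x \<in> W \<Longrightarrow> f x = g x" "x \<in> W"
  shows "iter_deriv vs f x = iter_deriv vs g x"
  using assms(3)
proof (induction vs arbitrary: x)
  case (Cons v vs)
  have "(iter_deriv vs f has_derivative d) (at x) \<longleftrightarrow> (iter_deriv vs g has_derivative d) (at x)" for d
    using has_derivative_transform_within_open[OF _ assms(1) Cons.prems] Cons.IH by metis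
  then show ?case by (simp add: frechet_derivative_def)
qed (use assms in auto)

text \<open>The span of sine and cosine is closed under differentiation, so the induction on the
  order closes once \<open>a\<close> and \<open>b\<close> are arbitrary.\<close>

lemma sm_sin_cos: "sm UNIV (\<lambda>x::real. a * sin x + b * cos x)"
proof -
  have "ck k UNIV UNIV (\<lambda>_ x::real. a * sin x + b * cos x)" for k
  proof (induction k arbitrary: a b)
    case 0 show ?case by (auto intro!: continuous_intros)
  next
    case (Suc k)
    show ?case
    proof (rule ck_SucI)
      show "ck k UNIV UNIV (\<lambda>_ x. (- b * v) * sin x + (a * v) * cos x)" for v
        by (rule Suc)
      show "((\<lambda>x. a * sin x + b * cos x) has_derivative (\<lambda>v. (- b * v) * sin x + (a * v) * cos x)) (at x)" for x
        by (auto intro!: derivative_eq_intros simp: algebra_simps)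
    qed (auto intro!: continuous_intros)
  qed
  then show ?thesis by (simp add: sm_def)
qed

lemma sm_sin: "sm UNIV (sin :: real \<Rightarrow> real)"
  using sm_sin_cos[of 1 0] by simp

lemma sm_inverse: "sm (- {0}) (inverse :: real \<Rightarrow> real)"
proof -
  have o: "open (- {0::real})" by auto
  have "ck k UNIV (- {0}) (\<lambda>_. inverse :: real \<Rightarrow> real)" for k
  proof (induction k)
    case 0 show ?case by (auto intro!: continuous_intros)
  next
    case (Suc k)
    show ?case
    proof (rule ck_SucI[OF o])
      show "(inverse has_derivative (\<lambda>v. - (inverse x * v * inverse x))) (at x)" if "x \<in> - {0}" for x :: real
        using that by (auto intro!: derivative_eq_intros)
      show "ck k UNIV (- {0}) (\<lambda>t x. - (inverse x * v * inverse x))" for v :: real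
        by (intro ck_minus ck_mult ck_const o Suc)
    qed (auto intro!: continuous_intros)
  qed
  then show ?thesis by (simp add: sm_def o)
qed

lemma sm_ln: "sm {0<..} (ln :: real \<Rightarrow> real)"
proof -
  have i: "sm {0<..} (inverse :: real \<Rightarrow> real)" using sm_subset[OF sm_inverse] by auto
  have "ck k UNIV {0<..} (\<lambda>_. ln :: real \<Rightarrow> real)" for k
  proof (cases k)
    case 0 then show ?thesis by (auto intro!: continuous_intros)
  next
    case (Suc j)
    show ?thesis unfolding Suc
    proof (rule ck_SucI)
      show "(ln has_derivative (\<lambda>v. inverse x * v)) (at x)" if "x \<in> {0<..}" for x :: real
        using that by (auto intro!: derivative_eq_intros simp: field_simps)
      show "ck j UNIV {0<..} (\<lambda>t x. inverse x * v)" for v :: real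
        by (intro ck_mult ck_const sm_ck i) auto
    qed (auto intro!: continuous_intros)
  qed
  then show ?thesis by (simp add: sm_def)
qed


section \<open>Smooth dependence of solutions of differential equations\<close>

definition ode_sol :: "(real \<Rightarrow> 'a::euclidean_space \<Rightarrow> 'a) \<Rightarrow> (real \<Rightarrow> 'a) \<Rightarrow> bool" where
  "ode_sol f u \<longleftrightarrow> (\<forall>t\<in>{0..1}. (u has_vector_derivative f t (u t)) (at t within {0..1}))"

lemma ode_solD: "ode_sol f u \<Longrightarrow> t \<in> {0..1} \<Longrightarrow> (u has_vector_derivative f t (u t)) (at t within {0..1})"
  by (simp add: ode_sol_def)

lemma ode_sol_continuous: "ode_sol f u \<Longrightarrow> continuous_on {0..1} u"
  unfolding ode_sol_def continuous_on_eq_continuous_within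
  using has_vector_derivative_continuous by blast

text \<open>The norm is not differentiable at 0, so its square is used:
  \<open>exp (- ((2*L+1) * t)) * (w t \<bullet> w t + e^2)\<close> does not increase, because
  \<open>2 * norm (w t) * e\<close> is at most \<open>(norm (w t))^2 + e^2\<close>. Rounding
  \<open>2*L+1\<close> up to \<open>2*(L+1)\<close> before taking the square root gives the constant
  \<open>exp (L + 1)\<close>.\<close>

lemma gronwall:
  fixes w w' :: "real \<Rightarrow> 'a::euclidean_space"
  assumes w: "\<And>t. t \<in> {0..1} \<Longrightarrow> (w has_vector_derivative w' t) (at t within {0..1})"
    and le: "\<And>t. t \<in> {0..1} \<Longrightarrow> norm (w' t) \<le> L * norm (w t) + e"
    and L: "L \<ge> 0" and e: "e \<ge> 0" and i: "norm (w 0) \<le> e0" and t: "t \<in> {0..1}"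
  shows "norm (w t) \<le> exp (L + 1) * (e0 + e)"
proof -
  define u where "u = (\<lambda>t. exp (- ((2*L+1) * t)) * (w t \<bullet> w t + e\<^sup>2))"
  define u' where "u' = (\<lambda>t. exp (- ((2*L+1) * t)) * (2 * (w t \<bullet> w' t) - (2*L+1) * (w t \<bullet> w t + e\<^sup>2)))"
  have d: "(u has_derivative (\<lambda>h. h * u' s)) (at s within {0..t})" if "0 \<le> s" "s \<le> t" for s
  proof -
    have s: "s \<in> {0..1}" using that t by auto
    have "(w has_derivative (\<lambda>h. h *\<^sub>R w' s)) (at s within {0..t})"
      using has_derivative_subset[OF w[OF s, unfolded has_vector_derivative_def], of "{0..t}"] t by auto
    then show ?thesis unfolding u_def u'_def
      by (auto intro!: derivative_eq_intros simp: algebra_simps inner_commute)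
  qed
  have "0 \<le> t" using t by auto
  from mvt_very_simple[OF this d]
  obtain s where s: "s \<in> {0..t}" "u t - u 0 = t * u' s" by (auto simp: mult.commute)
  then have s1: "s \<in> {0..1}" using t by auto
  have "2 * (w s \<bullet> w' s) \<le> 2 * (norm (w s) * norm (w' s))" using Cauchy_Schwarz_ineq2[of "w s" "w' s"] by linarith
  also have "\<dots> \<le> 2 * (norm (w s) * (L * norm (w s) + e))"
    using le[OF s1] by (simp add: mult_left_mono)
  also have "\<dots> = 2 * L * (norm (w s))\<^sup>2 + 2 * norm (w s) * e" by (simp add: power2_eq_square algebra_simps)
  also have "\<dots> \<le> 2 * L * (norm (w s))\<^sup>2 + (norm (w s))\<^sup>2 + e\<^sup>2"
    using sum_squares_bound[of "norm (w s)" e] by simp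
  also have "\<dots> \<le> (2*L+1) * ((norm (w s))\<^sup>2 + e\<^sup>2)"
    using L by (simp add: algebra_simps)
  finally have "u' s \<le> 0"
    unfolding u'_def by (simp add: mult_nonneg_nonpos power2_norm_eq_inner)
  then have "u t \<le> u 0" using s(2) mult_nonneg_nonpos[OF \<open>0 \<le> t\<close>, of "u' s"] by linarith
  then have "exp ((2*L+1)*t) * u t \<le> exp ((2*L+1)*t) * u 0" by simp
  moreover have "exp ((2*L+1)*t) * u t = (norm (w t))\<^sup>2 + e\<^sup>2"
    unfolding u_def by (simp add: exp_minus power2_norm_eq_inner)
  moreover have "u 0 = (norm (w 0))\<^sup>2 + e\<^sup>2"
    unfolding u_def by (simp add: power2_norm_eq_inner)
  ultimately have "(norm (w t))\<^sup>2 + e\<^sup>2 \<le> exp ((2*L+1)*t) * ((norm (w 0))\<^sup>2 + e\<^sup>2)" by simp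
  then have "(norm (w t))\<^sup>2 \<le> exp ((2*L+1)*t) * ((norm (w 0))\<^sup>2 + e\<^sup>2)"
    using zero_le_power2[of e] by linarith
  also have "\<dots> \<le> exp (2*(L+1)) * (e0 + e)\<^sup>2"
  proof (rule mult_mono)
    have "(2*L+1)*t \<le> (2*L+1)*1" using t L by (intro mult_left_mono) auto
    then show "exp ((2*L+1)*t) \<le> exp (2*(L+1))" by simp
    have "0 \<le> e0" using i norm_ge_zero order_trans by blast
    then have "(e0+e)\<^sup>2 \<ge> e0\<^sup>2 + e\<^sup>2" using e by (simp add: power2_sum)
    moreover have "(norm (w 0))\<^sup>2 \<le> e0\<^sup>2" using i by (simp add: power_mono)
    ultimately show "(norm (w 0))\<^sup>2 + e\<^sup>2 \<le> (e0+e)\<^sup>2" by linarith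
  qed auto
  also have "\<dots> = (exp (L+1) * (e0+e))\<^sup>2" by (simp add: power_mult_distrib exp_double[symmetric])
  finally show ?thesis
    using power2_le_imp_le e i norm_ge_zero[of "w 0"] by (smt (verit) exp_ge_zero mult_nonneg_nonneg)
qed

lemma ode_unique:
  assumes "ode_sol f u" "ode_sol f w" "u 0 = w 0" "L \<ge> 0"
    and lip: "\<And>t x y. t \<in> {0..1} \<Longrightarrow> norm (f t x - f t y) \<le> L * norm (x - y)"
    and "t \<in> {0..1}"
  shows "u t = w t"
proof -
  have "norm (u t - w t) \<le> exp (L+1) * (0 + 0)"
  proof (rule gronwall[where w'="\<lambda>t. f t (u t) - f t (w t)" and w="\<lambda>t. u t - w t"])
    show "((\<lambda>t. u t - w t) has_vector_derivative f t (u t) - f t (w t)) (at t within {0..1})" if "t \<in> {0..1}" for t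
      by (intro has_vector_derivative_diff ode_solD assms that)
  qed (use assms in auto)
  then show ?thesis by simp
qed

text \<open>Picard iteration in an exponentially weighted norm: with weight
  \<open>exp (2 * L * t)\<close> the integral operator contracts by 1/2 on the whole unit interval
  at once, without a subdivision into short intervals.\<close>

lemma ode_exists:
  fixes f :: "real \<Rightarrow> 'a::euclidean_space \<Rightarrow> 'a"
  assumes cont: "continuous_on ({0..1} \<times> UNIV) (\<lambda>p. f (fst p) (snd p))"
    and lip0: "\<And>t x y. t \<in> {0..1} \<Longrightarrow> norm (f t x - f t y) \<le> L0 * norm (x - y)"
  shows "\<exists>u. u 0 = x0 \<and> ode_sol f u"
proof -
  define L where "L = max L0 1"
  have L: "L > 0" by (simp add: L_def)
  have lip: "norm (f t x - f t y) \<le> L * norm (x - y)" if "t \<in> {0..1}" for t x y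
    using lip0[OF that, of x y] by (smt (verit) L_def mult_right_mono norm_ge_zero)
  have fc: "continuous_on {0..1} (\<lambda>s. f s (u s))" if "continuous_on {0..1} u" for u
  proof -
    have "continuous_on {0..1} (\<lambda>s. (s, u s))" by (intro continuous_intros that)
    from continuous_on_compose2[OF cont this] show ?thesis by auto
  qed
  \<comment> \<open>Banach's theorem is applied in the complete space of bounded continuous
    functions on the line; clamping time to \<open>{0..1}\<close> extends a function on the interval
    constantly beyond both ends.\<close>
  define c :: "real \<Rightarrow> real" where "c t = max 0 (min 1 t)" for t
  have c01: "c t \<in> {0..1}" for t by (auto simp: c_def)
  have c_id: "c t = t" if "t \<in> {0..1}" for t using that by (auto simp: c_def)
  have c_cont: "continuous_on S c" for S unfolding c_def by (intro continuous_intros)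
  \<comment> \<open>The unknown \<open>v\<close> is the solution divided by
    \<open>exp (2 * L * s)\<close>, so that the plain sup distance between two such \<open>v\<close>
    is the weighted distance between the solutions.\<close>
  define F :: "(real, 'a) bcontfun \<Rightarrow> real \<Rightarrow> 'a"
    where "F = (\<lambda>v s. f s (exp (2 * L * s) *\<^sub>R apply_bcontfun v s))"
  have F_cont: "continuous_on {0..1} (F v)" for v
    unfolding F_def by (rule fc) (intro continuous_intros, simp)
  define P0 where "P0 v t = exp (-2 * L * t) *\<^sub>R (x0 + integral {0..t} (F v))" for v t
  have I_deriv: "((\<lambda>t. integral {0..t} (F v)) has_vector_derivative F v t) (at t within {0..1})"
    if "t \<in> {0..1}" for v t
    by (rule integral_has_vector_derivative[OF F_cont that])
  have I_cont: "continuous_on {0..1} (\<lambda>t. integral {0..t} (F v))" for v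
    unfolding continuous_on_eq_continuous_within
    using I_deriv has_vector_derivative_continuous by blast
  have P0_cont: "continuous_on {0..1} (P0 v)" for v
    unfolding P0_def by (intro continuous_intros I_cont)
  have P_bc: "(\<lambda>t. P0 v (c t)) \<in> bcontfun" for v
  proof -
    have "continuous_on UNIV (\<lambda>t. P0 v (c t))"
      by (rule continuous_on_compose2[OF P0_cont c_cont]) (use c01 in auto)
    moreover have "bounded (range (\<lambda>t. P0 v (c t)))"
      by (rule bounded_subset[OF compact_imp_bounded[OF compact_continuous_image[OF P0_cont]]])
        (use c01 in auto)
    ultimately show ?thesis by (simp add: bcontfun_def)
  qed
  define P where "P v = Bcontfun (\<lambda>t. P0 v (c t))" for v
  have P_app: "apply_bcontfun (P v) t = P0 v (c t)" for v t
    unfolding P_def by (simp add: Bcontfun_inverse[OF P_bc])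
  have contr: "dist (P v) (P w) \<le> 1/2 * dist v w" for v w
  proof (rule dist_bound)
    fix t
    define s where "s = c t"
    have s: "s \<in> {0..1}" using c01 s_def by simp
    have sub: "{0..s} \<subseteq> {0..1}" using s by auto
    let ?D = "dist v w"
    have "norm (integral {0..s} (F v) - integral {0..s} (F w)) = norm (integral {0..s} (\<lambda>r. F v r - F w r))"
      by (subst integral_diff)
        (auto intro!: integrable_continuous_real continuous_on_subset[OF F_cont sub])
    also have "\<dots> \<le> integral {0..s} (\<lambda>r. L * exp (2 * L * r) * ?D)"
    proof (rule integral_norm_bound_integral)
      fix r assume r: "r \<in> {0..s}"
      have "norm (F v r - F w r) \<le> L * norm (exp (2 * L * r) *\<^sub>R v r - exp (2 * L * r) *\<^sub>R w r)"
        unfolding F_def using r sub by (intro lip) auto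
      also have "\<dots> = L * exp (2 * L * r) * dist (v r) (w r)"
        by (simp add: scaleR_diff_right[symmetric] dist_norm)
      also have "\<dots> \<le> L * exp (2 * L * r) * ?D"
        using dist_bounded[of v r w] L by (simp add: mult_left_mono)
      finally show "norm (F v r - F w r) \<le> L * exp (2 * L * r) * ?D" .
    qed (auto intro!: integrable_continuous_real continuous_intros continuous_on_subset[OF F_cont sub])
    also have "integral {0..s} (\<lambda>r. L * exp (2 * L * r) * ?D) = exp (2 * L * s) / 2 * ?D - exp (2*L*0) / 2 * ?D"
    proof (rule integral_unique, rule fundamental_theorem_of_calculus)
      show "0 \<le> s" using s by simp
      fix r assume "r \<in> {0..s}"
      have "((\<lambda>r. exp (2 * L * r) / 2 * ?D) has_real_derivative L * exp (2 * L * r) * ?D) (at r within {0..s})"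
        by (auto intro!: derivative_eq_intros)
      then show "((\<lambda>r. exp (2 * L * r) / 2 * ?D) has_vector_derivative L * exp (2 * L * r) * ?D) (at r within {0..s})"
        by (simp add: has_real_derivative_iff_has_vector_derivative)
    qed
    finally have *: "norm (integral {0..s} (F v) - integral {0..s} (F w)) \<le> exp (2 * L * s) / 2 * ?D"
      by (smt (verit) divide_nonneg_nonneg exp_ge_zero mult_nonneg_nonneg zero_le_dist)
    have "dist (P v t) (P w t) = exp (-2 * L * s) * norm (integral {0..s} (F v) - integral {0..s} (F w))"
      unfolding P_app P0_def s_def[symmetric] by (simp add: dist_norm scaleR_diff_right[symmetric])
    also have "\<dots> \<le> exp (-2 * L * s) * (exp (2 * L * s) / 2 * ?D)"
      by (intro mult_left_mono *) auto
    also have "\<dots> = 1/2 * ?D" by (simp add: exp_minus field_simps)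
    finally show "dist (P v t) (P w t) \<le> 1/2 * ?D" .
  qed
  obtain v where v: "P v = v"
    using banach_fix_type[of "1/2" P] contr by auto
  define u where "u t = x0 + integral {0..t} (F v)" for t
  have u: "exp (2 * L * t) *\<^sub>R v t = u t" if "t \<in> {0..1}" for t
  proof -
    have "v t = P0 v t" using P_app[of v t] v c_id[OF that] by simp
    then show ?thesis unfolding P0_def u_def by (simp add: exp_add[symmetric])
  qed
  have "(u has_vector_derivative f t (u t)) (at t within {0..1})" if "t \<in> {0..1}" for t
  proof -
    have "(u has_vector_derivative F v t) (at t within {0..1})"
      unfolding u_def using I_deriv[OF that] by (auto intro!: derivative_eq_intros)
    then show ?thesis unfolding F_def using u[OF that] by simp
  qed
  moreover have "u 0 = x0" by (simp add: u_def)
  ultimately show ?thesis unfolding ode_sol_def by blast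
qed

text \<open>The curve lies in a ball of some radius \<open>R\<close>, and everything within distance
  1 of it in the ball of radius \<open>R + 1\<close>. Compactness of that ball times
  \<open>{0..1}\<close> makes \<open>d\<close> independent of \<open>t\<close>.\<close>

lemma uniformly_continuous_near_curve:
  fixes F :: "real \<Rightarrow> 'b::euclidean_space \<Rightarrow> 'c::euclidean_space"
  assumes F: "continuous_on ({0..1} \<times> UNIV) (\<lambda>p. F (fst p) (snd p))"
    and \<gamma>: "continuous_on {0..1} \<gamma>" and e: "e > 0"
  shows "\<exists>d>0. \<forall>t\<in>{0..1}. \<forall>q. norm (q - \<gamma> t) < d \<longrightarrow> norm (F t q - F t (\<gamma> t)) < e"
proof -
  have "bounded (\<gamma> ` {0..1})" by (rule compact_imp_bounded[OF compact_continuous_image[OF \<gamma>]]) simp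
  then obtain R where "\<forall>q\<in>\<gamma> ` {0..1}. norm q \<le> R" unfolding bounded_iff by blast
  then have R: "norm (\<gamma> t) \<le> R" if "t \<in> {0..1}" for t using that by blast
  define C where "C = {0..1::real} \<times> cball (0::'b) (R+1)"
  have "compact C" unfolding C_def by (intro compact_Times) auto
  moreover have "continuous_on C (\<lambda>p. F (fst p) (snd p))"
    by (rule continuous_on_subset[OF F]) (auto simp: C_def)
  ultimately have "uniformly_continuous_on C (\<lambda>p. F (fst p) (snd p))"
    using compact_uniformly_continuous by blast
  then obtain d where d: "d > 0" "\<And>p q. p \<in> C \<Longrightarrow> q \<in> C \<Longrightarrow> dist q p < d \<Longrightarrow> dist (F (fst q) (snd q)) (F (fst p) (snd p)) < e"
    unfolding uniformly_continuous_on_def using e by metis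
  show ?thesis
  proof (intro exI[of _ "min d 1"] conjI ballI allI impI)
    fix t :: real and q assume t: "t \<in> {0..1}" and q: "norm (q - \<gamma> t) < min d 1"
    have "norm q \<le> R + 1" using R[OF t] q norm_triangle_ineq2[of q "\<gamma> t"] by linarith
    then have "(t, q) \<in> C" "(t, \<gamma> t) \<in> C" using t R[OF t] by (auto simp: C_def)
    moreover have "dist (t, q) (t, \<gamma> t) < d" using q by (simp add: dist_Pair_Pair dist_norm)
    ultimately show "norm (F t q - F t (\<gamma> t)) < e" using d(2)[of "(t, \<gamma> t)" "(t,q)"] by (simp add: dist_norm)
  qed (use d in auto)
qed

lemma uniform_taylor:
  fixes g :: "real \<Rightarrow> 'b::euclidean_space \<Rightarrow> 'c::euclidean_space"
  assumes g: "ck (Suc 0) {0..1} UNIV g" and \<gamma>: "continuous_on {0..1} \<gamma>" and e: "e > 0"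
  shows "\<exists>d>0. \<forall>t\<in>{0..1}. \<forall>q. norm (q - \<gamma> t) < d \<longrightarrow>
     norm (g t q - g t (\<gamma> t) - ddir (g t) (\<gamma> t) (q - \<gamma> t)) \<le> e * norm (q - \<gamma> t)"
proof -
  \<comment> \<open>A bound \<open>e'\<close> on every basis vector gives the operator bound
    \<open>DIM('b) * e' = e\<close> through \<open>linear_bound_basis\<close>.\<close>
  define e' where "e' = e / DIM('b)"
  have e': "e' > 0" using e by (simp add: e'_def)
  have "\<forall>b. \<exists>d>0. \<forall>t\<in>{0..1}. \<forall>q. norm (q - \<gamma> t) < d \<longrightarrow> norm (ddir (g t) q b - ddir (g t) (\<gamma> t) b) < e'"
  proof
    fix b
    have "ck 0 {0..1} UNIV (\<lambda>t x. ddir (g t) x b)" using ck_ddir[OF g] .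
    from uniformly_continuous_near_curve[OF ck_cont[OF this] \<gamma> e']
    show "\<exists>d>0. \<forall>t\<in>{0..1}. \<forall>q. norm (q - \<gamma> t) < d \<longrightarrow> norm (ddir (g t) q b - ddir (g t) (\<gamma> t) b) < e'" .
  qed
  from choice[OF this] obtain d where d: "\<And>b. d b > 0"
    "\<And>b t q. t \<in> {0..1} \<Longrightarrow> norm (q - \<gamma> t) < d b \<Longrightarrow> norm (ddir (g t) q b - ddir (g t) (\<gamma> t) b) < e'" by blast
  define d0 where "d0 = Min (d ` (Basis :: 'b set))"
  have d0: "d0 > 0" "\<And>b. b \<in> Basis \<Longrightarrow> d0 \<le> d b" unfolding d0_def using d(1) by auto
  have gd: "(g t has_derivative ddir (g t) x) (at x)" if "t \<in> {0..1}" for t x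
    using ck_hd[OF g that] by simp
  show ?thesis
  proof (intro exI[of _ d0] conjI ballI allI impI d0)
    fix t :: real and q assume t: "t \<in> {0..1}" and q: "norm (q - \<gamma> t) < d0"
    define S where "S = ball (\<gamma> t) d0"
    have on: "onorm (ddir (g t) x - ddir (g t) (\<gamma> t)) \<le> e" if x: "x \<in> S" for x
    proof (rule onorm_le)
      fix h
      have lin: "linear (ddir (g t) x - ddir (g t) (\<gamma> t))"
        using has_derivative_linear[OF gd[OF t]] by (auto simp: fun_diff_def intro!: linear_compose_sub)
      have "norm ((ddir (g t) x - ddir (g t) (\<gamma> t)) h) \<le> (\<Sum>b\<in>(Basis::'b set). e') * norm h"
      proof (rule linear_bound_basis[OF lin])
        fix b :: 'b assume b: "b \<in> Basis"
        have "norm (ddir (g t) x b - ddir (g t) (\<gamma> t) b) < e'"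
          by (rule d(2)[OF t]) (use x d0(2)[OF b] in \<open>auto simp: S_def dist_norm norm_minus_commute\<close>)
        then show "norm ((ddir (g t) x - ddir (g t) (\<gamma> t)) b) \<le> e'" by simp
      qed
      then show "norm ((ddir (g t) x - ddir (g t) (\<gamma> t)) h) \<le> e * norm h" by (simp add: e'_def)
    qed
    have "norm (g t q - g t (\<gamma> t) - ddir (g t) (\<gamma> t) (q - \<gamma> t)) \<le> norm (q - \<gamma> t) * e"
    proof (rule differentiable_bound_linearization[where S=S and f'="\<lambda>x. ddir (g t) x"])
      show "\<gamma> t + s *\<^sub>R (q - \<gamma> t) \<in> S" if "s \<in> {0..1}" for s
      proof -
        have "s * norm (q - \<gamma> t) \<le> 1 * norm (q - \<gamma> t)" using that by (intro mult_right_mono) auto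
        then show ?thesis using that q by (auto simp: S_def dist_norm)
      qed
      show "(g t has_derivative ddir (g t) x) (at x within S)" for x
        using gd[OF t] has_derivative_at_withinI by blast
      show "\<gamma> t \<in> S" using d0 by (simp add: S_def)
    qed (use on in auto)
    then show "norm (g t q - g t (\<gamma> t) - ddir (g t) (\<gamma> t) (q - \<gamma> t)) \<le> e * norm (q - \<gamma> t)"
      by (simp add: mult.commute)
  qed
qed


section \<open>Dependence of solutions on parameters\<close>

definition locally_lipschitz_family ::
    "(real \<Rightarrow> 'p::euclidean_space \<times> 'u::euclidean_space \<Rightarrow> 'u) \<Rightarrow> bool" where
  "locally_lipschitz_family g \<longleftrightarrow> (\<forall>x0. \<exists>L\<ge>0. \<exists>d>0. \<forall>x. norm (x - x0) < d \<longrightarrow>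
     (\<forall>t\<in>{0..1}. \<forall>u v. norm (g t (x, u) - g t (x, v)) \<le> L * norm (u - v)))"

lemma locally_lipschitz_familyE:
  assumes "locally_lipschitz_family g"
  obtains L d where "L \<ge> 0" "d > 0" "\<And>x t u v. norm (x - x0) < d \<Longrightarrow> t \<in> {0..1} \<Longrightarrow>
     norm (g t (x, u) - g t (x, v)) \<le> L * norm (u - v)"
  using assms unfolding locally_lipschitz_family_def by metis

text \<open>The right hand sides for \<open>x\<close> and \<open>x0\<close> differ by a Lipschitz
  term in the state, at fixed parameter, and by a defect from moving the parameter along the single
  curve \<open>y t x0\<close>. That defect is small uniformly in \<open>t\<close>, so Gronwall's
  inequality applies.\<close>

lemma psol_uniform:
  fixes g :: "real \<Rightarrow> 'p::euclidean_space \<times> 'u::euclidean_space \<Rightarrow> 'u" and y :: "real \<Rightarrow> 'p \<Rightarrow> 'u"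
  assumes g: "ck 0 {0..1} UNIV g" and ll: "locally_lipschitz_family g"
    and sol: "\<And>x. ode_sol (\<lambda>t u. g t (x, u)) (\<lambda>t. y t x)"
    and i: "isCont (y 0) x0" and e: "e > 0"
  shows "\<exists>d>0. \<forall>x. norm (x - x0) < d \<longrightarrow> (\<forall>t\<in>{0..1}. norm (y t x - y t x0) < e)"
proof -
  obtain L d where L: "L \<ge> 0" and d: "d > 0" and lip: "\<And>x t u v. norm (x - x0) < d \<Longrightarrow> t \<in> {0..1} \<Longrightarrow>
     norm (g t (x, u) - g t (x, v)) \<le> L * norm (u - v)"
    using locally_lipschitz_familyE[OF ll, of x0] by metis
  \<comment> \<open>The initial gap and the defect each contribute \<open>e'\<close>, so Gronwall's
    bound is two thirds of \<open>e\<close>.\<close>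
  define e' where "e' = e / (3 * exp (L+1))"
  have e': "e' > 0" using e by (simp add: e'_def)
  have "continuous_on {0..1} (\<lambda>t. (x0, y t x0))"
    by (intro continuous_intros ode_sol_continuous[OF sol])
  from uniformly_continuous_near_curve[OF ck_cont[OF g] this e']
  obtain d1 where d1: "d1 > 0" "\<And>t q. t \<in> {0..1} \<Longrightarrow> norm (q - (x0, y t x0)) < d1 \<Longrightarrow> norm (g t q - g t (x0, y t x0)) < e'"
    by blast
  obtain d2 where d2: "d2 > 0" "\<And>x. norm (x - x0) < d2 \<Longrightarrow> norm (y 0 x - y 0 x0) < e'"
    using i e' unfolding continuous_at_eps_delta dist_norm by blast
  show ?thesis
  proof (intro exI[of _ "min d (min d1 d2)"] conjI allI impI ballI)
    fix x and t :: real assume x: "norm (x - x0) < min d (min d1 d2)" and t: "t \<in> {0..1}"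
    have "norm (y t x - y t x0) \<le> exp (L+1) * (e' + e')"
    proof (rule gronwall[where w'="\<lambda>t. g t (x, y t x) - g t (x0, y t x0)" and w="\<lambda>t. y t x - y t x0"])
      fix t :: real assume t: "t \<in> {0..1}"
      show "((\<lambda>t. y t x - y t x0) has_vector_derivative g t (x, y t x) - g t (x0, y t x0)) (at t within {0..1})"
        using ode_solD[OF sol t] by (intro has_vector_derivative_diff)
      have "norm (g t (x, y t x) - g t (x, y t x0)) \<le> L * norm (y t x - y t x0)"
        by (rule lip) (use x t in auto)
      moreover have "norm (g t (x, y t x0) - g t (x0, y t x0)) < e'"
        by (rule d1) (use x t in auto)
      moreover have "norm (g t (x, y t x) - g t (x0, y t x0)) \<le>
          norm (g t (x, y t x) - g t (x, y t x0)) + norm (g t (x, y t x0) - g t (x0, y t x0))"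
        using norm_triangle_ineq[of "g t (x, y t x) - g t (x, y t x0)" "g t (x, y t x0) - g t (x0, y t x0)"] by simp
      ultimately show "norm (g t (x, y t x) - g t (x0, y t x0)) \<le> L * norm (y t x - y t x0) + e'" by linarith
    next
      show "norm (y 0 x - y 0 x0) \<le> e'" using d2(2)[of x] x by simp
    qed (use L e' t in simp_all)
    also have "\<dots> < e" unfolding e'_def using e by (simp add: field_simps)
    finally show "norm (y t x - y t x0) < e" .
  qed (use d d1 d2 in auto)
qed

lemma psol_ck0:
  fixes g :: "real \<Rightarrow> 'p::euclidean_space \<times> 'u::euclidean_space \<Rightarrow> 'u" and y :: "real \<Rightarrow> 'p \<Rightarrow> 'u"
  assumes g: "ck 0 {0..1} UNIV g" and ll: "locally_lipschitz_family g"
    and sol: "\<And>x. ode_sol (\<lambda>t u. g t (x, u)) (\<lambda>t. y t x)"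
    and i: "continuous_on UNIV (y 0)"
  shows "ck 0 {0..1} UNIV y"
proof -
  have "continuous_on ({0..1} \<times> UNIV) (\<lambda>p. y (fst p) (snd p))"
    unfolding continuous_on_iff
  proof (intro ballI allI impI)
    fix p :: "real \<times> 'p" and e :: real assume p: "p \<in> {0..1} \<times> UNIV" and e: "e > 0"
    obtain t0 x0 where px: "p = (t0, x0)" by (cases p)
    have t0: "t0 \<in> {0..1}" using p px by auto
    have "isCont (y 0) x0" using i by (simp add: continuous_on_eq_continuous_at)
    from psol_uniform[OF g ll sol this, of "e/2"] e
    obtain d1 where d1: "d1 > 0" "\<And>x t. norm (x - x0) < d1 \<Longrightarrow> t \<in> {0..1} \<Longrightarrow> norm (y t x - y t x0) < e/2"
      by auto
    obtain d2 where d2: "d2 > 0" "\<And>t. t \<in> {0..1} \<Longrightarrow> dist t t0 < d2 \<Longrightarrow> dist (y t x0) (y t0 x0) < e/2"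
      using ode_sol_continuous[OF sol[of x0], unfolded continuous_on_iff] t0 half_gt_zero[OF e] by metis
    show "\<exists>d>0. \<forall>x'\<in>{0..1} \<times> UNIV. dist x' p < d \<longrightarrow> dist (y (fst x') (snd x')) (y (fst p) (snd p)) < e"
    proof (intro exI[of _ "min d1 d2"] conjI ballI impI)
      fix q :: "real \<times> 'p" assume q: "q \<in> {0..1} \<times> UNIV" "dist q p < min d1 d2"
      have "dist (fst q) t0 < d2" "dist (snd q) x0 < d1"
        using q(2) dist_fst_le[of q p] dist_snd_le[of q p] px by auto
      then have "dist (y (fst q) (snd q)) (y (fst q) x0) < e/2" "dist (y (fst q) x0) (y t0 x0) < e/2"
        using d1(2)[of "snd q" "fst q"] d2(2)[of "fst q"] q(1) by (auto simp: dist_norm)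
      then show "dist (y (fst q) (snd q)) (y (fst p) (snd p)) < e"
        using dist_triangle[of "y (fst q) (snd q)" "y t0 x0" "y (fst q) x0"] px by simp
    qed (use d1 d2 in auto)
  qed
  then show ?thesis by simp
qed

text \<open>Compactness of \<open>{0..1}\<close> times the unit ball about \<open>x0\<close>, used
  for each basis direction. The bound serves as Lipschitz constant and as growth bound of the
  variational equation.\<close>

lemma ck_op_bound:
  fixes g :: "real \<Rightarrow> 'p::euclidean_space \<times> 'u::euclidean_space \<Rightarrow> 'c::euclidean_space"
  assumes g: "ck (Suc 0) {0..1} UNIV g" and y: "ck 0 {0..1} UNIV y"
  shows "\<exists>C\<ge>0. \<forall>t\<in>{0..1}. \<forall>x. norm (x - x0) \<le> 1 \<longrightarrow> (\<forall>h. norm (ddir (g t) (x, y t x) h) \<le> C * norm h)"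
proof -
  have "\<exists>C. \<forall>t\<in>{0..1}. \<forall>x. norm (x - x0) \<le> 1 \<longrightarrow> norm (ddir (g t) (x, y t x) b) \<le> C" for b
  proof -
    define K where "K = {0..1::real} \<times> cball x0 1"
    have "ck 0 {0..1} UNIV (\<lambda>t x. (\<lambda>t q. ddir (g t) q b) t (x, y t x))"
      by (rule ck_compose[where Y=UNIV, OF _ _ ck_ddir[OF g]]) (use y in \<open>auto intro!: ck_Pair ck_id simp del: ck.simps\<close>)
    then have "continuous_on K (\<lambda>p. ddir (g (fst p)) (snd p, y (fst p) (snd p)) b)"
      using ck_cont by (rule_tac continuous_on_subset[where s="{0..1} \<times> UNIV"]) (auto simp: K_def)
    moreover have "compact K" unfolding K_def by (intro compact_Times) auto
    ultimately have "bounded ((\<lambda>p. ddir (g (fst p)) (snd p, y (fst p) (snd p)) b) ` K)"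
      using compact_imp_bounded compact_continuous_image by blast
    then obtain C where "\<forall>q\<in>((\<lambda>p. ddir (g (fst p)) (snd p, y (fst p) (snd p)) b) ` K). norm q \<le> C"
      unfolding bounded_iff by blast
    then show ?thesis by (intro exI[of _ C]) (auto simp: K_def dist_norm norm_minus_commute)
  qed
  then obtain C where C: "\<And>b t x. t \<in> {0..1} \<Longrightarrow> norm (x - x0) \<le> 1 \<Longrightarrow> norm (ddir (g t) (x, y t x) b) \<le> C b"
    by metis
  show ?thesis
  proof (intro exI[of _ "\<Sum>b\<in>Basis. C b"] conjI ballI allI impI)
    have "0 \<le> C b" for b using order_trans[OF norm_ge_zero C[of 0 x0 b]] by simp
    then show "0 \<le> (\<Sum>b\<in>Basis. C b)" by (rule sum_nonneg)
    fix t :: real and x h assume t: "t \<in> {0..1}" and x: "norm (x - x0) \<le> 1"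
    have "linear (ddir (g t) (x, y t x))" using g t by (intro linear_frechet_derivative) simp
    then show "norm (ddir (g t) (x, y t x) h) \<le> (\<Sum>b\<in>Basis. C b) * norm h"
      by (rule linear_bound_basis) (rule C[OF t x])
  qed
qed

text \<open>The derivative of a solution in a parameter direction \<open>v\<close> solves the equation with this right
  hand side, which is again of the form \<open>g t (x, u)\<close>; this makes the induction on the order of
  differentiability stay within one type.\<close>

definition variational :: "(real \<Rightarrow> 'p::euclidean_space \<times> 'u::euclidean_space \<Rightarrow> 'u) \<Rightarrow> (real \<Rightarrow> 'p \<Rightarrow> 'u) \<Rightarrow> 'p
    \<Rightarrow> real \<Rightarrow> 'p \<times> 'u \<Rightarrow> 'u" where
  "variational g y v t q = ddir (g t) (fst q, y t (fst q)) (v, snd q)"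

text \<open>The variational equation is affine in the state, with slope given by the derivative of
  \<open>g\<close> along the solutions. Compactness bounds this slope only for parameters near
  \<open>x0\<close>, which is why \<open>locally_lipschitz_family\<close> is local in the parameter
  but global in the state.\<close>

lemma variational_lipschitz:
  fixes g :: "real \<Rightarrow> 'p::euclidean_space \<times> 'u::euclidean_space \<Rightarrow> 'u"
  assumes g: "ck (Suc 0) {0..1} UNIV g" and y: "ck 0 {0..1} UNIV y"
  shows "locally_lipschitz_family (variational g y v)"
  unfolding locally_lipschitz_family_def
proof
  fix x0
  from ck_op_bound[OF g y, of x0] obtain C where C: "C \<ge> 0"
    "\<And>t x h. t \<in> {0..1} \<Longrightarrow> norm (x - x0) \<le> 1 \<Longrightarrow> norm (ddir (g t) (x, y t x) h) \<le> C * norm h" by blast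
  show "\<exists>L\<ge>0. \<exists>d>0. \<forall>x. norm (x - x0) < d \<longrightarrow>
     (\<forall>t\<in>{0..1}. \<forall>u w. norm (variational g y v t (x, u) - variational g y v t (x, w)) \<le> L * norm (u - w))"
  proof (rule exI[of _ C], rule conjI[OF C(1)], rule exI[of _ 1], intro conjI allI impI ballI)
    fix x and t :: real and u w assume x: "norm (x - x0) < 1" and t: "t \<in> {0..1}"
    have "linear (ddir (g t) (x, y t x))" using g t by (intro linear_frechet_derivative) simp
    from linear_diff[OF this, of "(v,u)" "(v,w)"]
    have "variational g y v t (x, u) - variational g y v t (x, w) = ddir (g t) (x, y t x) (0, u - w)"
      by (simp add: variational_def)
    with C(2)[OF t less_imp_le[OF x], of "(0, u - w)"]
    show "norm (variational g y v t (x, u) - variational g y v t (x, w)) \<le> C * norm (u - w)" by simp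
  qed auto
qed

text \<open>One order of \<open>g\<close> is spent, but \<open>y\<close> enters at order
  \<open>k\<close> only; this is what the induction hypothesis of \<open>psol_ck\<close> can
  supply.\<close>

lemma variational_ck:
  fixes g :: "real \<Rightarrow> 'p::euclidean_space \<times> 'u::euclidean_space \<Rightarrow> 'u"
  assumes g: "ck (Suc k) {0..1} UNIV g" and y: "ck k {0..1} UNIV y"
  shows "ck k {0..1} UNIV (variational g y v)"
proof -
  have f: "ck k {0..1} UNIV (\<lambda>t q. fst q :: 'p)" "ck k {0..1} UNIV (\<lambda>t q. snd q :: 'u)"
    using ck_bounded_linear bounded_linear_fst bounded_linear_snd by blast+
  have yf: "ck k {0..1} UNIV (\<lambda>t (q::'p\<times>'u). y t (fst q))"
    by (rule ck_compose[OF _ _ y f(1)]) auto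
  have D: "ck k {0..1} UNIV (\<lambda>t (q::'p\<times>'u). (\<lambda>t q. ddir (g t) q b) t (fst q, y t (fst q)))" for b
    by (rule ck_compose[OF _ _ ck_ddir[OF g]]) (auto intro!: ck_Pair f yf)
  have "ck k {0..1} UNIV (\<lambda>t q. \<Sum>b\<in>Basis. ((v, snd q) \<bullet> b) *\<^sub>R ddir (g t) (fst q, y t (fst q)) b)"
    by (intro ck_sum ck_scaleR ck_inner ck_Pair ck_const f D) auto
  then show ?thesis
  proof (rule ck_cong[rotated 2])
    fix t and q :: "'p \<times> 'u" assume "t \<in> {0..1::real}"
    then have "g t differentiable (at (fst q, y t (fst q)))" using g by simp
    from ddir_basis[OF this, of "(v, snd q)"]
    show "(\<Sum>b\<in>Basis. ((v, snd q) \<bullet> b) *\<^sub>R ddir (g t) (fst q, y t (fst q)) b) = variational g y v t q"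
      by (simp only: variational_def)
  qed auto
qed

text \<open>The candidate derivative \<open>Z\<close> is constructed as a solution of the
  variational equation. The remainder \<open>y t x - y t x0 - Z (x - x0) t\<close> then satisfies a
  differential inequality whose defect is small compared with \<open>x - x0\<close>, and Gronwall's
  inequality finishes.\<close>

lemma psol_has_derivative:
  fixes g :: "real \<Rightarrow> 'p::euclidean_space \<times> 'u::euclidean_space \<Rightarrow> 'u" and y :: "real \<Rightarrow> 'p \<Rightarrow> 'u"
  assumes g: "ck (Suc 0) {0..1} UNIV g" and ll: "locally_lipschitz_family g"
    and sol: "\<And>x. ode_sol (\<lambda>t u. g t (x, u)) (\<lambda>t. y t x)"
    and i: "\<And>x. (y 0 has_derivative y0' x) (at x)"
  shows "\<exists>Z. (\<forall>t\<in>{0..1}. (y t has_derivative (\<lambda>v. Z v t)) (at x0))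
     \<and> (\<forall>v. Z v 0 = y0' x0 v \<and> ode_sol (\<lambda>t z. variational g y v t (x0, z)) (Z v))"
proof -
  have i0: "continuous_on UNIV (y 0)"
    using i by (metis continuous_at_imp_continuous_on has_derivative_continuous)
  have y: "ck 0 {0..1} UNIV y" by (rule psol_ck0[OF ck_Suc_imp[OF g] ll sol i0])
  obtain C where C0: "C \<ge> 0" "\<forall>t\<in>{0..1}. \<forall>x. norm (x - x0) \<le> 1 \<longrightarrow> (\<forall>h. norm (ddir (g t) (x, y t x) h) \<le> C * norm h)"
    using ck_op_bound[OF g y, of x0] by (elim exE conjE) (rule that)
  have C: "C \<ge> 0" "\<And>t h. t \<in> {0..1} \<Longrightarrow> norm (ddir (g t) (x0, y t x0) h) \<le> C * norm h"
    by (rule C0(1)) (rule C0(2)[rule_format], simp_all)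
  have lin: "linear (ddir (g t) (x0, y t x0))" if "t \<in> {0..1}" for t
    using g that by (intro linear_frechet_derivative) simp
  have vlip: "norm (variational g y v t (x0, z) - variational g y v t (x0, z')) \<le> C * norm (z - z')"
    if "t \<in> {0..1}" for v t z z'
    using C(2)[OF that, of "(0, z - z')"] linear_diff[OF lin[OF that], of "(v,z)" "(v,z')"]
    by (simp add: variational_def)
  have vc: "continuous_on ({0..1} \<times> UNIV) (\<lambda>p. variational g y v (fst p) (x0, snd p))" for v
  proof -
    have "ck 0 {0..1} UNIV (\<lambda>t z. variational g y v t (x0, z))"
      by (rule ck_compose[OF _ _ variational_ck[OF g y]]) (auto intro!: ck_Pair ck_const ck_id simp del: ck.simps)
    from ck_cont[OF this] show ?thesis .
  qed
  have "\<exists>z. z 0 = y0' x0 v \<and> ode_sol (\<lambda>t z. variational g y v t (x0, z)) z" for v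
    by (rule ode_exists[OF vc]) (use vlip in auto)
  then obtain Z where Z: "\<And>v. Z v 0 = y0' x0 v" "\<And>v. ode_sol (\<lambda>t z. variational g y v t (x0, z)) (Z v)"
    by metis
  have Zd: "(Z v has_vector_derivative ddir (g t) (x0, y t x0) (v, Z v t)) (at t within {0..1})" if "t \<in> {0..1}" for v t
    using ode_solD[OF Z(2) that] by (simp add: variational_def)
  have y0lin: "linear (y0' x0)" using i has_derivative_linear by blast
  \<comment> \<open>\<open>Z v\<close> was chosen separately for each \<open>v\<close>. Sums and
    multiples of solutions solve the equation for the summed or scaled direction, and uniqueness
    identifies them with the chosen ones.\<close>
  have Zlin: "linear (\<lambda>v. Z v t)" if t: "t \<in> {0..1}" for t
  proof
    fix v w c
    have "Z (v + w) t = Z v t + Z w t"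
    proof (rule ode_unique[where L=C, OF Z(2)])
      show "ode_sol (\<lambda>t z. variational g y (v + w) t (x0, z)) (\<lambda>t. Z v t + Z w t)"
        unfolding ode_sol_def
      proof
        fix t :: real assume t: "t \<in> {0..1}"
        have "ddir (g t) (x0, y t x0) (v + w, Z v t + Z w t) =
            ddir (g t) (x0, y t x0) (v, Z v t) + ddir (g t) (x0, y t x0) (w, Z w t)"
          using linear_add[OF lin[OF t], of "(v, Z v t)" "(w, Z w t)"] by simp
        then show "((\<lambda>t. Z v t + Z w t) has_vector_derivative variational g y (v + w) t (x0, Z v t + Z w t)) (at t within {0..1})"
          using has_vector_derivative_add[OF Zd[OF t] Zd[OF t]] by (simp add: variational_def)
      qed
    qed (use Z(1) linear_add[OF y0lin] vlip C t in auto)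
    then show "Z (v + w) t = Z v t + Z w t" .
    have "Z (c *\<^sub>R v) t = c *\<^sub>R Z v t"
    proof (rule ode_unique[where L=C, OF Z(2)])
      show "ode_sol (\<lambda>t z. variational g y (c *\<^sub>R v) t (x0, z)) (\<lambda>t. c *\<^sub>R Z v t)"
        unfolding ode_sol_def
      proof
        fix t :: real assume t: "t \<in> {0..1}"
        have "ddir (g t) (x0, y t x0) (c *\<^sub>R v, c *\<^sub>R Z v t) = c *\<^sub>R ddir (g t) (x0, y t x0) (v, Z v t)"
          using linear_scale[OF lin[OF t], of c "(v, Z v t)"] by simp
        then show "((\<lambda>t. c *\<^sub>R Z v t) has_vector_derivative variational g y (c *\<^sub>R v) t (x0, c *\<^sub>R Z v t)) (at t within {0..1})"
          using Zd[OF t] by (auto simp: variational_def intro!: derivative_eq_intros)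
      qed
    qed (use Z(1) linear_scale[OF y0lin] vlip C t in auto)
    then show "Z (c *\<^sub>R v) t = c *\<^sub>R Z v t" .
  qed
  obtain B where B: "B \<ge> 0" "\<And>v. norm (y0' x0 v) \<le> B * norm v"
    using bounded_linear.nonneg_bounded[OF has_derivative_bounded_linear[OF i]] by (metis mult.commute)
  \<comment> \<open>Gronwall's constant for \<open>Z h\<close>: initial size
    \<open>B * norm h\<close>, Lipschitz constant \<open>C\<close>, and defect
    \<open>C * norm h\<close> from the parameter component of the direction.\<close>
  define C2 where "C2 = exp (C+1) * (B + C)"
  have C2: "norm (Z h t) \<le> C2 * norm h" if t: "t \<in> {0..1}" for h t
  proof -
    have "norm (Z h t) \<le> exp (C+1) * (B * norm h + C * norm h)"
    proof (rule gronwall[where w'="\<lambda>t. ddir (g t) (x0, y t x0) (h, Z h t)"])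
      fix t :: real assume t: "t \<in> {0..1}"
      have "norm (ddir (g t) (x0, y t x0) (h, Z h t)) \<le> C * norm (h, Z h t)" by (rule C(2)[OF t])
      also have "\<dots> \<le> C * (norm h + norm (Z h t))" using C(1) norm_Pair_le by (intro mult_left_mono) auto
      finally show "norm (ddir (g t) (x0, y t x0) (h, Z h t)) \<le> C * norm (Z h t) + C * norm h" by (simp add: algebra_simps)
    qed (use Zd t B C Z in auto)
    then show ?thesis by (simp add: C2_def algebra_simps)
  qed
  have C2n: "C2 \<ge> 0" using B C by (simp add: C2_def)
  have "(y t has_derivative (\<lambda>v. Z v t)) (at x0)" if t: "t \<in> {0..1}" for t
    unfolding has_derivative_within_alt
  proof (intro conjI allI impI)
    show "bounded_linear (\<lambda>v. Z v t)" using Zlin[OF t] by (simp add: linear_conv_bounded_linear)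
    fix e :: real assume e: "e > 0"
    \<comment> \<open>The remainder has Lipschitz constant \<open>C + 1\<close>, hence
      \<open>exp (C+2)\<close>. In units of \<open>\<eta> * norm h\<close> its initial value counts
      1 and its defect \<open>1 + C2\<close>.\<close>
    define K where "K = exp (C+2) * (2 + C2)"
    have K: "K > 0" using C2n by (simp add: K_def)
    \<comment> \<open>The cap 1 lets the part \<open>\<eta> * norm r\<close> of the Taylor error be
      absorbed into the Gronwall term, whose constant rises from \<open>C\<close> to
      \<open>C + 1\<close>.\<close>
    define \<eta> where "\<eta> = min 1 (e / K)"
    have \<eta>: "\<eta> > 0" "\<eta> \<le> 1" "\<eta> * K \<le> e" using e K by (auto simp: \<eta>_def min_def field_simps)
    have "continuous_on {0..1} (\<lambda>t. (x0, y t x0))"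
      by (intro continuous_intros ode_sol_continuous[OF sol])
    from uniform_taylor[OF g this \<eta>(1)]
    obtain d1 where d1: "d1 > 0" "\<And>t q. t \<in> {0..1} \<Longrightarrow> norm (q - (x0, y t x0)) < d1 \<Longrightarrow>
      norm (g t q - g t (x0, y t x0) - ddir (g t) (x0, y t x0) (q - (x0, y t x0))) \<le> \<eta> * norm (q - (x0, y t x0))"
      by blast
    obtain d2 where d2: "d2 > 0" "\<And>x t. norm (x - x0) < d2 \<Longrightarrow> t \<in> {0..1} \<Longrightarrow> norm (y t x - y t x0) < d1/2"
      using psol_uniform[OF ck_Suc_imp[OF g] ll sol, of x0 "d1/2"] has_derivative_continuous[OF i] d1(1) by auto
    obtain d3 where d3: "d3 > 0" "\<And>x. norm (x - x0) < d3 \<Longrightarrow> norm (y 0 x - y 0 x0 - y0' x0 (x - x0)) \<le> \<eta> * norm (x - x0)"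
      using i[of x0, unfolded has_derivative_within_alt] \<eta>(1) by (metis UNIV_I)
    show "\<exists>d>0. \<forall>x\<in>UNIV. norm (x - x0) < d \<longrightarrow> norm (y t x - y t x0 - Z (x - x0) t) \<le> e * norm (x - x0)"
    proof (intro exI[of _ "min (d1/2) (min d2 d3)"] conjI ballI impI)
      fix x assume x: "norm (x - x0) < min (d1/2) (min d2 d3)"
      define h where "h = x - x0"
      have "norm (y t x - y t x0 - Z h t) \<le> exp ((C + 1) + 1) * (\<eta> * norm h + \<eta> * (1 + C2) * norm h)"
      proof (rule gronwall[where w="\<lambda>t. y t x - y t x0 - Z h t" and
            w'="\<lambda>t. g t (x, y t x) - g t (x0, y t x0) - ddir (g t) (x0, y t x0) (h, Z h t)"])
        fix t :: real assume t: "t \<in> {0..1}"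
        show "((\<lambda>t. y t x - y t x0 - Z h t) has_vector_derivative
           g t (x, y t x) - g t (x0, y t x0) - ddir (g t) (x0, y t x0) (h, Z h t)) (at t within {0..1})"
          using ode_solD[OF sol t] Zd[OF t] by (intro has_vector_derivative_diff)
        define r where "r = y t x - y t x0 - Z h t"
        define k where "k = (x, y t x) - (x0, y t x0)"
        have k: "k = (h, Z h t) + (0, r)" by (simp add: k_def h_def r_def)
        have nk: "norm k \<le> norm h + norm (Z h t) + norm r"
          unfolding k using norm_triangle_ineq[of "(h, Z h t)" "(0::'p, r)"] norm_Pair_le[of h "Z h t"] by simp
        have "norm k \<le> norm h + norm (y t x - y t x0)"
          unfolding k_def h_def using norm_Pair_le[of "x - x0" "y t x - y t x0"] by simp
        then have "norm k < d1" using d2(2)[of x t] x t by (auto simp: h_def)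
        then have err: "norm (g t (x, y t x) - g t (x0, y t x0) - ddir (g t) (x0, y t x0) k) \<le> \<eta> * norm k"
          using d1(2)[OF t, of "(x, y t x)"] by (simp add: k_def)
        have "ddir (g t) (x0, y t x0) k = ddir (g t) (x0, y t x0) (h, Z h t) + ddir (g t) (x0, y t x0) (0, r)"
          unfolding k by (rule linear_add[OF lin[OF t]])
        then have "norm (g t (x, y t x) - g t (x0, y t x0) - ddir (g t) (x0, y t x0) (h, Z h t))
           = norm ((g t (x, y t x) - g t (x0, y t x0) - ddir (g t) (x0, y t x0) k) + ddir (g t) (x0, y t x0) (0, r))"
          by (simp add: algebra_simps)
        also have "\<dots> \<le> \<eta> * norm k + C * norm r"
          using norm_triangle_le[OF add_mono[OF err C(2)[OF t, of "(0, r)"]]] by simp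
        also have "\<eta> * norm k \<le> \<eta> * (norm h + C2 * norm h + norm r)"
          using nk C2[OF t, of h] \<eta> by (intro mult_left_mono) auto
        also have "\<dots> + C * norm r \<le> (C + 1) * norm r + \<eta> * (1 + C2) * norm h"
          using mult_right_mono[OF \<eta>(2) norm_ge_zero[of r]] by (simp add: algebra_simps)
        finally show "norm (g t (x, y t x) - g t (x0, y t x0) - ddir (g t) (x0, y t x0) (h, Z h t))
          \<le> (C + 1) * norm r + \<eta> * (1 + C2) * norm h" by simp
      next
        show "0 \<le> C + 1" "0 \<le> \<eta> * (1 + C2) * norm h" using C(1) C2n \<eta>(1) by simp_all
        show "norm (y 0 x - y 0 x0 - Z h 0) \<le> \<eta> * norm h"
          unfolding Z(1) h_def by (rule d3(2)) (use x in simp)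
      qed (rule t)
      also have "\<dots> = (\<eta> * K) * norm h" by (simp add: K_def algebra_simps)
      also have "\<dots> \<le> e * norm h" using \<eta>(3) by (simp add: mult_right_mono)
      finally show "norm (y t x - y t x0 - Z (x - x0) t) \<le> e * norm (x - x0)" by (simp add: h_def)
    qed (use d1 d2 d3 in auto)
  qed
  then show ?thesis
    by (intro exI[of _ Z] conjI ballI allI Z)
qed

lemma psol_variational:
  fixes g :: "real \<Rightarrow> 'p::euclidean_space \<times> 'u::euclidean_space \<Rightarrow> 'u" and y :: "real \<Rightarrow> 'p \<Rightarrow> 'u"
  assumes g: "ck (Suc 0) {0..1} UNIV g" and ll: "locally_lipschitz_family g"
    and sol: "\<And>x. ode_sol (\<lambda>t u. g t (x, u)) (\<lambda>t. y t x)"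
    and i: "\<And>x. (y 0 has_derivative y0' x) (at x)"
  shows "t \<in> {0..1} \<Longrightarrow> (y t has_derivative ddir (y t) x) (at x)"
    and "ode_sol (\<lambda>t z. variational g y v t (x, z)) (\<lambda>t. ddir (y t) x v)"
proof -
  from psol_has_derivative[OF assms, of x] obtain Z where
    Z0: "\<forall>t\<in>{0..1}. (y t has_derivative (\<lambda>v. Z v t)) (at x)"
      "\<forall>v. Z v 0 = y0' x v \<and> ode_sol (\<lambda>t z. variational g y v t (x, z)) (Z v)"
    by (elim exE conjE) (rule that)
  have Z: "\<And>t. t \<in> {0..1} \<Longrightarrow> (y t has_derivative (\<lambda>v. Z v t)) (at x)"
      "\<And>v. ode_sol (\<lambda>t z. variational g y v t (x, z)) (Z v)"
    by (rule bspec[OF Z0(1)], assumption, rule conjunct2[OF spec[OF Z0(2)]])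
  have e: "ddir (y t) x = (\<lambda>v. Z v t)" if "t \<in> {0..1}" for t
    using frechet_derivative_at[OF Z(1)[OF that]] by simp
  then show "t \<in> {0..1} \<Longrightarrow> (y t has_derivative ddir (y t) x) (at x)" using Z(1) by simp
  show "ode_sol (\<lambda>t z. variational g y v t (x, z)) (\<lambda>t. ddir (y t) x v)"
    unfolding ode_sol_def
  proof
    fix t :: real assume t: "t \<in> {0..1}"
    show "((\<lambda>t. ddir (y t) x v) has_vector_derivative variational g y v t (x, ddir (y t) x v)) (at t within {0..1})"
      by (rule has_vector_derivative_transform[OF t _ ode_solD[OF Z(2)[of v] t, folded fun_cong[OF e[OF t], of v]]])
        (use e in simp)
  qed
qed

theorem psol_ck:
  fixes g :: "real \<Rightarrow> 'p::euclidean_space \<times> 'u::euclidean_space \<Rightarrow> 'u" and y :: "real \<Rightarrow> 'p \<Rightarrow> 'u"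
  assumes "ck k {0..1} UNIV g" "locally_lipschitz_family g"
    and "\<And>x. ode_sol (\<lambda>t u. g t (x, u)) (\<lambda>t. y t x)" and "ck k {0..1} UNIV (\<lambda>_. y 0)"
  shows "ck k {0..1} UNIV y"
  using assms
proof (induction k arbitrary: g y)
  case 0
  have "continuous_on UNIV ((\<lambda>p. y 0 (snd p)) \<circ> (\<lambda>x. (0::real, x)))"
    by (rule continuous_on_compose)
      (use 0(4) in \<open>auto intro!: continuous_intros continuous_on_subset[where s="{0..1} \<times> UNIV"]\<close>)
  then show ?case using psol_ck0[OF 0(1,2,3)] by (simp add: o_def)
next
  case (Suc k)
  have g1: "ck (Suc 0) {0..1} UNIV g" by (rule ck_mono[OF Suc.prems(1)]) simp
  have i: "(y 0 has_derivative ddir (y 0) x) (at x)" for x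
    using ck_hd[OF Suc.prems(4), of 0 x] by simp
  \<comment> \<open>Order \<open>k\<close> of \<open>y\<close> is needed first, because
    \<open>y\<close> enters the coefficients of the equation that its derivatives solve.\<close>
  have yk: "ck k {0..1} UNIV y"
    by (rule Suc.IH[OF ck_Suc_imp[OF Suc.prems(1)] Suc.prems(2,3) ck_Suc_imp[OF Suc.prems(4)]])
  note v = psol_variational[OF g1 Suc.prems(2,3) i]
  have "ck k {0..1} UNIV (\<lambda>t x. ddir (y t) x w)" for w
    by (rule Suc.IH[OF variational_ck[OF Suc.prems(1) yk] variational_lipschitz[OF g1 ck_mono[OF yk]] v(2)
          ck_ddir[OF Suc.prems(4)]]) simp
  then show ?case
    by (intro ck_SucI[where f'="\<lambda>t x. ddir (y t) x"] ck_cont[OF yk] v(1)) auto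
qed


section \<open>Flows of autonomous Lipschitz fields and of compactly supported fields\<close>

lemma ck_freeze:
  assumes "t \<in> T" "ck k T W f"
  shows "ck k UNIV W (\<lambda>_. f t)"
  using assms(2)
proof (induction k arbitrary: f)
  have c: "continuous_on ((UNIV::real set) \<times> W) (\<lambda>p. f t (snd p))" if "continuous_on (T \<times> W) (\<lambda>p. f (fst p) (snd p))" for f
  proof -
    have "continuous_on ((UNIV::real set) \<times> W) (\<lambda>p. (t, snd p))" by (intro continuous_intros)
    from continuous_on_compose2[OF that this] show ?thesis using assms(1) by (simp add: image_subset_iff)
  qed
  {
    case 0
    then show ?case using c by simp
  next
    case (Suc k)
    have "ck k UNIV W (\<lambda>_ x. ddir (f t) x v)" for v
      by (rule Suc.IH[OF ck_ddir[OF Suc.prems]])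
    then show ?case using c[OF ck_cont[OF Suc.prems]] Suc.prems assms(1) by simp
  }
qed

locale lipschitz_field =
  fixes X :: "'a::euclidean_space \<Rightarrow> 'a"
  assumes smX: "sm UNIV X"
    and lipX: "\<exists>L\<ge>0. \<forall>x y. norm (X x - X y) \<le> L * norm (x - y)"

definition sol :: "('a::euclidean_space \<Rightarrow> 'a) \<Rightarrow> 'a \<Rightarrow> real \<Rightarrow> 'a" where
  "sol X x = (SOME u. u 0 = x \<and> ode_sol (\<lambda>_. X) u)"

context lipschitz_field
begin

lemma sol: "sol X x 0 = x \<and> ode_sol (\<lambda>_. X) (sol X x)"
proof -
  obtain L where L: "\<And>x y. norm (X x - X y) \<le> L * norm (x - y)" using lipX by blast
  have c: "continuous_on ({0..1::real} \<times> UNIV) (\<lambda>p. X (snd p))"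
    using sm_ck[OF smX, of 0 "{0..1}"] by simp
  have "\<exists>u. u 0 = x \<and> ode_sol (\<lambda>_. X) u"
    by (rule ode_exists[OF c L])
  from someI_ex[OF this] show ?thesis by (simp add: sol_def)
qed

lemma sol_0: "sol X x 0 = x" and sol_ode: "ode_sol (\<lambda>_. X) (sol X x)"
  using sol by blast+

lemma sol_deriv: "t \<in> {0..1} \<Longrightarrow> (sol X x has_vector_derivative X (sol X x t)) (at t within {0..1})"
  by (rule ode_solD[OF sol_ode])

lemma sol_unique:
  assumes "w 0 = x" "\<And>t. t \<in> {0..1} \<Longrightarrow> (w has_vector_derivative X (w t)) (at t within {0..1})" "t \<in> {0..1}"
  shows "sol X x t = w t"
proof -
  obtain L where "L \<ge> 0" "\<And>x y. norm (X x - X y) \<le> L * norm (x - y)" using lipX by blast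
  moreover have "ode_sol (\<lambda>_. X) w" using assms(2) by (simp add: ode_sol_def)
  ultimately show ?thesis
    using ode_unique[OF sol_ode, of w x L t] assms(1,3) sol_0 by auto
qed

text \<open>Initial values are treated as parameters: \<open>fst q\<close> is the initial point,
  \<open>snd q\<close> the state. The right hand side ignores the former, and all dependence sits in
  the starting map, which is the identity.\<close>

lemma lipschitz_family: "locally_lipschitz_family (\<lambda>t (q :: 'a \<times> 'a). X (snd q))"
proof -
  obtain L where "L \<ge> 0" "\<And>x y. norm (X x - X y) \<le> L * norm (x - y)" using lipX by blast
  then show ?thesis unfolding locally_lipschitz_family_def
    by (intro allI exI[of _ L]) (auto intro: exI[of _ 1])
qed

lemma ck_family: "ck k {0..1} UNIV (\<lambda>t (q :: 'a \<times> 'a). X (snd q))"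
  by (rule sm_ck, rule sm_compose[OF smX sm_bounded_linear[OF bounded_linear_snd]]) auto

lemma sol_family: "ode_sol (\<lambda>t u. X (snd (x, u))) (\<lambda>t. sol X x t)"
  using sol_ode by simp

lemma sol_start: "(\<lambda>x. sol X x 0) = (\<lambda>x. x)"
  by (simp add: sol_0)

lemma sol_ck: "ck k {0..1} UNIV (\<lambda>t x. sol X x t)"
  by (rule psol_ck[OF ck_family lipschitz_family sol_family]) (simp add: sol_start ck_id)

lemma sol_sm: "t \<in> {0..1} \<Longrightarrow> sm UNIV (\<lambda>x. sol X x t)"
  unfolding sm_def using ck_freeze[OF _ sol_ck] by blast

lemma sol_variational:
  assumes "t \<in> {0..1}"
  shows "((\<lambda>t. ddir (\<lambda>x. sol X x t) x v) has_vector_derivative ddir X (sol X x t) (ddir (\<lambda>x. sol X x t) x v))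
     (at t within {0..1})"
proof -
  have i: "((\<lambda>x. sol X x 0) has_derivative (\<lambda>v. v)) (at x)" for x
    unfolding sol_start by (rule has_derivative_ident)
  have e: "ddir (\<lambda>q. X (snd q)) (x, z) (v, w) = ddir X z w" for x z v w :: 'a
  proof -
    have "((\<lambda>q. X (snd q)) has_derivative (\<lambda>h. ddir X (snd (x, z)) (snd h))) (at (x, z))"
      by (rule has_derivative_compose[OF bounded_linear_imp_has_derivative[OF bounded_linear_snd]])
        (use sm_hd[OF smX] in auto)
    from fun_cong[OF frechet_derivative_at[OF this], of "(v,w)"] show ?thesis by simp
  qed
  show ?thesis
    using ode_solD[OF psol_variational(2)[OF ck_family lipschitz_family sol_family i] assms]
    by (simp add: variational_def e)
qed

lemma lipschitz_field_scale: "lipschitz_field (\<lambda>x. c *\<^sub>R X x)"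
proof
  show "sm UNIV (\<lambda>x. c *\<^sub>R X x)" by (intro sm_scaleR sm_const smX) auto
  obtain L where L: "L \<ge> 0" "\<And>x y. norm (X x - X y) \<le> L * norm (x - y)" using lipX by blast
  show "\<exists>L\<ge>0. \<forall>x y. norm (c *\<^sub>R X x - c *\<^sub>R X y) \<le> L * norm (x - y)"
  proof (intro exI[of _ "\<bar>c\<bar> * L"] conjI allI)
    show "0 \<le> \<bar>c\<bar> * L" using L by simp
    fix x y
    have "norm (c *\<^sub>R X x - c *\<^sub>R X y) = \<bar>c\<bar> * norm (X x - X y)"
      by (simp flip: scaleR_diff_right)
    also have "\<dots> \<le> \<bar>c\<bar> * (L * norm (x - y))" using L(2) by (intro mult_left_mono) auto
    finally show "norm (c *\<^sub>R X x - c *\<^sub>R X y) \<le> \<bar>c\<bar> * L * norm (x - y)" by (simp add: mult.assoc)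
  qed
qed

lemma sol_reparam:
  assumes "\<And>t. t \<in> {0..1} \<Longrightarrow> r t \<in> {0..1}"
    and "\<And>t. t \<in> {0..1} \<Longrightarrow> (r has_real_derivative c t) (at t within {0..1})" and "t \<in> {0..1}"
  shows "((\<lambda>t. sol X x (r t)) has_vector_derivative c t *\<^sub>R X (sol X x (r t))) (at t within {0..1})"
proof -
  have "(sol X x has_vector_derivative X (sol X x (r t))) (at (r t) within (r ` {0..1}))"
    by (rule has_vector_derivative_within_subset[OF sol_deriv[OF assms(1)[OF assms(3)]]]) (use assms(1) in auto)
  then have "((sol X x \<circ> r) has_vector_derivative c t *\<^sub>R X (sol X x (r t))) (at t within {0..1})"
    using assms(2)[OF assms(3)] by (intro vector_diff_chain_within) (simp_all add: has_real_derivative_iff_has_vector_derivative)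
  then show ?thesis by (simp add: o_def)
qed

lemma sol_scale:
  assumes c: "c \<in> {0..1}" and t: "t \<in> {0..1}"
  shows "sol (\<lambda>x. c *\<^sub>R X x) x t = sol X x (c * t)"
proof (rule lipschitz_field.sol_unique[OF lipschitz_field_scale _ _ t])
  show "sol X x (c * 0) = x" by (simp add: sol_0)
  show "((\<lambda>t. sol X x (c * t)) has_vector_derivative c *\<^sub>R X (sol X x (c * t))) (at t within {0..1})"
    if "t \<in> {0..1}" for t
    by (rule sol_reparam[where c="\<lambda>_. c", OF _ _ that])
      (use c in \<open>auto intro!: derivative_eq_intros mult_le_one\<close>)
qed

text \<open>Solutions are controlled on \<open>{0..1}\<close> only, so going back in time means
  following \<open>- X\<close> forwards; the curve \<open>sol X x (1 - t)\<close> does this.\<close>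

lemma sol_reverse: "sol (\<lambda>x. - X x) (sol X x 1) 1 = x"
proof -
  have "sol (\<lambda>x. (-1) *\<^sub>R X x) (sol X x 1) 1 = sol X x (1 - 1)"
  proof (rule lipschitz_field.sol_unique[OF lipschitz_field_scale, where w="\<lambda>t. sol X x (1 - t)"])
    show "((\<lambda>t. sol X x (1 - t)) has_vector_derivative (-1) *\<^sub>R X (sol X x (1 - t))) (at t within {0..1})"
      if "t \<in> {0..1}" for t
      by (rule sol_reparam[where c="\<lambda>_. - 1", OF _ _ that]) (auto intro!: derivative_eq_intros)
  qed auto
  then show ?thesis by (simp add: sol_0)
qed

end

lemma compact_support_bounded:
  fixes f :: "'a::euclidean_space \<Rightarrow> 'b::euclidean_space"
  assumes "compact K" "\<And>x. x \<notin> K \<Longrightarrow> f x = 0" "continuous_on UNIV f"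
  shows "\<exists>C\<ge>0. \<forall>x. norm (f x) \<le> C"
proof -
  have "bounded (f ` K)"
    using compact_imp_bounded[OF compact_continuous_image[OF continuous_on_subset[OF assms(3)] assms(1)]] by auto
  then obtain C where C: "\<forall>y\<in>f ` K. norm y \<le> C" unfolding bounded_iff by blast
  have "norm (f x) \<le> max C 0" for x
    by (cases "x \<in> K") (use C assms(2)[of x] in \<open>auto intro: max.coboundedI1\<close>)
  then show ?thesis by (intro exI[of _ "max C 0"]) auto
qed

lemma ddir_zero_off:
  assumes "closed K" "\<And>x. x \<notin> K \<Longrightarrow> f x = 0" "x \<notin> K"
  shows "ddir f x = (\<lambda>_. 0)"
proof -
  have "(f has_derivative (\<lambda>_. 0)) (at x)"
    by (rule has_derivative_transform_within_open[where s="- K" and f="\<lambda>_. 0"]) (use assms in auto)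
  from frechet_derivative_at[OF this] show ?thesis by simp
qed

locale supported_field =
  fixes X :: "'a::euclidean_space \<Rightarrow> 'a" and K :: "'a set"
  assumes sm_field: "sm UNIV X" and compact_support: "compact K" and off_support: "\<And>x. x \<notin> K \<Longrightarrow> X x = 0"
begin

lemma lipschitz: "\<exists>L\<ge>0. \<forall>x y. norm (X x - X y) \<le> L * norm (x - y)"
proof -
  have "\<exists>C\<ge>0. \<forall>x. norm (ddir X x b) \<le> C" for b
    by (rule compact_support_bounded[OF compact_support])
      (use ddir_zero_off[OF compact_imp_closed[OF compact_support] off_support]
        sm_continuous_on[OF sm_ddir[OF sm_field]] in simp_all)
  then obtain C where C: "\<And>b. C b \<ge> 0" "\<And>b x. norm (ddir X x b) \<le> C b" by metis
  define L where "L = (\<Sum>b\<in>Basis. C b)"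
  have "onorm (ddir X x) \<le> L" for x
    unfolding L_def by (rule onorm_le, rule linear_bound_basis[OF has_derivative_linear[OF sm_hd[OF sm_field UNIV_I]] C(2)])
  then have "norm (X x - X y) \<le> L * norm (x - y)" for x y
    by (intro differentiable_bound[where S=UNIV and f'="ddir X"]) (use sm_hd[OF sm_field] in auto)
  moreover have "L \<ge> 0" unfolding L_def by (intro sum_nonneg C)
  ultimately show ?thesis by blast
qed

sublocale lipschitz_field X
  by unfold_locales (rule sm_field lipschitz)+

text \<open>Scaling the field rather than the time gives a map for every real \<open>s\<close>,
  negative ones included. On \<open>{0..1}\<close> it is the solution of \<open>X\<close> at time
  \<open>sin s\<close>; its velocity at \<open>s = 0\<close> is still \<open>X\<close>, since sine
  has derivative 1 there.\<close>

definition flow :: "real \<Rightarrow> 'a \<Rightarrow> 'a" where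
  "flow s x = sol (\<lambda>x. sin s *\<^sub>R X x) x 1"

text \<open>Adjoining \<open>s\<close> as a stationary coordinate turns joint smoothness of \<open>flow\<close> into smooth
  dependence on initial conditions. The factor \<open>sin s\<close>, rather than \<open>s\<close>, keeps the enlarged field
  globally Lipschitz.\<close>

definition suspended :: "'a \<times> real \<Rightarrow> 'a \<times> real" where
  "suspended q = (sin (snd q) *\<^sub>R X (fst q), 0)"

lemma abs_sin_diff_le: "\<bar>sin s - sin t\<bar> \<le> \<bar>s - t\<bar>" for s t :: real
proof -
  have "\<bar>sin s - sin t\<bar> = 2 * \<bar>sin ((s - t) / 2)\<bar> * \<bar>cos ((s + t) / 2)\<bar>"
    unfolding sin_diff_sin by (simp add: abs_mult)
  also have "\<dots> \<le> 2 * \<bar>(s - t) / 2\<bar> * 1"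
    by (intro mult_mono abs_sin_x_le_abs_x) auto
  finally show ?thesis by simp
qed

lemma suspended_lipschitz_field: "lipschitz_field suspended"
proof
  have s1: "sm UNIV (\<lambda>q :: 'a \<times> real. sin (snd q))"
    by (rule sm_compose[OF sm_sin sm_bounded_linear[OF bounded_linear_snd]]) auto
  have s2: "sm UNIV (\<lambda>q :: 'a \<times> real. X (fst q))"
    by (rule sm_compose[OF sm_field sm_bounded_linear[OF bounded_linear_fst]]) auto
  show "sm UNIV suspended"
    unfolding suspended_def[abs_def] by (intro sm_Pair sm_scaleR s1 s2 sm_const) auto
  obtain L where L: "L \<ge> 0" "\<And>x y. norm (X x - X y) \<le> L * norm (x - y)" using lipschitz by blast
  obtain M where M: "M \<ge> 0" "\<And>x. norm (X x) \<le> M"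
    using compact_support_bounded[OF compact_support off_support sm_continuous_on[OF sm_field]] by blast
  show "\<exists>L\<ge>0. \<forall>p q. norm (suspended p - suspended q) \<le> L * norm (p - q)"
  proof (intro exI[of _ "L + M"] conjI allI)
    show "0 \<le> L + M" using L M by simp
    fix p q :: "'a \<times> real"
    obtain x s y t where pq: "p = (x, s)" "q = (y, t)" by (cases p, cases q)
    have "norm (suspended p - suspended q) = norm (sin s *\<^sub>R (X x - X y) + (sin s - sin t) *\<^sub>R X y)"
      by (simp add: pq suspended_def norm_Pair algebra_simps)
    also have "\<dots> \<le> \<bar>sin s\<bar> * norm (X x - X y) + \<bar>sin s - sin t\<bar> * norm (X y)"
      by (rule norm_triangle_le) simp
    also have "\<dots> \<le> 1 * (L * norm (x - y)) + \<bar>s - t\<bar> * M"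
      by (intro add_mono mult_mono L M abs_sin_diff_le) (auto simp: L)
    also have "\<dots> \<le> L * norm (p - q) + norm (p - q) * M"
    proof (intro add_mono mult_right_mono M)
      show "1 * (L * norm (x - y)) \<le> L * norm (p - q)"
        using norm_fst_le[of "x - y" "s - t"] L by (simp add: pq mult_left_mono)
      show "\<bar>s - t\<bar> \<le> norm (p - q)"
        using norm_snd_le[of "s - t" "x - y"] by (simp add: pq)
    qed
    finally show "norm (suspended p - suspended q) \<le> (L + M) * norm (p - q)" by (simp add: algebra_simps)
  qed
qed

lemma flow_suspended: "sol suspended (x, s) 1 = (flow s x, s)"
proof -
  have l: "lipschitz_field (\<lambda>x. sin s *\<^sub>R X x)" by (rule lipschitz_field_scale)
  have "sol suspended (x, s) 1 = (sol (\<lambda>x. sin s *\<^sub>R X x) x 1, s)"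
  proof (rule lipschitz_field.sol_unique[OF suspended_lipschitz_field, where w="\<lambda>t. (sol (\<lambda>x. sin s *\<^sub>R X x) x t, s)"])
    show "((\<lambda>t. (sol (\<lambda>x. sin s *\<^sub>R X x) x t, s)) has_vector_derivative
       suspended (sol (\<lambda>x. sin s *\<^sub>R X x) x t, s)) (at t within {0..1})" if "t \<in> {0..1}" for t
      unfolding suspended_def fst_conv snd_conv
      by (intro has_vector_derivative_Pair lipschitz_field.sol_deriv[OF l that] has_vector_derivative_const)
  qed (simp_all add: lipschitz_field.sol_0[OF l])
  then show ?thesis by (simp add: flow_def)
qed

lemma flow_smooth: "sm UNIV (\<lambda>q. flow (snd q) (fst q))"
proof -
  have "sm UNIV (\<lambda>q. sol suspended q 1)"
    by (rule lipschitz_field.sol_sm[OF suspended_lipschitz_field]) simp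
  from sm_linear_comp[OF bounded_linear_fst this]
  show ?thesis by (rule sm_cong) (metis flow_suspended fst_conv prod.collapse)
qed

text \<open>Sine is odd, so \<open>- s\<close> belongs to the opposite field and
  \<open>sol_reverse\<close> applies. Each \<open>flow s\<close> thus has its inverse within the
  same family.\<close>

lemma flow_neg: "flow (- s) (flow s x) = x"
  using lipschitz_field.sol_reverse[OF lipschitz_field_scale, of "sin s" x] by (simp add: flow_def)

lemma flow_off: "x \<notin> K \<Longrightarrow> flow s x = x"
  unfolding flow_def
  by (rule lipschitz_field.sol_unique[OF lipschitz_field_scale, where w="\<lambda>_. x"])
    (simp_all add: off_support)

text \<open>If \<open>flow s x\<close> were outside \<open>K\<close>, then \<open>flow (- s)\<close>
  would fix it, and by \<open>flow_neg\<close> it would be \<open>x\<close> itself.\<close>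

lemma flow_in: "x \<in> K \<Longrightarrow> flow s x \<in> K"
  using flow_off[of "flow s x" "- s"] flow_neg[of s x] by metis

lemma flow_sol: "s \<in> {0..1} \<Longrightarrow> flow s x = sol X x (sin s)"
  unfolding flow_def using sol_scale[of "sin s" 1 x] sin_ge_zero[of s] pi_gt3 by auto

lemma sol_off: "x \<notin> K \<Longrightarrow> t \<in> {0..1} \<Longrightarrow> sol X x t = x"
  by (rule sol_unique) (simp_all add: off_support)

lemma sol_in: 
  assumes "x \<in> K" "t \<in> {0..1}"
  shows "sol X x t \<in> K"
proof -
  have l: "lipschitz_field (\<lambda>x. t *\<^sub>R X x)" by (rule lipschitz_field_scale)
  have l': "lipschitz_field (\<lambda>x. - (t *\<^sub>R X x))"
    using lipschitz_field_scale[of "- t"] by simp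
  define y where "y = sol (\<lambda>x. t *\<^sub>R X x) x 1"
  have y: "sol X x t = y" unfolding y_def using sol_scale[OF assms(2), of 1 x] by simp
  have x: "sol (\<lambda>x. - (t *\<^sub>R X x)) y 1 = x"
    unfolding y_def by (rule lipschitz_field.sol_reverse[OF l])
  show ?thesis
  proof (rule ccontr)
    assume n: "sol X x t \<notin> K"
    have "sol (\<lambda>x. - (t *\<^sub>R X x)) y 1 = y"
      by (rule lipschitz_field.sol_unique[OF l', where w="\<lambda>_. y"]) (use n y off_support in simp_all)
    with x n y assms(1) show False by simp
  qed
qed

end

text \<open>The standard flat function \<open>exp (- 1 / u)\<close> together with its multiples by
  powers of \<open>1 / u\<close>: the span of this family is closed under differentiation, which
  lets smoothness be shown for all \<open>n\<close> at once.\<close>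

definition flat_exp :: "nat \<Rightarrow> real \<Rightarrow> real" where
  "flat_exp n u = (if u > 0 then inverse u ^ n * exp (- inverse u) else 0)"

lemma flat_exp_isCont_0: "isCont (flat_exp n) 0"
proof -
  have "((\<lambda>u::real. inverse u ^ n / exp (inverse u)) \<longlongrightarrow> 0) (at_right 0)"
    by (rule filterlim_compose[OF tendsto_power_div_exp_0 filterlim_inverse_at_top_right])
  then have "(flat_exp n \<longlongrightarrow> 0) (at_right 0)"
    by (rule Lim_transform_eventually)
      (auto simp: flat_exp_def eventually_at_right_less exp_minus divide_inverse intro!: eventually_at_rightI[of 0 1])
  moreover have "(flat_exp n \<longlongrightarrow> 0) (at_left 0)"
    by (rule Lim_transform_eventually[where f="\<lambda>_. 0"])
      (auto simp: flat_exp_def intro!: eventually_at_leftI[of "-1" 0])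
  ultimately show ?thesis by (simp add: isCont_def filterlim_split_at flat_exp_def)
qed

lemma flat_exp_deriv:
  "(flat_exp n has_derivative (\<lambda>v. v * (flat_exp (n+2) u - real n * flat_exp (n+1) u))) (at u)"
proof -
  consider "u > 0" | "u < 0" | "u = 0" by linarith
  then have "(flat_exp n has_real_derivative (flat_exp (n+2) u - real n * flat_exp (n+1) u)) (at u)"
  proof cases
    case 1
    have "((\<lambda>u. inverse u ^ n * exp (- inverse u)) has_real_derivative
       (inverse u ^ (n+2) * exp (- inverse u) - real n * (inverse u ^ (n+1) * exp (- inverse u)))) (at u)"
    proof (cases n)
      case 0
      then show ?thesis using 1 by (auto intro!: derivative_eq_intros simp: power2_eq_square)
    next
      case (Suc m)
      have di: "(inverse has_real_derivative - (inverse u * inverse u)) (at u)"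
        using 1 by (auto intro!: derivative_eq_intros)
      have de: "((\<lambda>u. exp (- inverse u)) has_real_derivative exp (- inverse u) * (inverse u * inverse u)) (at u)"
        using 1 by (auto intro!: derivative_eq_intros)
      from DERIV_mult[OF DERIV_power_Suc[OF di, of m] de]
      show ?thesis unfolding Suc by (simp add: algebra_simps)
    qed
    then show ?thesis
      by (rule has_field_derivative_transform_within_open[where S="{0<..}", THEN DERIV_cong])
        (use 1 in \<open>auto simp: flat_exp_def\<close>)
  next
    case 2
    show ?thesis
      by (rule has_field_derivative_transform_within_open[where S="{..<0}" and f="\<lambda>_. 0", THEN DERIV_cong])
        (use 2 in \<open>auto simp: flat_exp_def\<close>)
  next
    case 3
    \<comment> \<open>At the origin the difference quotient of \<open>flat_exp n\<close> is exactly
      \<open>flat_exp (Suc n)\<close>, so differentiability there reduces to continuity of the next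
      member.\<close>
    have "(flat_exp (Suc n) \<longlongrightarrow> 0) (at 0)"
      using flat_exp_isCont_0[of "Suc n"] by (simp add: isCont_def flat_exp_def)
    then have "((\<lambda>h. (flat_exp n (0 + h) - flat_exp n 0) / h) \<longlongrightarrow> 0) (at 0)"
      by (rule Lim_transform_eventually) (auto simp: flat_exp_def divide_inverse intro!: always_eventually)
    then show ?thesis using 3 by (simp add: DERIV_def flat_exp_def)
  qed
  then show ?thesis by (simp add: has_field_derivative_def mult_commute_abs)
qed

lemma sm_flat_exp: "sm UNIV (flat_exp n)"
proof -
  have c: "continuous_on UNIV (flat_exp n)" for n
    using flat_exp_deriv has_derivative_continuous by (blast intro: continuous_at_imp_continuous_on)
  then have c2: "continuous_on (UNIV \<times> UNIV) (\<lambda>p :: real \<times> real. flat_exp n (snd p))" for n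
    by (rule continuous_on_compose2) (auto intro!: continuous_intros)
  have "ck k UNIV UNIV (\<lambda>_. flat_exp n)" for k
  proof (induction k arbitrary: n)
    case 0 then show ?case using c2 by simp
  next
    case (Suc k)
    show ?case
    proof (rule ck_SucI)
      show "(flat_exp n has_derivative (\<lambda>v. v * (flat_exp (n+2) u - real n * flat_exp (n+1) u))) (at u)" for u
        by (rule flat_exp_deriv)
      show "ck k UNIV UNIV (\<lambda>t u. v * (flat_exp (n+2) u - real n * flat_exp (n+1) u))" for v
        by (intro ck_mult ck_diff ck_const Suc.IH) auto
    qed (use c2 in auto)
  qed
  then show ?thesis by (simp add: sm_def)
qed

lemma exists_bump:
  fixes x0 :: "'a::euclidean_space"
  assumes "r > 0"
  shows "\<exists>\<rho> :: 'a \<Rightarrow> real. sm UNIV \<rho> \<and> \<rho> x0 = 1 \<and> (\<forall>x. x \<notin> cball x0 r \<longrightarrow> \<rho> x = 0)"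
proof -
  define \<rho> where "\<rho> x = inverse (flat_exp 0 (r\<^sup>2)) * flat_exp 0 (r\<^sup>2 - (x - x0) \<bullet> (x - x0))" for x
  have "sm UNIV \<rho>" unfolding \<rho>_def
    by (intro sm_mult sm_const sm_compose[OF sm_flat_exp] sm_diff sm_inner sm_ident) auto
  moreover have "\<rho> x0 = 1" using assms by (simp add: \<rho>_def flat_exp_def)
  moreover have "\<rho> x = 0" if "x \<notin> cball x0 r" for x
  proof -
    have "r < norm (x - x0)" using that by (simp add: dist_norm norm_minus_commute)
    then have "r\<^sup>2 < (norm (x - x0))\<^sup>2" using assms by (intro power_strict_mono) auto
    then show ?thesis by (simp add: \<rho>_def flat_exp_def power2_norm_eq_inner)
  qed
  ultimately show ?thesis by blast
qed


section \<open>Contact Hamiltonian fields in a chart\<close>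

lemma operator_close:
  fixes B :: "'b::metric_space \<Rightarrow> 'a::euclidean_space \<Rightarrow> 'c::euclidean_space"
  assumes V: "open V" "x0 \<in> V" and lin: "\<And>x. x \<in> V \<Longrightarrow> linear (B x)"
    and c: "\<And>e. continuous_on V (\<lambda>x. B x e)" and e: "e > 0"
  shows "\<exists>d>0. ball x0 d \<subseteq> V \<and> (\<forall>x\<in>ball x0 d. \<forall>v. norm (B x v - B x0 v) \<le> e * norm v)"
proof -
  define e' where "e' = e / DIM('a)"
  have e': "e' > 0" using e by (simp add: e'_def)
  obtain d0 where d0: "d0 > 0" "ball x0 d0 \<subseteq> V" using V openE by blast
  have "\<exists>d>0. \<forall>x. dist x x0 < d \<longrightarrow> dist (B x b) (B x0 b) < e'" for b
  proof -
    have "isCont (\<lambda>x. B x b) x0" using c[of b] V continuous_on_eq_continuous_at by blast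
    then show ?thesis using e' unfolding continuous_at_eps_delta by blast
  qed
  then obtain d where d: "\<And>b. d b > 0" "\<And>b x. dist x x0 < d b \<Longrightarrow> dist (B x b) (B x0 b) < e'" by metis
  define r where "r = min d0 (Min (d ` (Basis :: 'a set)))"
  have r: "r > 0" "r \<le> d0" "\<And>b. b \<in> Basis \<Longrightarrow> r \<le> d b" unfolding r_def using d(1) d0 by (auto simp: min.coboundedI2)
  show ?thesis
  proof (rule exI[of _ r], intro conjI ballI allI r(1))
    show "ball x0 r \<subseteq> V" using r(2) d0(2) by auto
    fix x v assume x: "x \<in> ball x0 r"
    then have xV: "x \<in> V" using r(2) d0(2) by auto
    have l: "linear (\<lambda>v. B x v - B x0 v)" by (intro linear_compose_sub lin xV V)
    have "norm (B x v - B x0 v) \<le> (\<Sum>b\<in>(Basis::'a set). e') * norm v"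
    proof (rule linear_bound_basis[OF l])
      fix b :: 'a assume b: "b \<in> Basis"
      show "norm (B x b - B x0 b) \<le> e'"
        using d(2)[of x b] x r(3)[OF b] by (auto simp: dist_commute dist_norm[of "B x b", symmetric])
    qed
    then show "norm (B x v - B x0 v) \<le> e * norm v" by (simp add: e'_def)
  qed
qed

text \<open>An injective linear map of a finite dimensional space is bounded below by some
  \<open>m > 0\<close>; a perturbation of operator size \<open>m / 2\<close> leaves the lower bound
  \<open>m / 2\<close>.\<close>

lemma injective_near:
  fixes B :: "'b::metric_space \<Rightarrow> 'a::euclidean_space \<Rightarrow> 'a"
  assumes V: "open V" "x0 \<in> V" and lin: "\<And>x. x \<in> V \<Longrightarrow> linear (B x)"
    and c: "\<And>e. continuous_on V (\<lambda>x. B x e)" and inj: "\<And>v. B x0 v = 0 \<Longrightarrow> v = 0"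
  shows "\<exists>m>0. \<exists>d>0. ball x0 d \<subseteq> V \<and> (\<forall>x\<in>ball x0 d. \<forall>v. m * norm v \<le> norm (B x v))"
proof -
  have l: "linear (B x0)" by (rule lin[OF V(2)])
  have "inj (B x0)" using inj by (simp add: linear_injective_0[OF l])
  from linear_inj_bounded_below_pos[OF l this]
  obtain m where m: "m > 0" "\<And>v. m * norm v \<le> norm (B x0 v)" by metis
  from operator_close[OF V lin c half_gt_zero[OF m(1)]]
  obtain d where d: "d > 0" "ball x0 d \<subseteq> V" "\<And>x v. x \<in> ball x0 d \<Longrightarrow> norm (B x v - B x0 v) \<le> m / 2 * norm v" by blast
  have "m / 2 * norm v \<le> norm (B x v)" if "x \<in> ball x0 d" for x v
    using d(3)[OF that, of v] m(2)[of v] norm_triangle_ineq2[of "B x0 v" "B x v"] norm_minus_commute[of "B x v" "B x0 v"] by simp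
  then show ?thesis using m d by (intro exI[of _ "m/2"]) auto
qed

text \<open>Differentiating \<open>B x (y x) = w x\<close> shows that each directional derivative of
  \<open>y\<close> solves a system with the same \<open>B\<close> and a right hand side made of
  derivatives of \<open>w\<close> and \<open>B\<close> and of \<open>y\<close> itself. So regularity
  of \<open>y\<close> climbs one order at a time, and no formula for the inverse enters.\<close>

lemma linear_solution_smooth:
  fixes B :: "'b::euclidean_space \<Rightarrow> 'a::euclidean_space \<Rightarrow> 'a"
  assumes V: "open V" and lin: "\<And>x. x \<in> V \<Longrightarrow> linear (B x)"
    and smB: "\<And>e. sm V (\<lambda>x. B x e)" and inj: "\<And>x v. x \<in> V \<Longrightarrow> B x v = 0 \<Longrightarrow> v = 0"
    and w: "sm V w" and y: "\<And>x. x \<in> V \<Longrightarrow> B x (y x) = w x"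
  shows "sm V y"
proof -
  have cB: "continuous_on V (\<lambda>x. B x e)" for e by (rule sm_continuous_on[OF smB])
  have Binj: "inj (B x)" if "x \<in> V" for x
    using inj[OF that] by (simp add: linear_injective_0[OF lin[OF that]])
  have near: "\<exists>m>0. \<exists>d>0. ball x0 d \<subseteq> V \<and> (\<forall>x\<in>ball x0 d. \<forall>v. m * norm v \<le> norm (B x v))" if "x0 \<in> V" for x0
    by (rule injective_near[OF V that lin cB inj[OF that]])
  have est: "norm (y x - y x0) \<le> norm (w x - B x (y x0)) / m"
    if "m > 0" "x \<in> V" "\<And>v. m * norm v \<le> norm (B x v)" "B x (y x) = w x" for m x x0 and w y :: "'b \<Rightarrow> 'a"
    using that(3)[of "y x - y x0"] that(1,4) linear_diff[OF lin[OF that(2)], of "y x" "y x0"] by (simp add: field_simps)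
  have cont: "continuous_on V y" if w: "continuous_on V w" and y: "\<And>x. x \<in> V \<Longrightarrow> B x (y x) = w x" for w y
  proof (rule continuous_at_imp_continuous_on, rule ballI)
    fix x0 assume x0: "x0 \<in> V"
    from near[OF x0] obtain m d where m: "m > 0" "d > 0" "ball x0 d \<subseteq> V"
      "\<And>x v. x \<in> ball x0 d \<Longrightarrow> m * norm v \<le> norm (B x v)" by blast
    have "isCont (\<lambda>x. w x - B x (y x0)) x0"
      using w cB[of "y x0"] x0 V by (intro continuous_diff) (auto simp: continuous_on_eq_continuous_at)
    then have "((\<lambda>x. w x - B x (y x0)) \<longlongrightarrow> 0) (at x0)"
      using y[OF x0] by (simp add: isCont_def)
    then have l: "((\<lambda>x. norm (w x - B x (y x0)) / m) \<longlongrightarrow> 0) (at x0)"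
      using tendsto_divide[OF tendsto_norm_zero tendsto_const, of "\<lambda>x. w x - B x (y x0)" "at x0" m] m(1) by simp
    have "\<forall>\<^sub>F x in at x0. norm (y x - y x0) \<le> norm (w x - B x (y x0)) / m"
      unfolding eventually_at
      by (intro exI[of _ d] conjI m(2) ballI impI est[OF m(1)] m(4) y) (use m(3) in \<open>auto simp: dist_commute\<close>)
    from Lim_null_comparison[OF this l] show "isCont y x0" by (simp add: isCont_def LIM_zero_iff)
  qed
  have deriv: "\<exists>N. (y has_derivative N) (at x0) \<and> (\<forall>h. B x0 (N h) = w' h - ddir (\<lambda>x. B x (y x0)) x0 h)"
    if x0: "x0 \<in> V" and w: "(w has_derivative w') (at x0)" and y: "\<And>x. x \<in> V \<Longrightarrow> B x (y x) = w x" for w w' y x0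
  proof -
    \<comment> \<open>Freezing the solution at \<open>x0\<close> gives
      \<open>u x = B x (y x - y x0)\<close> with \<open>u x0 = 0\<close>, so the increment of
      \<open>y\<close> is controlled by a function with known derivative.\<close>
    define u where "u x = w x - B x (y x0)" for x
    define u' where "u' h = w' h - ddir (\<lambda>x. B x (y x0)) x0 h" for h
    have u: "(u has_derivative u') (at x0)" unfolding u_def u'_def
      by (intro has_derivative_diff w sm_hd[OF smB x0])
    have u0: "u x0 = 0" using y[OF x0] by (simp add: u_def)
    obtain g where g: "linear g" "\<And>v. B x0 (g v) = v"
      using linear_injective_isomorphism[OF lin[OF x0] Binj[OF x0]] by blast
    have N: "linear (\<lambda>h. g (u' h))"
      using linear_compose[OF has_derivative_linear[OF u] g(1)] by (simp add: o_def)
    from near[OF x0] obtain m d where m: "m > 0" "d > 0" "ball x0 d \<subseteq> V"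
      "\<And>x v. x \<in> ball x0 d \<Longrightarrow> m * norm v \<le> norm (B x v)" by blast
    obtain K where K: "K \<ge> 0" "\<And>h. norm (u' h) \<le> K * norm h"
      using bounded_linear.nonneg_bounded[OF has_derivative_bounded_linear[OF u]] by (metis mult.commute)
    have "(y has_derivative (\<lambda>h. g (u' h))) (at x0)"
      unfolding has_derivative_within_alt
    proof (intro conjI allI impI)
      show "bounded_linear (\<lambda>h. g (u' h))" using N by (simp add: linear_conv_bounded_linear)
      fix e :: real assume e: "e > 0"
      \<comment> \<open>\<open>e2\<close> limits the Taylor error of \<open>u\<close>,
        \<open>e1\<close> the change of \<open>B\<close>. Since the increment of \<open>y\<close> is
        at most \<open>(K + 1) * norm h / m\<close>, each contributes
        \<open>e * m / 2 * norm h\<close>; the cap 1 is what yields \<open>K + 1\<close>.\<close>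
      define e2 where "e2 = min 1 (e * m / 2)"
      define e1 where "e1 = e * m\<^sup>2 / (2 * (K + 1))"
      have e2: "e2 > 0" "e2 \<le> 1" "e2 \<le> e * m / 2" using e m by (auto simp: e2_def)
      have e1: "e1 > 0" using e m K by (simp add: e1_def)
      obtain d1 where d1: "d1 > 0" "\<And>x v. x \<in> ball x0 d1 \<Longrightarrow> norm (B x v - B x0 v) \<le> e1 * norm v"
        using operator_close[OF V x0 lin cB e1] by blast
      obtain d2 where d2: "d2 > 0" "\<And>x. norm (x - x0) < d2 \<Longrightarrow> norm (u x - u x0 - u' (x - x0)) \<le> e2 * norm (x - x0)"
        using u[unfolded has_derivative_within_alt] e2(1) by blast
      show "\<exists>d>0. \<forall>x\<in>UNIV. norm (x - x0) < d \<longrightarrow> norm (y x - y x0 - g (u' (x - x0))) \<le> e * norm (x - x0)"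
      proof (intro exI[of _ "min d (min d1 d2)"] conjI ballI impI)
        fix x assume x: "norm (x - x0) < min d (min d1 d2)"
        define h where "h = x - x0"
        have b: "x \<in> ball x0 d" "x \<in> ball x0 d1" using x by (auto simp: dist_norm norm_minus_commute)
        then have xV: "x \<in> V" using m(3) by auto
        have ux: "norm (u x - u' h) \<le> e2 * norm h" using d2(2)[of x] x u0 by (simp add: h_def)
        have "norm (u x) \<le> norm (u x - u' h) + norm (u' h)" using norm_triangle_ineq[of "u x - u' h" "u' h"] by simp
        also have "\<dots> \<le> 1 * norm h + K * norm h"
          using ux K(2)[of h] mult_right_mono[OF e2(2) norm_ge_zero[of h]] by linarith
        finally have un: "norm (u x) \<le> (K + 1) * norm h" by (simp add: algebra_simps)
        have yn: "norm (y x - y x0) \<le> norm (u x) / m"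
          unfolding u_def
          by (rule est[where w=w and y=y and m=m, OF m(1) xV]) (use m(4)[OF b(1)] y[OF xV] in auto)
        have "m * norm (y x - y x0 - g (u' h)) \<le> norm (B x0 (y x - y x0 - g (u' h)))"
          by (rule m(4)) (use m(2) in simp)
        also have "B x0 (y x - y x0 - g (u' h)) = (u x - u' h) - (B x (y x - y x0) - B x0 (y x - y x0))"
          using linear_diff[OF lin[OF x0]] linear_diff[OF lin[OF xV]] y[OF xV] g(2) by (simp add: u_def)
        also have "norm \<dots> \<le> e2 * norm h + e1 * norm (y x - y x0)"
          by (rule norm_triangle_le_diff[OF add_mono[OF ux d1(2)[OF b(2)]]])
        also have "\<dots> \<le> (e * m / 2) * norm h + e1 * ((K + 1) * norm h / m)"
        proof (intro add_mono mult_right_mono mult_left_mono)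
          have "norm (u x) / m \<le> (K + 1) * norm h / m" using un m(1) by (simp add: divide_right_mono)
          then show "norm (y x - y x0) \<le> (K + 1) * norm h / m" using yn by linarith
        qed (use e1 e2 in auto)
        also have "\<dots> = m * (e * norm h)"
        proof -
          have "e * m\<^sup>2 / (2 * k) * (k * norm h / m) = e * m / 2 * norm h" if "k \<noteq> 0" for k
            using that m(1) by (simp add: power2_eq_square field_simps)
          from this[of "K + 1"] have "e1 * ((K + 1) * norm h / m) = e * m / 2 * norm h"
            using K(1) by (simp add: e1_def)
          then show ?thesis by (simp only:) (simp add: field_simps)
        qed
        finally have "norm (y x - y x0 - g (u' h)) \<le> e * norm h" using m(1) by simp
        then show "norm (y x - y x0 - g (u' (x - x0))) \<le> e * norm (x - x0)" by (simp add: h_def)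
      qed (use m d1 d2 in auto)
    qed
    then show ?thesis using g(2) by (intro exI[of _ "\<lambda>h. g (u' h)"]) (simp add: u'_def)
  qed
  have c2: "continuous_on (UNIV \<times> V) (\<lambda>p :: real \<times> 'b. f (snd p))" if "continuous_on V f" for f :: "'b \<Rightarrow> 'a"
    by (rule continuous_on_compose2[OF that]) (auto intro!: continuous_intros)
  have "ck k UNIV V (\<lambda>_. y)" if "ck k UNIV V (\<lambda>_. w)" "\<And>x. x \<in> V \<Longrightarrow> B x (y x) = w x" for k w y
    using that
  proof (induction k arbitrary: w y)
    case 0
    have "continuous_on V ((\<lambda>p. w (snd p)) \<circ> (\<lambda>x. (0::real, x)))"
      by (rule continuous_on_compose)
        (use 0(1) in \<open>auto intro!: continuous_intros continuous_on_subset[where s="UNIV \<times> V"]\<close>)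
    then show ?case using cont[OF _ 0(2)] c2 by (simp add: o_def)
  next
    case (Suc k)
    have yk: "ck k UNIV V (\<lambda>_. y)" by (rule Suc.IH[OF ck_Suc_imp[OF Suc.prems(1)] Suc.prems(2)])
    have "\<exists>N. (y has_derivative N) (at x) \<and> (\<forall>h. B x (N h) = ddir w x h - ddir (\<lambda>z. B z (y x)) x h)" if "x \<in> V" for x
      by (rule deriv[OF that ck_hd[OF Suc.prems(1) _ that] Suc.prems(2)]) auto
    then obtain N where N: "\<And>x. x \<in> V \<Longrightarrow> (y has_derivative N x) (at x)"
      "\<And>x h. x \<in> V \<Longrightarrow> B x (N x h) = ddir w x h - ddir (\<lambda>z. B z (y x)) x h" by metis
    have e: "ddir (\<lambda>z. B z c) x h = (\<Sum>b\<in>Basis. (c \<bullet> b) *\<^sub>R ddir (\<lambda>z. B z b) x h)" if "x \<in> V" for c x h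
    proof -
      have "((\<lambda>z. B z c) has_derivative (\<lambda>h. \<Sum>b\<in>Basis. (c \<bullet> b) *\<^sub>R ddir (\<lambda>z. B z b) x h)) (at x)"
      proof (rule has_derivative_transform_within_open[OF _ V that])
        show "((\<lambda>z. \<Sum>b\<in>Basis. (c \<bullet> b) *\<^sub>R B z b) has_derivative (\<lambda>h. \<Sum>b\<in>Basis. (c \<bullet> b) *\<^sub>R ddir (\<lambda>z. B z b) x h)) (at x)"
          by (intro has_derivative_sum has_derivative_scaleR_right sm_hd[OF smB that])
        show "(\<Sum>b\<in>Basis. (c \<bullet> b) *\<^sub>R B z b) = B z c" if "z \<in> V" for z
          using linear_sum[OF lin[OF that], of "\<lambda>b. (c \<bullet> b) *\<^sub>R b" Basis] linear_scale[OF lin[OF that]]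
          by (simp add: euclidean_representation)
      qed
      from fun_cong[OF frechet_derivative_at[OF this]] show ?thesis by simp
    qed
    have "ck k UNIV V (\<lambda>t x. N x v)" for v
    proof (rule Suc.IH)
      show "ck k UNIV V (\<lambda>_ x. ddir w x v - (\<Sum>b\<in>Basis. (y x \<bullet> b) *\<^sub>R ddir (\<lambda>z. B z b) x v))"
        by (intro ck_diff ck_sum ck_scaleR ck_inner yk ck_const V ck_ddir[OF Suc.prems(1)] sm_ck[OF sm_ddir[OF smB]]) auto
      show "B x (N x v) = ddir w x v - (\<Sum>b\<in>Basis. (y x \<bullet> b) *\<^sub>R ddir (\<lambda>z. B z b) x v)" if "x \<in> V" for x
        using N(2)[OF that, of v] e[OF that, of "y x" v] by simp
    qed
    then show ?case
      by (intro ck_SucI[where f'="\<lambda>_. N"] V N c2 cont[OF _ Suc.prems(2)])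
        (use Suc.prems(1) ck_cont[OF yk] in \<open>auto intro!: continuous_at_imp_continuous_on differentiable_imp_continuous_within\<close>)
  qed
  from this[OF _ y] show ?thesis using w V by (simp add: sm_def)
qed

text \<open>The exterior derivative evaluated on the constant extensions of \<open>v\<close> and
  \<open>w\<close>; these commute, so there is no bracket term. No factor 1/2 is used.\<close>

definition dform :: "('a::euclidean_space \<Rightarrow> 'a \<Rightarrow> real) \<Rightarrow> 'a \<Rightarrow> 'a \<Rightarrow> 'a \<Rightarrow> real" where
  "dform a x v w = ddir (\<lambda>y. a y w) x v - ddir (\<lambda>y. a y v) x w"

lemma dform_alt: "dform a x v v = 0" and dform_swap: "dform a x v w = - dform a x w v"
  by (simp_all add: dform_def)

section \<open>Reeb fields and contact Hamiltonian fields on an open set\<close>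

locale euclidean_form =
  fixes V :: "'a::euclidean_space set" and a :: "'a \<Rightarrow> 'a \<Rightarrow> real"
  assumes open_V: "open V" and lin: "\<And>x. x \<in> V \<Longrightarrow> linear (a x)" and sm_form: "\<And>e. sm V (\<lambda>x. a x e)"
begin

lemma form_basis: "x \<in> V \<Longrightarrow> a x v = (\<Sum>b\<in>Basis. (v \<bullet> b) * a x b)"
  using linear_sum[OF lin, of x "\<lambda>b. (v \<bullet> b) *\<^sub>R b" Basis] linear_scale[OF lin, of x]
  by (simp add: euclidean_representation)

lemma ddir_form_basis:
  assumes "x \<in> V"
  shows "ddir (\<lambda>y. a y c) x h = (\<Sum>b\<in>Basis. (c \<bullet> b) * ddir (\<lambda>z. a z b) x h)"
proof -
  have "((\<lambda>z. a z c) has_derivative (\<lambda>h. \<Sum>b\<in>Basis. (c \<bullet> b) * ddir (\<lambda>z. a z b) x h)) (at x)"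
  proof (rule has_derivative_transform_within_open[OF _ open_V assms])
    show "((\<lambda>z. \<Sum>b\<in>Basis. (c \<bullet> b) * a z b) has_derivative (\<lambda>h. \<Sum>b\<in>Basis. (c \<bullet> b) * ddir (\<lambda>z. a z b) x h)) (at x)"
      by (intro has_derivative_sum has_derivative_mult_right sm_hd[OF sm_form assms])
  qed (rule form_basis[symmetric])
  from fun_cong[OF frechet_derivative_at[OF this]] show ?thesis by simp
qed

text \<open>Product rule with both the base point and the vector moving. Smoothness of the form is
  given for constant vectors only, so the vector is expanded in the basis.\<close>

lemma form_deriv:
  assumes "u t \<in> V" "(u has_derivative u') (at t within S)" "(Z has_derivative Z') (at t within S)" "t \<in> S"
    and "\<And>s. s \<in> S \<Longrightarrow> u s \<in> V"
  shows "((\<lambda>t. a (u t) (Z t)) has_derivative (\<lambda>h. ddir (\<lambda>y. a y (Z t)) (u t) (u' h) + a (u t) (Z' h))) (at t within S)"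
proof -
  have au: "((\<lambda>t. a (u t) b) has_derivative (\<lambda>h. ddir (\<lambda>y. a y b) (u t) (u' h))) (at t within S)" for b
    by (rule has_derivative_compose[OF assms(2)], rule sm_hd[OF sm_form assms(1)])
  have "((\<lambda>t. \<Sum>b\<in>Basis. (Z t \<bullet> b) * a (u t) b) has_derivative
     (\<lambda>h. \<Sum>b\<in>Basis. (Z t \<bullet> b) * ddir (\<lambda>y. a y b) (u t) (u' h) + (Z' h \<bullet> b) * a (u t) b)) (at t within S)"
    by (intro has_derivative_sum has_derivative_mult au has_derivative_inner_left assms(3))
  moreover have "(\<lambda>h. \<Sum>b\<in>Basis. (Z t \<bullet> b) * ddir (\<lambda>y. a y b) (u t) (u' h) + (Z' h \<bullet> b) * a (u t) b)
     = (\<lambda>h. ddir (\<lambda>y. a y (Z t)) (u t) (u' h) + a (u t) (Z' h))"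
    by (rule ext) (simp add: sum.distrib ddir_form_basis[OF assms(1), of "Z t"] form_basis[OF assms(1), of "Z' _"])
  ultimately have "((\<lambda>t. \<Sum>b\<in>Basis. (Z t \<bullet> b) * a (u t) b) has_derivative
     (\<lambda>h. ddir (\<lambda>y. a y (Z t)) (u t) (u' h) + a (u t) (Z' h))) (at t within S)" by simp
  then show ?thesis
    by (rule has_derivative_transform[OF assms(4), rotated]) (use form_basis[OF assms(5)] in simp)
qed

lemma linear_ddir_form1: "x \<in> V \<Longrightarrow> linear (\<lambda>v. ddir (\<lambda>y. a y w) x v)"
  by (rule has_derivative_linear[OF sm_hd[OF sm_form]])

lemma linear_ddir_form2:
  assumes "x \<in> V"
  shows "linear (\<lambda>w. ddir (\<lambda>y. a y w) x v)"
proof -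
  have "linear (\<lambda>w. \<Sum>b\<in>Basis. (w \<bullet> b) * ddir (\<lambda>y. a y b) x v)"
    by (rule linearI) (simp_all add: inner_add_left algebra_simps sum.distrib sum_distrib_left)
  then show ?thesis by (subst ddir_form_basis[OF assms])
qed

lemma linear_dform1: "x \<in> V \<Longrightarrow> linear (\<lambda>v. dform a x v w)"
  unfolding dform_def by (intro linear_compose_sub linear_ddir_form1 linear_ddir_form2)

lemma linear_dform2: "x \<in> V \<Longrightarrow> linear (\<lambda>w. dform a x v w)"
  unfolding dform_def by (intro linear_compose_sub linear_ddir_form1 linear_ddir_form2)

lemma sm_dform: "sm V (\<lambda>x. dform a x v w)"
  unfolding dform_def by (intro sm_diff sm_ddir sm_form)

text \<open>The coordinate form of \<open>v \<mapsto> \<iota>\<^sub>v d\<alpha> + \<alpha>(v) \<alpha>\<close>, under which the Reeb field is the preimage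
  of \<open>\<alpha>\<close>.\<close>

definition flat :: "'a \<Rightarrow> 'a \<Rightarrow> 'a" where
  "flat x v = (\<Sum>b\<in>Basis. (dform a x v b + a x v * a x b) *\<^sub>R b)"

lemma flat_inner: 
  assumes "x \<in> V"
  shows "flat x v \<bullet> w = dform a x v w + a x v * a x w"
proof -
  have "dform a x v w + a x v * a x w = (\<Sum>b\<in>Basis. (w \<bullet> b) * (dform a x v b + a x v * a x b))"
    using linear_sum[OF linear_dform2[OF assms], of v "\<lambda>b. (w \<bullet> b) *\<^sub>R b" Basis]
      linear_scale[OF linear_dform2[OF assms], of v]
    by (simp add: euclidean_representation form_basis[OF assms, of w] algebra_simps sum.distrib sum_distrib_left)
  then show ?thesis unfolding flat_def inner_sum_left inner_scaleR_left by (simp add: inner_commute mult.commute)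
qed

lemma linear_flat: "x \<in> V \<Longrightarrow> linear (flat x)"
  unfolding flat_def
  by (rule linearI)
    (simp_all add: linear_add[OF linear_dform1] linear_add[OF lin] linear_scale[OF linear_dform1] linear_scale[OF lin]
      algebra_simps sum.distrib scaleR_sum_right)

lemma sm_flat: "sm V (\<lambda>x. flat x v)"
  unfolding flat_def
  by (intro sm_sum open_V sm_scaleR sm_add sm_dform sm_mult sm_form sm_const) auto

text \<open>\<open>flat p\<close> is injective: pairing \<open>flat p v = 0\<close> with
  \<open>v\<close> gives \<open>(a p v)^2 = 0\<close>, after which non-degeneracy on the kernel
  applies. Injectivity persists near \<open>p\<close>, and there the Reeb field is the smooth
  solution of the linear system whose right hand side represents the form itself.\<close>

lemma reeb_exists:
  assumes p: "p \<in> V" and nz: "\<exists>v. a p v \<noteq> 0"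
    and nd: "\<And>v. a p v = 0 \<Longrightarrow> (\<And>w. a p w = 0 \<Longrightarrow> dform a p v w = 0) \<Longrightarrow> v = 0"
  shows "\<exists>W R. open W \<and> p \<in> W \<and> W \<subseteq> V \<and> sm W R
     \<and> (\<forall>x\<in>W. a x (R x) = 1 \<and> (\<forall>w. dform a x (R x) w = 0) \<and> (\<forall>v. flat x v = 0 \<longrightarrow> v = 0))"
proof -
  have inj: "v = 0" if "flat p v = 0" for v
  proof -
    have f: "dform a p v w + a p v * a p w = 0" for w using flat_inner[OF p, of v w] that by simp
    from f[of v] have "a p v = 0" by (simp add: dform_alt)
    then show ?thesis using nd f by simp
  qed
  from injective_near[OF open_V p linear_flat sm_continuous_on[OF sm_flat] inj]
  obtain m d where md: "m > 0" "d > 0" "ball p d \<subseteq> V" "\<And>x v. x \<in> ball p d \<Longrightarrow> m * norm v \<le> norm (flat x v)" by blast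
  define U where "U = ball p d"
  have U: "open U" "p \<in> U" "U \<subseteq> V" using md by (auto simp: U_def)
  have linU: "linear (flat x)" if "x \<in> U" for x using linear_flat U that by blast
  have injU: "v = 0" if "x \<in> U" "flat x v = 0" for x v
  proof -
    have "m * norm v \<le> 0" using md(4)[of x v] that by (simp add: U_def)
    then show ?thesis using md(1) by (simp add: mult_le_0_iff)
  qed
  have "\<exists>v. flat x v = (\<Sum>b\<in>Basis. a x b *\<^sub>R b)" if "x \<in> U" for x
  proof -
    have "inj (flat x)" using injU[OF that] linear_injective_0[OF linU[OF that]] by blast
    from linear_injective_isomorphism[OF linU[OF that] this] show ?thesis by metis
  qed
  then obtain R where R: "\<And>x. x \<in> U \<Longrightarrow> flat x (R x) = (\<Sum>b\<in>Basis. a x b *\<^sub>R b)" by metis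
  have "sm U R"
  proof (rule linear_solution_smooth[OF U(1) linU _ injU _ R])
    show "sm U (\<lambda>x. flat x e)" for e by (rule sm_subset[OF sm_flat U(1,3)])
    show "sm U (\<lambda>x. \<Sum>b\<in>Basis. a x b *\<^sub>R b)"
      by (intro sm_sum U sm_scaleR sm_const sm_subset[OF sm_form U(1,3)]) auto
  qed auto
  have Req: "dform a x (R x) w + a x (R x) * a x w = a x w" if "x \<in> U" for x w
  proof -
    have "x \<in> V" using U that by auto
    moreover have "(\<Sum>b\<in>Basis. a x b *\<^sub>R b) \<bullet> w = a x w"
      unfolding form_basis[OF \<open>x \<in> V\<close>, of w] inner_sum_left
      by (rule sum.cong) (simp_all add: inner_commute mult.commute)
    ultimately show ?thesis using flat_inner[of x "R x" w] R[OF that] by simp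
  qed
  \<comment> \<open>Pairing the defining equation with \<open>R x\<close> gives
    \<open>(a x (R x))^2 = a x (R x)\<close>. So the value is 0 or 1, and it is 1 on the whole open
    set \<open>W\<close> where it does not vanish.\<close>
  have idem: "a x (R x) = 1" if "x \<in> U" "a x (R x) \<noteq> 0" for x
    using Req[OF that(1), of "R x"] that(2) by (simp add: dform_alt)
  \<comment> \<open>Otherwise the equation reads \<open>dform a p (R p) w = a p w\<close>. This
    vanishes for \<open>w\<close> in the kernel of the form, so \<open>R p = 0\<close> by
    non-degeneracy, and then the form itself is zero at \<open>p\<close>.\<close>
  have "a p (R p) \<noteq> 0"
  proof
    assume z: "a p (R p) = 0"
    have "R p = 0" by (rule nd[OF z]) (use Req[OF U(2)] z in auto)
    then have "a p w = 0" for w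
      using Req[OF U(2), of w] linear_0[OF linear_dform1[OF p]] linear_0[OF lin[OF p]] by simp
    then show False using nz by blast
  qed
  have smS: "sm U (\<lambda>x. \<Sum>b\<in>Basis. (R x \<bullet> b) * a x b)"
    by (intro sm_sum U sm_mult sm_inner \<open>sm U R\<close> sm_const sm_subset[OF sm_form U(1,3)]) auto
  have smA: "continuous_on U (\<lambda>x. a x (R x))"
    by (rule sm_continuous_on[OF sm_cong[OF smS]], rule form_basis[symmetric]) (use U(3) in auto)
  define W where "W = {x \<in> U. a x (R x) \<in> - {0}}"
  have "open W" unfolding W_def
    using continuous_open_preimage[OF smA U(1), of "- {0}"] by (simp add: vimage_def Int_def open_Compl)
  moreover have "p \<in> W" using \<open>a p (R p) \<noteq> 0\<close> U by (simp add: W_def)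
  moreover have "sm W R" by (rule sm_subset[OF \<open>sm U R\<close> \<open>open W\<close>]) (auto simp: W_def)
  moreover have "W \<subseteq> V" using U by (auto simp: W_def)
  moreover have "a x (R x) = 1 \<and> (\<forall>w. dform a x (R x) w = 0) \<and> (\<forall>v. flat x v = 0 \<longrightarrow> v = 0)" if "x \<in> W" for x
  proof -
    have x: "x \<in> U" "a x (R x) = 1" using that idem by (auto simp: W_def)
    then show ?thesis using Req[OF x(1)] injU[OF x(1)] by simp
  qed
  ultimately show ?thesis by blast
qed

end

text \<open>Non-degeneracy at one point yields a Reeb field on a neighbourhood \<open>W\<close> of
  it. Hamiltonians will be supported inside \<open>W\<close>, so that their fields extend by
  zero.\<close>

locale contact_patch = euclidean_form V a for V :: "'a::euclidean_space set" and a +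
  fixes W :: "'a set" and R :: "'a \<Rightarrow> 'a"
  assumes open_W: "open W" and W_sub: "W \<subseteq> V" and sm_reeb: "sm W R"
    and reeb: "\<And>x. x \<in> W \<Longrightarrow> a x (R x) = 1" "\<And>x w. x \<in> W \<Longrightarrow> dform a x (R x) w = 0"
    and flat_inj: "\<And>x v. x \<in> W \<Longrightarrow> flat x v = 0 \<Longrightarrow> v = 0"
begin

text \<open>The multiple \<open>m\<close> of the form may be unknown: evaluation on the Reeb vector
  shows \<open>m = 0\<close>, and injectivity of \<open>flat\<close> does the rest. Hamiltonian
  vectors can thus be compared without comparing their conformal factors.\<close>

lemma hamiltonian_vector_unique:
  assumes x: "x \<in> W" and "a x v = a x v'" and e: "\<And>e. dform a x v e - dform a x v' e = m * a x e"
  shows "v = v'"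
proof -
  have xV: "x \<in> V" using x W_sub by auto
  have a0: "a x (v - v') = 0" using assms(2) linear_diff[OF lin[OF xV]] by simp
  have d: "dform a x (v - v') e = m * a x e" for e
    using e linear_diff[OF linear_dform1[OF xV]] by simp
  have "m = 0" using d[of "R x"] dform_swap[of a x "v - v'" "R x"] reeb[OF x] by simp
  then have "flat x (v - v') \<bullet> w = 0" for w using flat_inner[OF xV] a0 d by simp
  then have "flat x (v - v') = 0" using inner_eq_zero_iff by blast
  then have "v - v' = 0" by (rule flat_inj[OF x])
  then show ?thesis by simp
qed

lemma hamiltonian_field_exists:
  assumes H: "sm UNIV H" and K: "compact K" "K \<subseteq> W" and off: "\<And>x. x \<notin> K \<Longrightarrow> H x = 0"
  shows "\<exists>X \<mu>. supported_field X K \<and> continuous_on UNIV \<mu> \<and> (\<forall>x. x \<notin> K \<longrightarrow> \<mu> x = 0)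
    \<and> (\<forall>x\<in>V. a x (X x) = H x \<and> (\<forall>e. dform a x (X x) e = - ddir H x e + \<mu> x * a x e))"
proof -
  have clK: "closed K" by (rule compact_imp_closed[OF K(1)])
  have DH: "ddir H x = (\<lambda>_. 0)" if "x \<notin> K" for x
    by (rule ddir_zero_off[OF clK off that])
  have HW: "sm W H" by (rule sm_subset[OF H open_W]) simp
  have aW: "sm W (\<lambda>x. a x e)" for e by (rule sm_subset[OF sm_form open_W W_sub])
  define \<mu>0 where "\<mu>0 x = (\<Sum>b\<in>Basis. (R x \<bullet> b) * ddir H x b)" for x
  have \<mu>0: "\<mu>0 x = ddir H x (R x)" for x
    unfolding \<mu>0_def by (subst ddir_basis[OF sm_differentiable[OF H UNIV_I]]) simp
  have sm\<mu>0: "sm W \<mu>0" unfolding \<mu>0_def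
    by (intro sm_sum open_W sm_mult sm_inner sm_reeb sm_const sm_ddir HW) auto
  define \<mu> where "\<mu> x = (if x \<in> W then \<mu>0 x else 0)" for x
  have \<mu>_off: "\<mu> x = 0" if "x \<notin> K" for x using DH[OF that] by (simp add: \<mu>_def \<mu>0)
  \<comment> \<open>The right hand side represents \<open>- dH + (dH(R) + H) \<alpha>\<close>.
    Pairing \<open>flat x (X x) = c x\<close> with \<open>R x\<close> cancels the two terms in
    \<open>dH(R)\<close> and leaves \<open>a x (X x) = H x\<close>; what remains is the equation for
    the contraction, with \<open>\<mu> = dH(R)\<close>.\<close>
  define c where "c x = (\<Sum>b\<in>Basis. (- ddir H x b + (\<mu>0 x + H x) * a x b) *\<^sub>R b)" for x
  have "\<exists>v. flat x v = c x" if "x \<in> W" for x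
  proof -
    have l: "linear (flat x)" using linear_flat W_sub that by blast
    have "inj (flat x)" using flat_inj[OF that] linear_injective_0[OF l] by blast
    from linear_injective_isomorphism[OF l this] show ?thesis by metis
  qed
  then obtain Y where Y: "\<And>x. x \<in> W \<Longrightarrow> flat x (Y x) = c x" by metis
  have smY: "sm W Y"
  proof (rule linear_solution_smooth[where B=flat and y=Y and w=c, OF open_W _ _ flat_inj _ Y])
    show "linear (flat x)" if "x \<in> W" for x using linear_flat W_sub that by blast
    show "sm W (\<lambda>x. flat x e)" for e by (rule sm_subset[OF sm_flat open_W W_sub])
    show "sm W c" unfolding c_def
      by (intro sm_sum open_W sm_scaleR sm_const sm_add sm_minus sm_ddir HW sm_mult sm\<mu>0 aW) auto
  qed auto
  define X where "X x = (if x \<in> W then Y x else 0)" for x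
  have X_off: "X x = 0" if "x \<notin> K" for x
  proof (cases "x \<in> W")
    case True
    have "c x = 0" using DH[OF that] off[OF that] by (simp add: c_def \<mu>0)
    then show ?thesis using flat_inj[OF True] Y[OF True] True by (simp add: X_def)
  qed (simp add: X_def)
  have "sm UNIV X"
    by (rule sm_extend_zero[OF sm_cong[OF smY] clK K(2) X_off]) (simp add: X_def)
  then have "supported_field X K" using K(1) X_off by unfold_locales auto
  moreover have "sm UNIV \<mu>"
    by (rule sm_extend_zero[OF sm_cong[OF sm\<mu>0] clK K(2) \<mu>_off]) (simp add: \<mu>_def)
  then have "continuous_on UNIV \<mu>" by (rule sm_continuous_on)
  moreover have "a x (X x) = H x \<and> (\<forall>e. dform a x (X x) e = - ddir H x e + \<mu> x * a x e)" if xV: "x \<in> V" for x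
  proof (cases "x \<in> W")
    case True
    have c: "c x \<bullet> e = - ddir H x e + (\<mu>0 x + H x) * a x e" for e
    proof -
      have "c x \<bullet> e = (\<Sum>b\<in>Basis. - ((e \<bullet> b) * ddir H x b) + (\<mu>0 x + H x) * ((e \<bullet> b) * a x b))"
        unfolding c_def inner_sum_left by (rule sum.cong) (simp_all add: inner_commute algebra_simps)
      also have "\<dots> = - ddir H x e + (\<mu>0 x + H x) * a x e"
        unfolding sum.distrib sum_negf sum_distrib_left[symmetric] form_basis[OF xV, of e]
        by (subst (2) ddir_basis[OF sm_differentiable[OF H UNIV_I]]) simp
      finally show ?thesis .
    qed
    have XY: "X x = Y x" using True by (simp add: X_def)
    have eq: "dform a x (X x) e + a x (X x) * a x e = - ddir H x e + (\<mu>0 x + H x) * a x e" for e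
      using flat_inner[OF xV, of "X x" e] Y[OF True] c XY by simp
    have "a x (X x) = H x"
      using eq[of "R x"] dform_swap[of a x "X x" "R x"] reeb[OF True] by (simp add: \<mu>0)
    then show ?thesis using eq True by (simp add: \<mu>_def algebra_simps)
  next
    case False
    then have "x \<notin> K" using K by auto
    then show ?thesis
      using X_off off DH \<mu>_off linear_0[OF lin[OF xV]] linear_0[OF linear_dform1[OF xV]] by simp
  qed
  ultimately show ?thesis using \<mu>_off by blast
qed

end

text \<open>Integrating factor \<open>exp (- G t)\<close>. It is applied to the pulled-back form and
  to \<open>H\<close> along an orbit, with the same \<open>m\<close> both times.\<close>

lemma scalar_linear_ode:
  fixes f G m :: "real \<Rightarrow> real"
  assumes f: "\<And>t. t \<in> {0..1} \<Longrightarrow> (f has_vector_derivative m t * f t) (at t within {0..1})"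
    and G: "\<And>t. t \<in> {0..1} \<Longrightarrow> (G has_vector_derivative m t) (at t within {0..1})" and "G 0 = 0" and t: "t \<in> {0..1}"
  shows "f t = f 0 * exp (G t)"
proof -
  have "((\<lambda>t. f t * exp (- G t)) has_field_derivative 0) (at t within {0..1})" if "t \<in> {0..1}" for t
    using f[OF that] G[OF that]
    by (auto simp: has_real_derivative_iff_has_vector_derivative[symmetric] intro!: derivative_eq_intros)
  then obtain c where "\<And>t. t \<in> {0..1} \<Longrightarrow> f t * exp (- G t) = c"
    using has_field_derivative_zero_constant[of "{0..1}" "\<lambda>t. f t * exp (- G t)"] by auto
  from this[OF t] this[of 0] show ?thesis using assms(3) by (simp add: exp_minus field_simps)
qed

section \<open>The flow of a contact Hamiltonian in coordinates\<close>

locale hamiltonian_field = euclidean_form V a + supported_field X K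
  for V :: "'a::euclidean_space set" and a and X :: "'a \<Rightarrow> 'a" and K +
  fixes H :: "'a \<Rightarrow> real" and \<mu> :: "'a \<Rightarrow> real"
  assumes K_sub: "K \<subseteq> V" and sm_H: "sm UNIV H"
    and ham: "\<And>x. x \<in> V \<Longrightarrow> a x (X x) = H x"
    and ham_d: "\<And>x e. x \<in> V \<Longrightarrow> dform a x (X x) e = - ddir H x e + \<mu> x * a x e"
    and cont_\<mu>: "continuous_on UNIV \<mu>" and off_\<mu>: "\<And>x. x \<notin> K \<Longrightarrow> \<mu> x = 0"
begin

lemma sol_V: "x \<in> V \<Longrightarrow> t \<in> {0..1} \<Longrightarrow> sol X x t \<in> V"
  using sol_in sol_off K_sub by (metis subsetD)

text \<open>The logarithm of the conformal factor: the infinitesimal factor \<open>\<mu>\<close>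
  integrated along the orbit.\<close>

definition log_factor :: "real \<Rightarrow> 'a \<Rightarrow> real" where
  "log_factor t x = integral {0..t} (\<lambda>r. \<mu> (sol X x r))"

lemma log_factor_0: "log_factor 0 x = 0"
  by (simp add: log_factor_def)

lemma log_factor_deriv:
  assumes "t \<in> {0..1}"
  shows "((\<lambda>t. log_factor t x) has_vector_derivative \<mu> (sol X x t)) (at t within {0..1})"
  unfolding log_factor_def
  by (rule integral_has_vector_derivative[OF continuous_on_compose2[OF cont_\<mu> ode_sol_continuous[OF sol_ode]] assms]) simp

text \<open>This is Cartan's formula \<open>L\<^sub>X \<alpha> = \<iota>\<^sub>X d\<alpha> + d(\<alpha>(X)) = \<mu> \<alpha>\<close>.\<close>

lemma lie_derivative:
  assumes x: "x \<in> V"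
  shows "ddir (\<lambda>y. a y e) x (X x) + a x (ddir X x e) = \<mu> x * a x e"
proof -
  have "((\<lambda>y. a y (X y)) has_derivative (\<lambda>h. ddir (\<lambda>y. a y (X x)) x h + a x (ddir X x h))) (at x within V)"
    by (rule form_deriv) (use x has_derivative_at_withinI[OF sm_hd[OF sm_field]] in auto)
  then have "((\<lambda>y. a y (X y)) has_derivative (\<lambda>h. ddir (\<lambda>y. a y (X x)) x h + a x (ddir X x h))) (at x)"
    using at_within_open[OF x open_V] by simp
  then have "(H has_derivative (\<lambda>h. ddir (\<lambda>y. a y (X x)) x h + a x (ddir X x h))) (at x)"
    by (rule has_derivative_transform_within_open[OF _ open_V x]) (rule ham)
  from fun_cong[OF frechet_derivative_at[OF this], of e]
  have "ddir H x e = ddir (\<lambda>y. a y (X x)) x e + a x (ddir X x e)" by simp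
  then show ?thesis using ham_d[OF x, of e] by (simp add: dform_def)
qed

text \<open>Insert \<open>X x\<close> itself into \<open>ham_d\<close>: the alternating term
  vanishes and \<open>a x (X x)\<close> is \<open>H x\<close>.\<close>

lemma ham_deriv: "x \<in> V \<Longrightarrow> ddir H x (X x) = \<mu> x * H x"
  using ham_d[of x "X x"] by (simp add: dform_alt ham)

text \<open>The vector transported by the flow solves the variational equation, so the time
  derivative of the form on it is the Lie derivative, that is \<open>\<mu>\<close> times the same
  quantity.\<close>

lemma sol_conformal:
  assumes x: "x \<in> V" and t: "t \<in> {0..1}"
  shows "a (sol X x t) (ddir (\<lambda>x. sol X x t) x e) = exp (log_factor t x) * a x e"
proof -
  have "a (sol X x t) (ddir (\<lambda>x. sol X x t) x e)
    = a (sol X x 0) (ddir (\<lambda>x. sol X x 0) x e) * exp (log_factor t x)"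
  proof (rule scalar_linear_ode[where G="\<lambda>t. log_factor t x" and m="\<lambda>t. \<mu> (sol X x t)", OF _ log_factor_deriv log_factor_0 t])
    fix t :: real assume t: "t \<in> {0..1}"
    let ?u = "sol X x t" and ?Z = "\<lambda>t. ddir (\<lambda>x. sol X x t) x e"
    have "((\<lambda>t. a (sol X x t) (?Z t)) has_derivative
       (\<lambda>h. ddir (\<lambda>y. a y (?Z t)) ?u (h *\<^sub>R X ?u) + a ?u (h *\<^sub>R ddir X ?u (?Z t)))) (at t within {0..1})"
      by (rule form_deriv[where u="sol X x" and Z="?Z", OF sol_V[OF x t] _ _ t])
        (use sol_deriv[OF t] sol_variational[OF t] sol_V[OF x] in \<open>auto simp: has_vector_derivative_def\<close>)
    moreover have "(\<lambda>h. ddir (\<lambda>y. a y (?Z t)) ?u (h *\<^sub>R X ?u) + a ?u (h *\<^sub>R ddir X ?u (?Z t)))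
       = (\<lambda>h. h *\<^sub>R (\<mu> ?u * a ?u (?Z t)))"
      using lie_derivative[OF sol_V[OF x t], of "?Z t"]
      by (simp add: linear_scale[OF linear_ddir_form1[OF sol_V[OF x t]]] linear_scale[OF lin[OF sol_V[OF x t]]]
          flip: distrib_left)
    ultimately show "((\<lambda>t. a (sol X x t) (?Z t)) has_vector_derivative \<mu> ?u * a ?u (?Z t)) (at t within {0..1})"
      by (simp add: has_vector_derivative_def)
  qed
  also have "a (sol X x 0) (ddir (\<lambda>x. sol X x 0) x e) = a x e"
    by (simp add: sol_0)
  finally show ?thesis by simp
qed

text \<open>By \<open>ham_deriv\<close> the function \<open>H\<close> obeys along orbits the same
  scalar equation as the pulled-back form, with the same factor.\<close>

lemma sol_hamiltonian:
  assumes x: "x \<in> V" and t: "t \<in> {0..1}"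
  shows "H (sol X x t) = H x * exp (log_factor t x)"
proof -
  have "H (sol X x t) = H (sol X x 0) * exp (log_factor t x)"
  proof (rule scalar_linear_ode[where G="\<lambda>t. log_factor t x" and m="\<lambda>t. \<mu> (sol X x t)", OF _ log_factor_deriv log_factor_0 t])
    fix t :: real assume t: "t \<in> {0..1}"
    have "((\<lambda>t. H (sol X x t)) has_derivative (\<lambda>h. ddir H (sol X x t) (h *\<^sub>R X (sol X x t)))) (at t within {0..1})"
      by (rule has_derivative_compose[OF _ sm_hd[OF sm_H UNIV_I]])
        (use sol_deriv[OF t] in \<open>simp add: has_vector_derivative_def\<close>)
    then show "((\<lambda>t. H (sol X x t)) has_vector_derivative \<mu> (sol X x t) * H (sol X x t)) (at t within {0..1})"
      using ham_deriv[OF sol_V[OF x t]]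
        linear_scale[OF has_derivative_linear[OF sm_hd[OF sm_H UNIV_I]], of "sol X x t" _ "X (sol X x t)"]
      by (simp add: has_vector_derivative_def)
  qed
  then show ?thesis by (simp add: sol_0)
qed

lemma flow_deriv:
  assumes s: "s \<in> {0..1}"
  shows "((\<lambda>s. flow s x) has_vector_derivative cos s *\<^sub>R X (flow s x)) (at s within {0..1})"
proof -
  have sin01: "sin r \<in> {0..1}" if "r \<in> {0..1}" for r :: real
    using sin_ge_zero[of r] pi_gt3 that by auto
  have "((\<lambda>s. sol X x (sin s)) has_vector_derivative cos s *\<^sub>R X (sol X x (sin s))) (at s within {0..1})"
    by (rule sol_reparam[OF sin01 _ s]) (auto intro!: derivative_eq_intros)
  then show ?thesis unfolding flow_sol[OF s]
    by (rule has_vector_derivative_transform[OF s, rotated]) (simp add: flow_sol)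
qed

lemma flow_V: "x \<in> V \<Longrightarrow> flow s x \<in> V"
  using flow_off flow_in K_sub by (metis subsetD)

lemma flow_slice_smooth: "sm UNIV (flow s)"
proof -
  have "sm UNIV (\<lambda>x. (\<lambda>q. flow (snd q) (fst q)) (x, s))"
    by (rule sm_compose[OF flow_smooth]) (auto intro!: sm_Pair sm_ident sm_const)
  then show ?thesis by simp
qed

lemma log_factor_off: 
  assumes "x \<notin> K" "t \<in> {0..1}"
  shows "log_factor t x = 0"
proof -
  have "log_factor t x = integral {0..t} (\<lambda>r. 0)"
    unfolding log_factor_def
    by (rule integral_cong) (use assms off_\<mu> in \<open>simp add: sol_off\<close>)
  then show ?thesis by simp
qed

text \<open>Smoothness of the conformal factor is read off from its value on the Reeb field, where
  \<open>\<alpha> = 1\<close>.\<close>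

lemma flow_conformal:
  assumes patch: "contact_patch V a W R" and KW: "K \<subseteq> W" and s: "s \<in> {0..1}"
  shows "\<exists>g. sm UNIV g \<and> (\<forall>x. x \<notin> K \<longrightarrow> g x = 0)
     \<and> (\<forall>x\<in>V. \<forall>e. a (flow s x) (ddir (flow s) x e) = exp (g x) * a x e)"
proof -
  interpret P: contact_patch V a W R by (rule patch)
  have s1: "sin s \<in> {0..1}" using sin_ge_zero[of s] pi_gt3 s by auto
  define g where "g = log_factor (sin s)"
  have fs: "flow s = (\<lambda>x. sol X x (sin s))" using flow_sol[OF s] by auto
  have conf: "a (flow s x) (ddir (flow s) x e) = exp (g x) * a x e" if "x \<in> V" for x e
    using sol_conformal[OF that s1] by (simp add: fs g_def)
  have off: "g x = 0" if "x \<notin> K" for x using log_factor_off[OF that s1] by (simp add: g_def)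
  \<comment> \<open>The form at \<open>flow s x\<close> applied to the image of the Reeb vector,
    expanded twice in the basis: moving point and moving direction then occur only in smooth scalar
    factors.\<close>
  define \<kappa> where "\<kappa> x = (\<Sum>b\<in>Basis. ((\<Sum>c\<in>Basis. (R x \<bullet> c) *\<^sub>R ddir (flow s) x c) \<bullet> b) * a (flow s x) b)" for x
  have \<kappa>: "\<kappa> x = exp (g x)" if "x \<in> W" for x
  proof -
    have xV: "x \<in> V" using that P.W_sub by auto
    have "(\<Sum>c\<in>Basis. (R x \<bullet> c) *\<^sub>R ddir (flow s) x c) = ddir (flow s) x (R x)"
      by (rule ddir_basis[OF sm_differentiable[OF flow_slice_smooth UNIV_I], symmetric])
    then have "\<kappa> x = a (flow s x) (ddir (flow s) x (R x))"
      unfolding \<kappa>_def by (simp only: form_basis[OF flow_V[OF xV], symmetric])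
    then show ?thesis using conf[OF xV] P.reeb(1)[OF that] by simp
  qed
  have fW: "sm W (flow s)" by (rule sm_subset[OF flow_slice_smooth P.open_W]) simp
  have "sm W \<kappa>" unfolding \<kappa>_def
    by (intro sm_sum P.open_W sm_mult sm_inner sm_scaleR P.sm_reeb sm_const sm_ddir fW sm_compose[OF sm_form fW])
      (use flow_V P.W_sub in auto)
  then have "sm W (\<lambda>x. ln (\<kappa> x))" by (rule sm_compose[OF sm_ln]) (simp add: \<kappa>)
  then have gW: "sm W g" by (rule sm_cong) (simp add: \<kappa>)
  have "sm UNIV g"
    by (rule sm_extend_zero[OF gW compact_imp_closed[OF compact_support] KW off])
  then show ?thesis using conf off by (intro exI[of _ g]) simp
qed

end


section \<open>Smooth isotopies supported in a chart\<close>

definition transplant :: "('m, 'e) chart \<Rightarrow> ('e \<Rightarrow> 'e) \<Rightarrow> 'm \<Rightarrow> 'm" where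
  "transplant c f q = (if q \<in> fst c then chart_inv c (f (snd c q)) else q)"

text \<open>Time runs over all reals, so each local representative \<open>g\<close> lives on an open
  set of pairs (point, time) and has two-sided time derivatives. Requiring the image to stay in the
  chart \<open>d\<close> builds in continuity. Slices, time curves, smoothness on the product and
  continuity in the smooth topology are all read off from this one notion.\<close>

definition joint_smooth :: "('m::topological_space, 'e::euclidean_space) chart set \<Rightarrow> (real \<Rightarrow> 'm \<Rightarrow> 'm) \<Rightarrow> bool" where
  "joint_smooth A F \<longleftrightarrow> (\<forall>q s. \<forall>c\<in>charts_at A q. \<forall>d\<in>charts_at A (F s q). \<exists>W g. sm W g \<and> (snd c q, s) \<in> W
     \<and> (\<forall>x r. (x, r) \<in> W \<longrightarrow> x \<in> snd c ` fst c \<and> F r (chart_inv c x) \<in> fst d \<and> snd d (F r (chart_inv c x)) = g (x, r)))"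

lemma joint_smoothD:
  assumes "joint_smooth A F" "c \<in> charts_at A q" "d \<in> charts_at A (F s q)"
  obtains W g where "sm W g" "(snd c q, s) \<in> W" "\<And>x r. (x, r) \<in> W \<Longrightarrow> x \<in> snd c ` fst c"
    "\<And>x r. (x, r) \<in> W \<Longrightarrow> F r (chart_inv c x) \<in> fst d"
    "\<And>x r. (x, r) \<in> W \<Longrightarrow> snd d (F r (chart_inv c x)) = g (x, r)"
proof -
  from assms(1)[unfolded joint_smooth_def, rule_format, OF assms(2,3)]
  obtain W g where W: "sm W g" "(snd c q, s) \<in> W" "\<forall>x r. (x, r) \<in> W \<longrightarrow> x \<in> snd c ` fst c \<and> F r (chart_inv c x) \<in> fst d \<and> snd d (F r (chart_inv c x)) = g (x, r)"
    by (elim exE conjE) (rule that)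
  show ?thesis
    by (rule that[OF W(1,2)]) (simp_all add: W(3)[rule_format])
qed

lemma sm_slice: "sm W g \<Longrightarrow> sm {x. (x, s) \<in> W} (\<lambda>x. g (x, s))"
proof -
  assume g: "sm W g"
  have "open ((\<lambda>x. (x, s)) -` W)" by (intro open_vimage sm_open[OF g] continuous_intros)
  then have o: "open {x. (x, s) \<in> W}" by (simp add: vimage_def)
  show ?thesis
    by (rule sm_compose[OF g]) (auto intro!: sm_Pair sm_ident sm_const o)
qed

text \<open>Spatial derivatives at a fixed time are derivatives of the joint function in directions
  \<open>(v, 0)\<close>, hence continuous in the time as well. This is what convergence in the
  smooth topology needs.\<close>

lemma iter_deriv_slice:
  fixes g :: "'a::euclidean_space \<times> real \<Rightarrow> 'b::euclidean_space"
  assumes g: "sm W g" and "(x, s) \<in> W"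
  shows "iter_deriv vs (\<lambda>x. g (x, s)) x = iter_deriv (map (\<lambda>v. (v, 0)) vs) g (x, s)"
  using assms(2)
proof (induction vs arbitrary: x)
  case (Cons v vs)
  let ?G = "iter_deriv (map (\<lambda>v. (v, 0)) vs) g"
  have o: "open {x. (x, s) \<in> W}" by (rule sm_open[OF sm_slice[OF g]])
  have "((\<lambda>x. ?G (x, s)) has_derivative (\<lambda>h. ddir ?G (x, s) (h, 0))) (at x)"
    by (rule has_derivative_compose[where f="\<lambda>x. (x, s)" and g="?G" and f'="\<lambda>h. (h, 0)", OF _ sm_hd[OF sm_iter_deriv[OF g] Cons.prems]])
      (intro derivative_intros)
  then have "((iter_deriv vs (\<lambda>x. g (x, s))) has_derivative (\<lambda>h. ddir ?G (x, s) (h, 0))) (at x)"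
    by (rule has_derivative_transform_within_open[OF _ o]) (use Cons in auto)
  from fun_cong[OF frechet_derivative_at[OF this], of v] show ?case by simp
qed simp

section \<open>Charts, tangent vectors and differentials\<close>

locale manifold =
  fixes A :: "('m::{t2_space,second_countable_topology}, 'e::euclidean_space) chart set"
  assumes manifold: "smooth_manifold A"
begin

lemma is_chart: "c \<in> A \<Longrightarrow> is_chart c"
  using manifold by (simp add: smooth_manifold_def)

lemma compatible: "c \<in> A \<Longrightarrow> d \<in> A \<Longrightarrow> compatible c d"
  using manifold by (simp add: smooth_manifold_def)

lemma dom_open: "c \<in> A \<Longrightarrow> open (fst c)"
  and img_open: "c \<in> A \<Longrightarrow> open (snd c ` fst c)"
  and homeo: "c \<in> A \<Longrightarrow> homeomorphism (fst c) (snd c ` fst c) (snd c) (chart_inv c)"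
  using is_chart by (auto simp: is_chart_def)

lemma chart_inv_l: "c \<in> A \<Longrightarrow> q \<in> fst c \<Longrightarrow> chart_inv c (snd c q) = q"
  using homeo[of c] by (simp add: homeomorphism_def)

lemma chart_inv_r: "x \<in> snd c ` fst c \<Longrightarrow> snd c (chart_inv c x) = x"
  by (simp add: f_inv_into_f)

lemma chart_inv_in: "x \<in> snd c ` fst c \<Longrightarrow> chart_inv c x \<in> fst c"
  by (simp add: inv_into_into)

lemma chart_cont: "c \<in> A \<Longrightarrow> continuous_on (fst c) (snd c)"
  and chart_inv_cont: "c \<in> A \<Longrightarrow> continuous_on (snd c ` fst c) (chart_inv c)"
  using homeo[of c] by (simp_all add: homeomorphism_def)

lemma charts_at_iff: "c \<in> charts_at A q \<longleftrightarrow> c \<in> A \<and> q \<in> fst c"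
  by (simp add: charts_at_def)

lemma ex_chart: "\<exists>c. c \<in> charts_at A q"
proof -
  have "(\<Union>c\<in>A. fst c) = UNIV" using manifold unfolding smooth_manifold_def by (elim conjE)
  then have "q \<in> (\<Union>c\<in>A. fst c)" by simp
  then show ?thesis by (auto simp: charts_at_def)
qed

lemma chart_at_in: "chart_at A q \<in> charts_at A q"
  unfolding chart_at_def using someI_ex[OF ex_chart] .

lemma chart_preimage:
  assumes c: "c \<in> A"
  shows "snd c ` (fst c \<inter> O') = {x \<in> snd c ` fst c. chart_inv c x \<in> O'}"
  using chart_inv_l[OF c] by auto

lemma chart_image_open: "c \<in> A \<Longrightarrow> open O' \<Longrightarrow> open (snd c ` (fst c \<inter> O'))"
  unfolding chart_preimage
  using continuous_open_preimage[OF chart_inv_cont img_open, of c O'] by (simp add: vimage_def Int_def)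

lemma trans_sm:
  assumes "c \<in> A" "d \<in> A"
  shows "sm (snd c ` (fst c \<inter> fst d)) (snd d \<circ> chart_inv c)"
proof -
  have "smooth_on (snd c ` (fst c \<inter> fst d)) (snd d \<circ> chart_inv c)"
    using compatible[OF assms] unfolding compatible_def by (rule conjunct1)
  then show ?thesis
    unfolding smooth_on_open_iff[OF chart_image_open[OF assms(1) dom_open[OF assms(2)]]] .
qed

lemma trans_hd:
  "c \<in> charts_at A q \<Longrightarrow> d \<in> charts_at A q \<Longrightarrow>
    ((snd d \<circ> chart_inv c) has_derivative ddir (snd d \<circ> chart_inv c) (snd c q)) (at (snd c q))"
  by (rule sm_hd[OF trans_sm]) (auto simp: charts_at_iff)

lemma trans_app: "c \<in> A \<Longrightarrow> q \<in> fst c \<Longrightarrow> (snd d \<circ> chart_inv c) (snd c q) = snd d q"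
  by (simp add: chart_inv_l)

text \<open>The cocycle identity for transition derivatives, by the chain rule; it is the reason why
  \<open>coord_vec\<close> produces tangent vectors.\<close>

lemma trans_deriv_comp:
  assumes c: "c \<in> charts_at A q" and d: "d \<in> charts_at A q" and e: "e \<in> charts_at A q"
  shows "ddir (snd e \<circ> chart_inv c) (snd c q) v
    = ddir (snd e \<circ> chart_inv d) (snd d q) (ddir (snd d \<circ> chart_inv c) (snd c q) v)"
proof -
  note cA = c[unfolded charts_at_iff] and dA = d[unfolded charts_at_iff]
  have "((\<lambda>x. (snd e \<circ> chart_inv d) ((snd d \<circ> chart_inv c) x)) has_derivative
     (\<lambda>v. ddir (snd e \<circ> chart_inv d) (snd d q) (ddir (snd d \<circ> chart_inv c) (snd c q) v))) (at (snd c q))"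
    by (rule has_derivative_compose[OF trans_hd[OF c d]])
      (simp only: trans_app[OF conjunct1[OF cA] conjunct2[OF cA]] trans_hd[OF d e])
  then have "((snd e \<circ> chart_inv c) has_derivative
     (\<lambda>v. ddir (snd e \<circ> chart_inv d) (snd d q) (ddir (snd d \<circ> chart_inv c) (snd c q) v))) (at (snd c q))"
  proof (rule has_derivative_transform_within_open)
    show "open (snd c ` (fst c \<inter> fst d))"
      by (rule chart_image_open[OF conjunct1[OF cA] dom_open[OF conjunct1[OF dA]]])
    show "snd c q \<in> snd c ` (fst c \<inter> fst d)" using cA dA by blast
    show "(snd e \<circ> chart_inv d) ((snd d \<circ> chart_inv c) x) = (snd e \<circ> chart_inv c) x"
      if "x \<in> snd c ` (fst c \<inter> fst d)" for x
      using that cA dA by (auto simp: chart_inv_l)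
  qed
  from fun_cong[OF frechet_derivative_at[OF this]] show ?thesis by simp
qed

lemma trans_deriv_self:
  assumes c: "c \<in> charts_at A q"
  shows "ddir (snd c \<circ> chart_inv c) (snd c q) v = v"
proof -
  note cA = c[unfolded charts_at_iff]
  have "((snd c \<circ> chart_inv c) has_derivative (\<lambda>v. v)) (at (snd c q))"
    by (rule has_derivative_transform_within_open[OF has_derivative_ident img_open])
      (use cA in \<open>auto simp: chart_inv_r\<close>)
  from fun_cong[OF frechet_derivative_at[OF this]] show ?thesis by simp
qed

lemma coord_vec_self: "c \<in> charts_at A q \<Longrightarrow> coord_vec A c q v c = v"
  by (simp add: coord_vec_def trans_deriv_self)

lemma coord_vec_tangent:
  assumes c: "c \<in> charts_at A q"
  shows "coord_vec A c q v \<in> tangent_space A q"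
  unfolding tangent_space_def
proof (intro CollectI conjI allI impI ballI)
  show "coord_vec A c q v d = 0" if "d \<notin> charts_at A q" for d using that by (simp add: coord_vec_def)
  fix d e assume d: "d \<in> charts_at A q" and e: "e \<in> charts_at A q"
  show "coord_vec A c q v e = frechet_derivative (snd e \<circ> chart_inv d) (at (snd d q)) (coord_vec A c q v d)"
    unfolding coord_vec_def if_P[OF d] if_P[OF e] by (rule trans_deriv_comp[OF c d e])
qed

lemma tangent_transforms:
  "v \<in> tangent_space A q \<Longrightarrow> c \<in> charts_at A q \<Longrightarrow> d \<in> charts_at A q \<Longrightarrow> v d = ddir (snd d \<circ> chart_inv c) (snd c q) (v c)"
  unfolding tangent_space_def by (elim CollectE conjE, drule (1) bspec, drule (1) bspec, assumption)

lemma tangent_off: "v \<in> tangent_space A q \<Longrightarrow> c \<notin> charts_at A q \<Longrightarrow> v c = 0"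
  unfolding tangent_space_def by (elim CollectE conjE, drule spec, drule (1) mp, assumption)

lemma tangent_eq_coord_vec:
  assumes "v \<in> tangent_space A q" "c \<in> charts_at A q"
  shows "v = coord_vec A c q (v c)"
proof
  fix d show "v d = coord_vec A c q (v c) d"
    unfolding coord_vec_def using tangent_transforms[OF assms] tangent_off[OF assms(1)]
    by (cases "d \<in> charts_at A q") (simp_all only: if_True if_False)
qed

lemma coord_vec_change:
  assumes "c \<in> charts_at A q" "d \<in> charts_at A q"
  shows "coord_vec A c q v = coord_vec A d q (ddir (snd d \<circ> chart_inv c) (snd c q) v)"
  using tangent_eq_coord_vec[OF coord_vec_tangent[OF assms(1)] assms(2), of v]
  unfolding coord_vec_def[of A c q v] if_P[OF assms(2)] .

lemma coord_vec_0: "c \<in> charts_at A q \<Longrightarrow> coord_vec A c q 0 = (\<lambda>_. 0)"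
  using linear_0[OF has_derivative_linear[OF trans_hd]] by (auto simp: coord_vec_def)

lemma form_eq_local: 
  "v \<in> tangent_space A q \<Longrightarrow> c \<in> charts_at A q \<Longrightarrow> \<alpha> q v = local_form A \<alpha> c (snd c q) (v c)"
  using tangent_eq_coord_vec[of v q c] by (simp add: local_form_def charts_at_iff chart_inv_l)

text \<open>Computing in one chart suffices, since the other representatives follow by the chain
  rule. The condition on \<open>at t within I\<close> makes the one-sided derivative unique, so that
  \<open>vector_derivative\<close> returns it.\<close>

lemma velocity_eq:
  assumes c: "c \<in> charts_at A q" and \<gamma>: "\<And>s. s \<in> I \<Longrightarrow> \<gamma> s = chart_inv c (u s)" and t: "t \<in> I"
    and u: "(u has_vector_derivative u') (at t within I)" "u t = snd c q" and nt: "at t within I \<noteq> bot"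
  shows "velocity A I \<gamma> t = coord_vec A c q u'"
proof -
  note cA = c[unfolded charts_at_iff]
  have q: "\<gamma> t = q" using \<gamma>[OF t] u(2) cA by (simp add: chart_inv_l)
  have "vector_derivative (snd d \<circ> \<gamma>) (at t within I) = ddir (snd d \<circ> chart_inv c) (snd c q) u'"
    if d: "d \<in> charts_at A q" for d
  proof (rule vector_derivative_within[OF nt])
    have "((\<lambda>s. (snd d \<circ> chart_inv c) (u s)) has_derivative
       (\<lambda>h. ddir (snd d \<circ> chart_inv c) (snd c q) (h *\<^sub>R u'))) (at t within I)"
      by (rule has_derivative_compose[OF u(1)[unfolded has_vector_derivative_def]])
        (simp only: u(2) trans_hd[OF c d])
    then have "((\<lambda>s. (snd d \<circ> chart_inv c) (u s)) has_vector_derivative ddir (snd d \<circ> chart_inv c) (snd c q) u') (at t within I)"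
      by (simp only: has_vector_derivative_def linear_scale[OF has_derivative_linear[OF trans_hd[OF c d]]])
    then show "((snd d \<circ> \<gamma>) has_vector_derivative ddir (snd d \<circ> chart_inv c) (snd c q) u') (at t within I)"
      by (rule has_vector_derivative_transform[OF t, rotated]) (simp add: \<gamma>)
  qed
  then show ?thesis unfolding velocity_def coord_vec_def q by auto
qed

text \<open>\<open>differential\<close> reads the vector in the fixed chart
  \<open>chart_at A p\<close>; composing with the transition to \<open>c\<close> permits any
  convenient pair of charts.\<close>

lemma differential_eq:
  assumes c: "c \<in> charts_at A p" and d: "d \<in> charts_at A (f p)" and v: "v \<in> tangent_space A p"
    and W: "open W" "snd c p \<in> W" "W \<subseteq> snd c ` fst c"
    and f: "\<And>x. x \<in> W \<Longrightarrow> f (chart_inv c x) \<in> fst d" "\<And>x. x \<in> W \<Longrightarrow> snd d (f (chart_inv c x)) = u x"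
    and u: "(u has_derivative u') (at (snd c p))"
  shows "differential A f p v = coord_vec A d (f p) (u' (v c))"
proof
  fix e
  define ch where "ch = chart_at A p"
  have ch: "ch \<in> charts_at A p" unfolding ch_def by (rule chart_at_in)
  note cA = c[unfolded charts_at_iff] and dA = d[unfolded charts_at_iff] and hA = ch[unfolded charts_at_iff]
  show "differential A f p v e = coord_vec A d (f p) (u' (v c)) e"
  proof (cases "e \<in> charts_at A (f p)")
    case e: True
    have ux: "u (snd c p) = snd d (f p)" using f(2)[OF W(2)] cA by (simp add: chart_inv_l)
    have vc: "v c = ddir (snd c \<circ> chart_inv ch) (snd ch p) (v ch)"
      by (rule tangent_transforms[OF v ch c])
    have "((\<lambda>x. (snd e \<circ> chart_inv d) (u ((snd c \<circ> chart_inv ch) x))) has_derivative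
      (\<lambda>h. ddir (snd e \<circ> chart_inv d) (snd d (f p)) (u' (ddir (snd c \<circ> chart_inv ch) (snd ch p) h)))) (at (snd ch p))"
    proof (rule has_derivative_compose[where f="\<lambda>x. u ((snd c \<circ> chart_inv ch) x)" and g="snd e \<circ> chart_inv d"
          and g'="ddir (snd e \<circ> chart_inv d) (snd d (f p))"])
      show "((\<lambda>x. u ((snd c \<circ> chart_inv ch) x)) has_derivative
         (\<lambda>h. u' (ddir (snd c \<circ> chart_inv ch) (snd ch p) h))) (at (snd ch p))"
        by (rule has_derivative_compose[OF trans_hd[OF ch c]])
            (simp only: trans_app[OF conjunct1[OF hA] conjunct2[OF hA]] u)
      show "((snd e \<circ> chart_inv d) has_derivative ddir (snd e \<circ> chart_inv d) (snd d (f p)))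
         (at (u ((snd c \<circ> chart_inv ch) (snd ch p))))"
        by (simp only: trans_app[OF conjunct1[OF hA] conjunct2[OF hA]] ux trans_hd[OF d e])
    qed
    then have "((snd e \<circ> f \<circ> chart_inv ch) has_derivative
      (\<lambda>h. ddir (snd e \<circ> chart_inv d) (snd d (f p)) (u' (ddir (snd c \<circ> chart_inv ch) (snd ch p) h)))) (at (snd ch p))"
    proof (rule has_derivative_transform_within_open)
      define P where "P = snd ch ` (fst ch \<inter> fst c) \<inter> (snd c \<circ> chart_inv ch) -` W"
      have hA1: "ch \<in> A" and cA1: "c \<in> A" using hA cA by auto
      show "open P" unfolding P_def
        by (rule continuous_open_preimage[OF sm_continuous_on[OF trans_sm[OF hA1 cA1]]
              chart_image_open[OF hA1 dom_open[OF cA1]] W(1)])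
      show "snd ch p \<in> P" unfolding P_def using hA cA W(2) by (simp add: chart_inv_l)
      fix x assume x: "x \<in> P"
      then have xi: "chart_inv ch x \<in> fst c" using hA by (auto simp: P_def chart_inv_l)
      have xW: "snd c (chart_inv ch x) \<in> W" using x by (simp add: P_def)
      from f(1)[OF xW] f(2)[OF xW]
      have "f (chart_inv ch x) \<in> fst d" "snd d (f (chart_inv ch x)) = u (snd c (chart_inv ch x))"
        using xi cA by (simp_all add: chart_inv_l)
      then show "(snd e \<circ> chart_inv d) (u ((snd c \<circ> chart_inv ch) x)) = (snd e \<circ> f \<circ> chart_inv ch) x"
        using chart_inv_l[of d "f (chart_inv ch x)"] dA by simp
    qed
    from fun_cong[OF frechet_derivative_at[OF this], of "v ch"] vc
    show ?thesis using e by (simp add: differential_def coord_vec_def ch_def Let_def)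
  qed (simp add: differential_def coord_vec_def)
qed

end


context manifold begin

text \<open>The support, pulled back to the manifold, is compact, hence closed because the manifold
  is Hausdorff, and it lies in \<open>fst c\<close>. So even a boundary point of
  \<open>fst c\<close> has a neighbourhood that misses it.\<close>

lemma avoid_support:
  assumes c: "c \<in> A" and K: "compact K" "K \<subseteq> snd c ` fst c" and d: "d \<in> charts_at A q" and q: "q \<notin> fst c"
  shows "\<exists>P. open P \<and> snd d q \<in> P \<and> P \<subseteq> snd d ` fst d \<and> (\<forall>x\<in>P. chart_inv d x \<in> fst c \<longrightarrow> snd c (chart_inv d x) \<notin> K)"
proof -
  note dA = d[unfolded charts_at_iff]
  define CK where "CK = chart_inv c ` K"
  have "compact CK" unfolding CK_def
    by (rule compact_continuous_image[OF continuous_on_subset[OF chart_inv_cont[OF c] K(2)] K(1)])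
  then have clCK: "closed CK" by (rule compact_imp_closed)
  have CKc: "CK \<subseteq> fst c" unfolding CK_def by (rule image_subsetI) (rule chart_inv_in[OF subsetD[OF K(2)]])
  have "open (snd d ` (fst d \<inter> - CK))" using clCK by (intro chart_image_open[OF conjunct1[OF dA]]) auto
  moreover have "snd d q \<in> snd d ` (fst d \<inter> - CK)" using q CKc dA by blast
  moreover have "snd c (chart_inv d x) \<notin> K" if x: "x \<in> snd d ` (fst d \<inter> - CK)" "chart_inv d x \<in> fst c" for x
  proof
    assume "snd c (chart_inv d x) \<in> K"
    then have "chart_inv c (snd c (chart_inv d x)) \<in> CK" unfolding CK_def by (rule imageI)
    then show False using x chart_inv_l[OF c x(2)] dA by (auto simp: chart_inv_l)
  qed
  moreover have "snd d ` (fst d \<inter> - CK) \<subseteq> snd d ` fst d" by blast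
  ultimately show ?thesis by (intro exI[of _ "snd d ` (fst d \<inter> - CK)"]) simp
qed

text \<open>At points of the chart domain the map is a composition with transition maps; at all
  others \<open>avoid_support\<close> gives a neighbourhood on which it is the identity for every
  time.\<close>

lemma transplant_joint_smooth:
  assumes c: "c \<in> A" and K: "compact K" "K \<subseteq> snd c ` fst c"
    and \<psi>: "sm UNIV (\<lambda>q. \<psi> (snd q) (fst q))" and off: "\<And>s x. x \<notin> K \<Longrightarrow> \<psi> s x = x"
    and V: "\<And>s x. x \<in> snd c ` fst c \<Longrightarrow> \<psi> s x \<in> snd c ` fst c"
  shows "joint_smooth A (\<lambda>s. transplant c (\<psi> s))"
  unfolding joint_smooth_def
proof (intro allI ballI)
  fix q s c1 d assume c1: "c1 \<in> charts_at A q" and d: "d \<in> charts_at A (transplant c (\<psi> s) q)"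
  note c1A = c1[unfolded charts_at_iff] and dA = d[unfolded charts_at_iff]
  show "\<exists>W g. sm W g \<and> (snd c1 q, s) \<in> W \<and> (\<forall>x r. (x, r) \<in> W \<longrightarrow> x \<in> snd c1 ` fst c1 \<and>
      transplant c (\<psi> r) (chart_inv c1 x) \<in> fst d \<and> snd d (transplant c (\<psi> r) (chart_inv c1 x)) = g (x, r))"
  proof (cases "q \<in> fst c")
    case q: True
    define W1 where "W1 = snd c1 ` (fst c1 \<inter> fst c) \<times> (UNIV :: real set)"
    define h where "h = (\<lambda>p :: 'e \<times> real. \<psi> (snd p) ((snd c \<circ> chart_inv c1) (fst p)))"
    have oW1: "open W1" unfolding W1_def
      by (rule open_Times[OF chart_image_open[OF conjunct1[OF c1A] dom_open[OF c]] open_UNIV])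
    have s1: "sm W1 (\<lambda>p. (snd c \<circ> chart_inv c1) (fst p))"
      by (rule sm_compose[OF trans_sm sm_bounded_linear[OF bounded_linear_fst oW1]]) (use c1A c in \<open>auto simp: W1_def\<close>)
    have h: "sm W1 h"
    proof -
      have "sm W1 (\<lambda>p. (\<lambda>q. \<psi> (snd q) (fst q)) ((snd c \<circ> chart_inv c1) (fst p), snd p))"
        by (rule sm_compose[OF \<psi> sm_Pair[OF s1 sm_bounded_linear[OF bounded_linear_snd oW1]]]) (rule UNIV_I)
      then show ?thesis by (simp add: h_def)
    qed
    define P where "P = snd c ` (fst c \<inter> fst d)"
    have oP: "open P" unfolding P_def by (rule chart_image_open[OF c dom_open[OF conjunct1[OF dA]]])
    define W where "W = W1 \<inter> h -` P"
    have oW: "open W" unfolding W_def by (rule continuous_open_preimage[OF sm_continuous_on[OF h] oW1 oP])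
    define g where "g = (\<lambda>p. (snd d \<circ> chart_inv c) (h p))"
    have sg: "sm W g" unfolding g_def
      by (rule sm_compose[OF trans_sm sm_subset[OF h oW]]) (use c dA in \<open>auto simp: W_def P_def\<close>)
    have key: "x \<in> snd c1 ` fst c1 \<and> chart_inv c1 x \<in> fst c \<and> transplant c (\<psi> r) (chart_inv c1 x) = chart_inv c (h (x, r))"
      if "(x, r) \<in> W1" for x r
    proof -
      have "x \<in> snd c1 ` fst c1" "chart_inv c1 x \<in> fst c"
        using that c1A by (auto simp: W1_def chart_inv_l)
      then show ?thesis by (simp add: transplant_def h_def)
    qed
    have qW1: "(snd c1 q, s) \<in> W1" using q c1A by (simp add: W1_def)
    have hq: "h (snd c1 q, s) = \<psi> s (snd c q)" using c1A by (simp add: h_def chart_inv_l)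
    have "h (snd c1 q, s) \<in> P"
    proof -
      have v: "\<psi> s (snd c q) \<in> snd c ` fst c" using V q by blast
      have t: "transplant c (\<psi> s) q = chart_inv c (\<psi> s (snd c q))" using q by (simp add: transplant_def)
      have "snd c (transplant c (\<psi> s) q) = \<psi> s (snd c q)" "transplant c (\<psi> s) q \<in> fst c"
        unfolding t using chart_inv_r[OF v] chart_inv_in[OF v] by auto
      then show ?thesis unfolding hq P_def using dA by (metis IntI imageI)
    qed
    then have "(snd c1 q, s) \<in> W" using qW1 by (simp add: W_def)
    moreover have "x \<in> snd c1 ` fst c1 \<and> transplant c (\<psi> r) (chart_inv c1 x) \<in> fst d \<and>
        snd d (transplant c (\<psi> r) (chart_inv c1 x)) = g (x, r)" if "(x, r) \<in> W" for x r
    proof -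
      have 1: "(x, r) \<in> W1" "h (x, r) \<in> P" using that by (auto simp: W_def)
      then have "chart_inv c (h (x, r)) \<in> fst d" using c by (auto simp: P_def chart_inv_l)
      then show ?thesis using key[OF 1(1)] by (simp add: g_def)
    qed
    ultimately show ?thesis using sg by (intro exI[of _ W] exI[of _ g]) simp
  next
    case q: False
    obtain P where P: "open P" "snd c1 q \<in> P" "P \<subseteq> snd c1 ` fst c1"
      "\<forall>x\<in>P. chart_inv c1 x \<in> fst c \<longrightarrow> snd c (chart_inv c1 x) \<notin> K"
      using avoid_support[OF c K c1 q] by blast
    have idt: "transplant c (\<psi> r) (chart_inv c1 x) = chart_inv c1 x" if "x \<in> P" for r x
      using P(4) that by (simp add: transplant_def off chart_inv_l[OF c])
    have qd: "q \<in> fst d" using dA q by (simp add: transplant_def)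
    define Q where "Q = P \<inter> snd c1 ` (fst c1 \<inter> fst d)"
    have oQ: "open Q" unfolding Q_def
      by (rule open_Int[OF P(1) chart_image_open[OF conjunct1[OF c1A] dom_open[OF conjunct1[OF dA]]]])
    define W where "W = Q \<times> (UNIV :: real set)"
    have oW: "open W" unfolding W_def by (rule open_Times[OF oQ open_UNIV])
    define g where "g = (\<lambda>p :: 'e \<times> real. (snd d \<circ> chart_inv c1) (fst p))"
    have sg: "sm W g" unfolding g_def
      by (rule sm_compose[OF trans_sm sm_bounded_linear[OF bounded_linear_fst oW]]) (use c1A dA in \<open>auto simp: W_def Q_def\<close>)
    have "(snd c1 q, s) \<in> W" using P(2) c1A qd by (simp add: W_def Q_def)
    moreover have "x \<in> snd c1 ` fst c1 \<and> transplant c (\<psi> r) (chart_inv c1 x) \<in> fst d \<and>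
        snd d (transplant c (\<psi> r) (chart_inv c1 x)) = g (x, r)" if "(x, r) \<in> W" for x r
    proof -
      have "x \<in> P" "x \<in> snd c1 ` fst c1" "chart_inv c1 x \<in> fst d"
        using that c1A by (auto simp: W_def Q_def chart_inv_l)
      then show ?thesis using idt by (simp add: g_def)
    qed
    ultimately show ?thesis using sg by (intro exI[of _ W] exI[of _ g]) simp
  qed
qed

lemma smooth_scalar_extension:
  assumes c: "c \<in> A" and K: "compact K" "K \<subseteq> snd c ` fst c" and g: "sm UNIV g" and off: "\<And>x. x \<notin> K \<Longrightarrow> g x = 0"
  shows "smooth_map_on A (euclidean_atlas :: (real, real) chart set) UNIV (\<lambda>q. if q \<in> fst c then g (snd c q) else 0)"
proof -
  define G where "G q = (if q \<in> fst c then g (snd c q) else 0)" for q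
  have loc: "\<exists>P h. sm P h \<and> snd d q \<in> P \<and> P \<subseteq> snd d ` fst d \<and> (\<forall>x\<in>P. G (chart_inv d x) = h x)"
    if d: "d \<in> charts_at A q" for d q
  proof (cases "q \<in> fst c")
    case True
    note dA = d[unfolded charts_at_iff]
    have "sm (snd d ` (fst d \<inter> fst c)) (\<lambda>x. g ((snd c \<circ> chart_inv d) x))"
      by (rule sm_compose[OF g trans_sm[OF conjunct1[OF dA] c]]) (rule UNIV_I)
    moreover have "snd d q \<in> snd d ` (fst d \<inter> fst c)" using dA True by blast
    moreover have "snd d ` (fst d \<inter> fst c) \<subseteq> snd d ` fst d" by blast
    moreover have "\<forall>x\<in>snd d ` (fst d \<inter> fst c). G (chart_inv d x) = g ((snd c \<circ> chart_inv d) x)"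
      using dA by (auto simp: G_def chart_inv_l)
    ultimately show ?thesis
      by (intro exI[of _ "snd d ` (fst d \<inter> fst c)"] exI[of _ "\<lambda>x. g ((snd c \<circ> chart_inv d) x)"] conjI)
  next
    case False
    obtain P where P: "open P" "snd d q \<in> P" "P \<subseteq> snd d ` fst d"
      "\<forall>x\<in>P. chart_inv d x \<in> fst c \<longrightarrow> snd c (chart_inv d x) \<notin> K"
      using avoid_support[OF c K d False] by blast
    then show ?thesis
      by (intro exI[of _ P] exI[of _ "\<lambda>_. 0"]) (simp add: G_def off sm_const)
  qed
  have "smooth_map_on A (euclidean_atlas :: (real, real) chart set) UNIV G"
    unfolding smooth_map_on_def euclidean_atlas_def
  proof (intro conjI ballI)
    show "continuous_on UNIV G"
    proof (rule continuous_at_imp_continuous_on, rule ballI)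
      fix q
      obtain d where d: "d \<in> charts_at A q" using ex_chart by blast
      note dA = d[unfolded charts_at_iff]
      obtain P h where h: "sm P h" "snd d q \<in> P" "P \<subseteq> snd d ` fst d" "\<forall>x\<in>P. G (chart_inv d x) = h x"
        using loc[OF d] by (elim exE conjE) (rule that)
      define Z where "Z = fst d \<inter> snd d -` P"
      have oZ: "open Z" unfolding Z_def
        by (rule continuous_open_preimage[OF chart_cont[OF conjunct1[OF dA]] dom_open[OF conjunct1[OF dA]] sm_open[OF h(1)]])
      have "continuous_on Z (\<lambda>z. h (snd d z))"
        by (rule continuous_on_compose2[OF sm_continuous_on[OF h(1)] continuous_on_subset[OF chart_cont[OF conjunct1[OF dA]]]])
          (auto simp: Z_def)
      then have "continuous_on Z G"
        by (rule continuous_on_eq) (use h(4) dA chart_inv_l in \<open>auto simp: Z_def\<close>)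
      moreover have "q \<in> Z" using h(2) dA by (simp add: Z_def)
      ultimately show "isCont G q" using oZ continuous_on_eq_continuous_at by blast
    qed
    fix d e assume d: "d \<in> A" and "e \<in> {(UNIV :: real set, id :: real \<Rightarrow> real)}"
    then have e: "fst e = UNIV" "snd e = id" by auto
    show "smooth_on (snd d ` (UNIV \<inter> fst d \<inter> G -` fst e)) (snd e \<circ> G \<circ> chart_inv d)"
    proof (rule smooth_onI)
      fix x assume "x \<in> snd d ` (UNIV \<inter> fst d \<inter> G -` fst e)"
      then obtain q where q: "x = snd d q" "d \<in> charts_at A q" using d by (auto simp: charts_at_iff)
      obtain P h where h: "sm P h" "snd d q \<in> P" "P \<subseteq> snd d ` fst d" "\<forall>x\<in>P. G (chart_inv d x) = h x"
        using loc[OF q(2)] by (elim exE conjE) (rule that)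
      show "\<exists>W g. x \<in> W \<and> sm W g \<and> (\<forall>y\<in>snd d ` (UNIV \<inter> fst d \<inter> G -` fst e) \<inter> W. (snd e \<circ> G \<circ> chart_inv d) y = g y)"
        by (rule exI[where x=P], rule exI[where x=h]) (use h q(1) in \<open>simp add: e\<close>)
    qed
  qed
  then show ?thesis by (simp add: G_def[abs_def])
qed

lemma joint_smooth_continuous:
  assumes F: "joint_smooth A F"
  shows "continuous_on UNIV (\<lambda>p. F (snd p) (fst p))"
proof (rule continuous_at_imp_continuous_on, rule ballI)
  fix p :: "'m \<times> real"
  obtain q s where p: "p = (q, s)" by (cases p)
  obtain c where c: "c \<in> charts_at A q" using ex_chart by blast
  obtain d where d: "d \<in> charts_at A (F s q)" using ex_chart by blast
  note cA = c[unfolded charts_at_iff] and dA = d[unfolded charts_at_iff]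
  obtain W g where g: "sm W g" and qW: "(snd c q, s) \<in> W" and W: "\<And>x r. (x, r) \<in> W \<Longrightarrow> x \<in> snd c ` fst c"
    "\<And>x r. (x, r) \<in> W \<Longrightarrow> F r (chart_inv c x) \<in> fst d"
    "\<And>x r. (x, r) \<in> W \<Longrightarrow> snd d (F r (chart_inv c x)) = g (x, r)"
    using joint_smoothD[OF F c d] by metis
  define h where "h = (\<lambda>p :: 'm \<times> real. (snd c (fst p), snd p))"
  have hc: "continuous_on (fst c \<times> UNIV) h" unfolding h_def
    by (intro continuous_intros continuous_on_compose2[OF chart_cont]) (use cA in auto)
  define Q where "Q = (fst c \<times> UNIV) \<inter> h -` W"
  have oQ: "open Q" unfolding Q_def
    by (rule continuous_open_preimage[OF hc open_Times sm_open[OF g]]) (use cA dom_open in auto)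
  have pQ: "p \<in> Q" using qW cA by (simp add: Q_def h_def p)
  have eq: "F (snd z) (fst z) = chart_inv d (g (h z))" "g (h z) \<in> snd d ` fst d" if "z \<in> Q" for z
  proof -
    have z: "(snd c (fst z), snd z) \<in> W" "fst z \<in> fst c" using that by (auto simp: Q_def h_def)
    have "F (snd z) (fst z) \<in> fst d" "snd d (F (snd z) (fst z)) = g (h z)"
      using W(2,3)[OF z(1)] z(2) cA by (simp_all add: chart_inv_l h_def)
    then show "F (snd z) (fst z) = chart_inv d (g (h z))" "g (h z) \<in> snd d ` fst d"
      using dA chart_inv_l by (metis, metis imageI)
  qed
  have "continuous_on Q (\<lambda>z. chart_inv d (g (h z)))"
  proof (rule continuous_on_compose2[OF chart_inv_cont])
    show "continuous_on Q (\<lambda>z. g (h z))"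
      by (rule continuous_on_compose2[OF sm_continuous_on[OF g] continuous_on_subset[OF hc]]) (auto simp: Q_def)
  qed (use dA eq(2) in auto)
  then have "continuous_on Q (\<lambda>p. F (snd p) (fst p))"
    by (rule continuous_on_eq) (simp add: eq(1))
  then show "isCont (\<lambda>p. F (snd p) (fst p)) p"
    using oQ pQ continuous_on_eq_continuous_at by blast
qed

lemma joint_smooth_slice:
  assumes F: "joint_smooth A F"
  shows "smooth_map_on A A UNIV (F s)"
  unfolding smooth_map_on_def
proof (intro conjI ballI)
  have "continuous_on UNIV (\<lambda>q. (\<lambda>p. F (snd p) (fst p)) (q, s))"
    by (rule continuous_on_compose2[OF joint_smooth_continuous[OF F]]) (auto intro!: continuous_intros)
  then show "continuous_on UNIV (F s)" by simp
  fix c d assume c: "c \<in> A" and d: "d \<in> A"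
  show "smooth_on (snd c ` (UNIV \<inter> fst c \<inter> F s -` fst d)) (snd d \<circ> F s \<circ> chart_inv c)"
  proof (rule smooth_onI)
    fix x assume "x \<in> snd c ` (UNIV \<inter> fst c \<inter> F s -` fst d)"
    then obtain q where q: "x = snd c q" "c \<in> charts_at A q" "d \<in> charts_at A (F s q)"
      using c d by (auto simp: charts_at_iff)
    obtain W g where g: "sm W g" "(snd c q, s) \<in> W" "\<And>x r. (x, r) \<in> W \<Longrightarrow> snd d (F r (chart_inv c x)) = g (x, r)"
      using joint_smoothD[OF F q(2,3)] by metis
    show "\<exists>W g. x \<in> W \<and> sm W g \<and> (\<forall>y\<in>snd c ` (UNIV \<inter> fst c \<inter> F s -` fst d) \<inter> W. (snd d \<circ> F s \<circ> chart_inv c) y = g y)"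
      by (rule exI[where x="{x. (x, s) \<in> W}"], rule exI[where x="\<lambda>x. g (x, s)"])
        (use g q(1) sm_slice[OF g(1)] in simp)
  qed
qed

lemma joint_smooth_curve:
  assumes F: "joint_smooth A F"
  shows "smooth_map_on (euclidean_atlas :: (real, real) chart set) A I (\<lambda>s. F s q)"
  unfolding smooth_map_on_def euclidean_atlas_def
proof (intro conjI ballI)
  have "continuous_on I (\<lambda>s. (\<lambda>p. F (snd p) (fst p)) (q, s))"
    by (rule continuous_on_compose2[OF joint_smooth_continuous[OF F]]) (auto intro!: continuous_intros)
  then show "continuous_on I (\<lambda>s. F s q)" by simp
  fix e d assume e: "e \<in> {(UNIV :: real set, id :: real \<Rightarrow> real)}" and d: "d \<in> A"
  then have e: "fst e = UNIV" "snd e = id" by auto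
  have ei: "chart_inv e = id" unfolding e by (simp add: inv_into_def fun_eq_iff)
  show "smooth_on (snd e ` (I \<inter> fst e \<inter> (\<lambda>s. F s q) -` fst d)) (snd d \<circ> (\<lambda>s. F s q) \<circ> chart_inv e)"
  proof (rule smooth_onI)
    fix s assume "s \<in> snd e ` (I \<inter> fst e \<inter> (\<lambda>s. F s q) -` fst d)"
    then have ds: "d \<in> charts_at A (F s q)" using d by (auto simp: charts_at_iff e)
    obtain c where c: "c \<in> charts_at A q" using ex_chart by blast
    obtain W g where g: "sm W g" "(snd c q, s) \<in> W" "\<And>x r. (x, r) \<in> W \<Longrightarrow> snd d (F r (chart_inv c x)) = g (x, r)"
      using joint_smoothD[OF F c ds] by metis
    have "open ((\<lambda>r. (snd c q, r)) -` W)" by (intro open_vimage sm_open[OF g(1)] continuous_intros)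
    then have o: "open {r. (snd c q, r) \<in> W}" by (simp add: vimage_def)
    have sg: "sm {r. (snd c q, r) \<in> W} (\<lambda>r. g (snd c q, r))"
      by (rule sm_compose[OF g(1)]) (auto intro!: sm_Pair sm_ident sm_const o)
    show "\<exists>W g. s \<in> W \<and> sm W g \<and> (\<forall>y\<in>snd e ` (I \<inter> fst e \<inter> (\<lambda>s. F s q) -` fst d) \<inter> W.
        (snd d \<circ> (\<lambda>s. F s q) \<circ> chart_inv e) y = g y)"
      by (rule exI[where x="{r. (snd c q, r) \<in> W}"], rule exI[where x="\<lambda>r. g (snd c q, r)"])
        (use g(2) g(3)[of "snd c q"] sg c in \<open>simp add: ei chart_inv_l charts_at_iff\<close>)
  qed
qed

lemma joint_smooth_prod:
  assumes F: "joint_smooth A F"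
  shows "smooth_map_on (prod_atlas A (euclidean_atlas :: (real, real) chart set)) A (UNIV \<times> I) (\<lambda>(p, t). F t p)"
  unfolding smooth_map_on_def
proof (intro conjI ballI)
  show "continuous_on (UNIV \<times> I) (\<lambda>(p, t). F t p)"
    using continuous_on_subset[OF joint_smooth_continuous[OF F] subset_UNIV] by (simp add: case_prod_beta')
  fix e d assume "e \<in> prod_atlas A (euclidean_atlas :: (real, real) chart set)" and d: "d \<in> A"
  then obtain c where c: "c \<in> A" and e: "fst e = fst c \<times> UNIV" "snd e = map_prod (snd c) id"
    by (auto simp: prod_atlas_def euclidean_atlas_def)
  have inj: "inj_on (snd e) (fst e)" unfolding e
    using inj_on_inverseI[of "fst c" "chart_inv c" "snd c"] chart_inv_l[OF c] by (intro map_prod_inj_on) auto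
  have ei: "chart_inv e (snd c q, r) = (q, r)" if "q \<in> fst c" for q r
    using inv_into_f_f[OF inj, of "(q, r)"] that by (simp add: e)
  show "smooth_on (snd e ` ((UNIV \<times> I) \<inter> fst e \<inter> (\<lambda>(p, t). F t p) -` fst d)) (snd d \<circ> (\<lambda>(p, t). F t p) \<circ> chart_inv e)"
  proof (rule smooth_onI)
    fix z assume "z \<in> snd e ` ((UNIV \<times> I) \<inter> fst e \<inter> (\<lambda>(p, t). F t p) -` fst d)"
    then obtain q s where q: "z = (snd c q, s)" "c \<in> charts_at A q" "d \<in> charts_at A (F s q)"
      using c d by (auto simp: charts_at_iff e)
    obtain W g where g: "sm W g" "(snd c q, s) \<in> W" "\<And>x r. (x, r) \<in> W \<Longrightarrow> snd d (F r (chart_inv c x)) = g (x, r)"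
      using joint_smoothD[OF F q(2,3)] by metis
    have "(snd d \<circ> (\<lambda>(p, t). F t p) \<circ> chart_inv e) y = g y"
      if y: "y \<in> snd e ` ((UNIV \<times> I) \<inter> fst e \<inter> (\<lambda>(p, t). F t p) -` fst d)" "y \<in> W" for y
    proof -
      obtain q' r where "y = (snd c q', r)" "q' \<in> fst c" using y(1) by (auto simp: e)
      then show ?thesis using g(3)[of "snd c q'" r] y(2) c by (simp add: ei chart_inv_l)
    qed
    then show "\<exists>W g. z \<in> W \<and> sm W g \<and> (\<forall>y\<in>snd e ` ((UNIV \<times> I) \<inter> fst e \<inter> (\<lambda>(p, t). F t p) -` fst d) \<inter> W.
        (snd d \<circ> (\<lambda>(p, t). F t p) \<circ> chart_inv e) y = g y)"
      by (intro exI[where x=W] exI[where x=g]) (use g q(1) in simp)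
  qed
qed

lemma smooth_map_local:
  assumes f: "smooth_map_on A A UNIV f" and c: "c \<in> A" and d: "d \<in> A"
  shows "sm (snd c ` (fst c \<inter> f -` fst d)) (snd d \<circ> f \<circ> chart_inv c)"
proof -
  have "open (f -` fst d)"
    using f dom_open[OF d] continuous_on_open_vimage[of UNIV f] by (auto simp: smooth_map_on_def)
  then have "open (snd c ` (fst c \<inter> f -` fst d))" by (rule chart_image_open[OF c])
  note o = this
  have "\<forall>c\<in>A. \<forall>d\<in>A. smooth_on (snd c ` (UNIV \<inter> fst c \<inter> f -` fst d)) (snd d \<circ> f \<circ> chart_inv c)"
    using f unfolding smooth_map_on_def by (rule conjunct2)
  from bspec[OF bspec[OF this c] d] show ?thesis
    unfolding Int_UNIV_left smooth_on_open_iff[OF o] .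
qed

text \<open>Preimages of subbasic sets suffice. Such a set asks for estimates on a compact
  \<open>K\<close>; each estimate is an open condition in time and point jointly, and compactness of
  \<open>K\<close> makes it hold for a whole interval of times.\<close>

lemma joint_smooth_path:
  assumes F: "joint_smooth A F"
  shows "continuous_map euclideanreal (smooth_topology A) F"
  unfolding smooth_topology_def continuous_on_generated_topo_iff
proof (intro conjI allI impI)
  let ?S = "{smooth_nhd A f c d K vs \<epsilon> | f c d K vs \<epsilon>.
        smooth_map_on A A UNIV f \<and> c \<in> A \<and> d \<in> A \<and> compact K \<and> K \<subseteq> fst c \<and> f ` K \<subseteq> fst d
        \<and> set vs \<subseteq> Basis \<and> 0 < \<epsilon>}"
  obtain c where c: "c \<in> A" using ex_chart charts_at_iff by blast
  show "F ` topspace euclideanreal \<subseteq> \<Union> ?S"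
  proof
    fix f assume "f \<in> F ` topspace euclideanreal"
    then have f: "smooth_map_on A A UNIV f" using joint_smooth_slice[OF F] by auto
    \<comment> \<open>The empty compact set imposes no condition, so every smooth self-map is a
      point of the generated topology.\<close>
    have "f \<in> smooth_nhd A f c c {} [] 1" using f by (simp add: smooth_nhd_def)
    moreover have "smooth_nhd A f c c {} [] 1 \<in> ?S"
      by (rule CollectI, rule exI[of _ f], rule exI[of _ c], rule exI[of _ c], rule exI[of _ "{}"], rule exI[of _ "[]"], rule exI[of _ 1])
        (use f c in simp)
    ultimately show "f \<in> \<Union> ?S" by (rule UnionI[rotated])
  qed
  fix U assume "U \<in> ?S"
  then obtain f c d K vs \<epsilon> where U: "U = smooth_nhd A f c d K vs \<epsilon>" and f: "smooth_map_on A A UNIV f"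
    and c: "c \<in> A" and d: "d \<in> A" and K: "compact K" "K \<subseteq> fst c" "f ` K \<subseteq> fst d" by blast
  have mem: "F s \<in> U \<longleftrightarrow> F s ` K \<subseteq> fst d \<and> (\<forall>x\<in>snd c ` K. dist (iter_deriv vs (snd d \<circ> F s \<circ> chart_inv c) x)
       (iter_deriv vs (snd d \<circ> f \<circ> chart_inv c) x) < \<epsilon>)" for s
    using joint_smooth_slice[OF F] by (simp add: U smooth_nhd_def)
  have "\<exists>J. open J \<and> s0 \<in> J \<and> J \<subseteq> F -` U" if s0: "F s0 \<in> U" for s0
  proof -
    define good where "good x s \<longleftrightarrow> F s (chart_inv c x) \<in> fst d \<and> dist (iter_deriv vs (snd d \<circ> F s \<circ> chart_inv c) x)
       (iter_deriv vs (snd d \<circ> f \<circ> chart_inv c) x) < \<epsilon>" for x s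
    have "\<exists>P. open P \<and> (s0, x) \<in> P \<and> (\<forall>s y. (s, y) \<in> P \<longrightarrow> good y s)" if x: "x \<in> snd c ` K" for x
    proof -
      obtain q where q: "x = snd c q" "q \<in> K" using x by blast
      have qc: "q \<in> fst c" using q K by auto
      have cq: "c \<in> charts_at A q" and dq: "d \<in> charts_at A (F s0 q)"
        using c d K q s0 mem by (auto simp: charts_at_iff)
      obtain W g where g: "sm W g" and qW: "(snd c q, s0) \<in> W" and W: "\<And>x r. (x, r) \<in> W \<Longrightarrow> x \<in> snd c ` fst c"
        "\<And>x r. (x, r) \<in> W \<Longrightarrow> F r (chart_inv c x) \<in> fst d"
        "\<And>x r. (x, r) \<in> W \<Longrightarrow> snd d (F r (chart_inv c x)) = g (x, r)"
        using joint_smoothD[OF F cq dq] by metis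
      define G where "G = iter_deriv (map (\<lambda>v. (v, 0::real)) vs) g"
      define T where "T = snd c ` (fst c \<inter> f -` fst d)"
      define h where "h = iter_deriv vs (snd d \<circ> f \<circ> chart_inv c)"
      have hT: "sm T h" unfolding T_def h_def by (rule sm_iter_deriv[OF smooth_map_local[OF f c d]])
      have xT: "x \<in> T" using q qc K by (auto simp: T_def)
      have eqG: "iter_deriv vs (snd d \<circ> F s \<circ> chart_inv c) y = G (y, s)" if "(y, s) \<in> W" for y s
      proof -
        have "iter_deriv vs (snd d \<circ> F s \<circ> chart_inv c) y = iter_deriv vs (\<lambda>y. g (y, s)) y"
          by (rule iter_deriv_cong[OF sm_open[OF sm_slice[OF g]]]) (use that W(3) in auto)
        then show ?thesis using iter_deriv_slice[OF g that] by (simp add: G_def)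
      qed
      define S where "S = (\<lambda>p :: real \<times> 'e. (snd p, fst p)) -` W \<inter> UNIV \<times> T"
      have oS: "open S" unfolding S_def
        by (intro open_Int open_vimage sm_open[OF g] continuous_intros open_Times sm_open[OF hT] open_UNIV)
      have "continuous_on S (\<lambda>p. dist (G (snd p, fst p)) (h (snd p)))"
      proof (rule continuous_on_dist)
        have GW: "sm W G" unfolding G_def by (rule sm_iter_deriv[OF g])
        show "continuous_on S (\<lambda>p. G (snd p, fst p))"
          by (rule continuous_on_compose2[OF sm_continuous_on[OF GW], where f="\<lambda>p. (snd p, fst p)"])
            (auto simp: S_def intro!: continuous_intros)
        show "continuous_on S (\<lambda>p. h (snd p))"
          by (rule continuous_on_compose2[OF sm_continuous_on[OF hT], where f=snd])
            (auto simp: S_def intro!: continuous_intros)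
      qed
      from continuous_open_preimage[OF this oS, of "{..<\<epsilon>}"]
      have oP: "open (S \<inter> (\<lambda>p. dist (G (snd p, fst p)) (h (snd p))) -` {..<\<epsilon>})" by simp
      have "dist (G (x, s0)) (h x) < \<epsilon>"
        using s0 x eqG[of x s0] qW q mem by (auto simp: h_def)
      then have "(s0, x) \<in> S \<inter> (\<lambda>p. dist (G (snd p, fst p)) (h (snd p))) -` {..<\<epsilon>}"
        using qW q xT by (simp add: S_def)
      moreover have "good y s" if "(s, y) \<in> S \<inter> (\<lambda>p. dist (G (snd p, fst p)) (h (snd p))) -` {..<\<epsilon>}" for s y
        using that W(2)[of y s] eqG[of y s] by (simp add: good_def S_def h_def)
      ultimately show ?thesis using oP by blast
    qed
    then obtain P where P: "\<And>x. x \<in> snd c ` K \<Longrightarrow> open (P x)" "\<And>x. x \<in> snd c ` K \<Longrightarrow> (s0, x) \<in> P x"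
      "\<And>x s y. x \<in> snd c ` K \<Longrightarrow> (s, y) \<in> P x \<Longrightarrow> good y s" by metis
    have cK: "compact (snd c ` K)"
      by (rule compact_continuous_image[OF continuous_on_subset[OF chart_cont[OF c] K(2)] K(1)])
    \<comment> \<open>The open sets \<open>P x\<close> cover the slice over \<open>s0\<close>, so
      they contain a tube of times around it.\<close>
    have "\<exists>J. s0 \<in> J \<and> open J \<and> J \<times> snd c ` K \<subseteq> (\<Union>x\<in>snd c ` K. P x)"
      by (rule Elementary_Topology.tube_lemma[OF cK]) (use P(1,2) in auto)
    then obtain J where J: "s0 \<in> J" "open J" "J \<times> snd c ` K \<subseteq> (\<Union>x\<in>snd c ` K. P x)" by blast
    have gJ: "good x s" if "s \<in> J" "x \<in> snd c ` K" for s x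
      using J(3) P(3) that by blast
    have "F s \<in> U" if "s \<in> J" for s
      unfolding mem
    proof
      show "F s ` K \<subseteq> fst d"
      proof
        fix r assume "r \<in> F s ` K"
        then obtain q where q: "q \<in> K" "r = F s q" by blast
        then show "r \<in> fst d" using gJ[OF that, of "snd c q"] K c by (auto simp: good_def chart_inv_l subset_iff)
      qed
      show "\<forall>x\<in>snd c ` K. dist (iter_deriv vs (snd d \<circ> F s \<circ> chart_inv c) x) (iter_deriv vs (snd d \<circ> f \<circ> chart_inv c) x) < \<epsilon>"
        using gJ[OF that] by (simp add: good_def)
    qed
    then show ?thesis using J by blast
  qed
  then have "open (F -` U)" by (subst open_subopen) blast
  then show "openin euclideanreal (F -` U \<inter> topspace euclideanreal)" by simp
qed

end


section \<open>Isotopies of small energy\<close>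

locale contact_manifold = manifold A
  for A :: "('m::{t2_space,second_countable_topology}, 'e::euclidean_space) chart set" +
  fixes \<alpha> :: "('m, 'e) form1"
  assumes contact: "contact_form A \<alpha>"
begin

lemma euclidean_form_chart:
  assumes c: "c \<in> A"
  shows "euclidean_form (snd c ` fst c) (local_form A \<alpha> c)"
proof (rule euclidean_form.intro)
  have "(\<forall>x\<in>snd c ` fst c. linear (local_form A \<alpha> c x)) \<and> (\<forall>e. smooth_on (snd c ` fst c) (\<lambda>x. local_form A \<alpha> c x e))"
    using contact unfolding contact_form_def one_form_def by (elim conjE) (drule bspec, rule c, assumption)
  then have 1: "\<forall>x\<in>snd c ` fst c. linear (local_form A \<alpha> c x)"
    and 2: "\<forall>e. smooth_on (snd c ` fst c) (\<lambda>x. local_form A \<alpha> c x e)" by (rule conjunct1, rule conjunct2)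
  show "linear (local_form A \<alpha> c x)" if "x \<in> snd c ` fst c" for x by (rule bspec[OF 1 that])
  show "sm (snd c ` fst c) (\<lambda>x. local_form A \<alpha> c x e)" for e
    using spec[OF 2, of e] unfolding smooth_on_open_iff[OF img_open[OF c]] .
qed (rule img_open[OF c])

lemma ext_deriv_eq:
  "ext_deriv A \<alpha> p v w = dform (local_form A \<alpha> (chart_at A p)) (snd (chart_at A p) p) (v (chart_at A p)) (w (chart_at A p))"
  by (simp only: ext_deriv_def dform_def Let_def)

lemma form_coord_vec: "c \<in> charts_at A q \<Longrightarrow> \<alpha> q (coord_vec A c q e) = local_form A \<alpha> c (snd c q) e"
  using form_eq_local[OF coord_vec_tangent, of c q c \<alpha> e] coord_vec_self[of c q e] by simp

lemma form_zero: "\<alpha> q (\<lambda>_. 0) = 0"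
proof -
  obtain c where c: "c \<in> charts_at A q" using ex_chart by blast
  then have "c \<in> A" "snd c q \<in> snd c ` fst c" by (auto simp: charts_at_iff)
  from linear_0[OF euclidean_form.lin[OF euclidean_form_chart[OF this(1)] this(2)]]
  show ?thesis using form_coord_vec[OF c, of 0] coord_vec_0[OF c] by simp
qed

text \<open>The chart is \<open>chart_at A p\<close> because \<open>ext_deriv\<close> at
  \<open>p\<close> is evaluated in it; \<open>coord_vec\<close> then carries non-degeneracy on the
  contact plane over to coordinates.\<close>

lemma contact_nondegenerate:
  fixes p
  defines "c \<equiv> chart_at A p"
  shows "\<exists>e. local_form A \<alpha> c (snd c p) e \<noteq> 0"
    and "local_form A \<alpha> c (snd c p) e = 0 \<Longrightarrow>
      (\<And>w. local_form A \<alpha> c (snd c p) w = 0 \<Longrightarrow> dform (local_form A \<alpha> c) (snd c p) e w = 0) \<Longrightarrow> e = 0"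
proof -
  have c: "c \<in> charts_at A p" unfolding c_def by (rule chart_at_in)
  have ct: "(\<exists>v\<in>tangent_space A p. \<alpha> p v \<noteq> 0)
    \<and> (\<forall>v\<in>contact_plane A \<alpha> p. (\<forall>w\<in>contact_plane A \<alpha> p. ext_deriv A \<alpha> p v w = 0) \<longrightarrow> v = (\<lambda>_. 0))"
    using contact unfolding contact_form_def by (elim conjE) (erule spec)
  obtain v where v: "v \<in> tangent_space A p" "\<alpha> p v \<noteq> 0" using conjunct1[OF ct] by blast
  show "\<exists>e. local_form A \<alpha> c (snd c p) e \<noteq> 0"
    using form_eq_local[OF v(1) c, of \<alpha>] v(2) by (intro exI[of _ "v c"]) simp
  assume e: "local_form A \<alpha> c (snd c p) e = 0"
    and d: "\<And>w. local_form A \<alpha> c (snd c p) w = 0 \<Longrightarrow> dform (local_form A \<alpha> c) (snd c p) e w = 0"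
  have pl: "coord_vec A c p e \<in> contact_plane A \<alpha> p"
    using coord_vec_tangent[OF c] form_coord_vec[OF c, of e] e by (simp add: contact_plane_def)
  have "ext_deriv A \<alpha> p (coord_vec A c p e) w = 0" if w: "w \<in> contact_plane A \<alpha> p" for w
  proof -
    have "local_form A \<alpha> c (snd c p) (w c) = 0"
      using w form_eq_local[of w p c \<alpha>] c by (simp add: contact_plane_def)
    from d[OF this] show ?thesis
      unfolding ext_deriv_eq c_def[symmetric] coord_vec_self[OF c] .
  qed
  then have "coord_vec A c p e = (\<lambda>_. 0)" using conjunct2[OF ct] pl by blast
  then show "e = 0" using coord_vec_self[OF c, of e] by simp
qed

end

section \<open>The transplanted flow as a contact isotopy\<close>

locale chart_flow = contact_manifold A \<alpha> + hamiltonian_field "snd c ` fst c" "local_form A \<alpha> c" X K H \<mu>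
  for A :: "('m::{t2_space,second_countable_topology}, 'e::euclidean_space) chart set"
    and \<alpha> :: "('m, 'e) form1" and c X K H \<mu> +
  fixes W :: "'e set" and R :: "'e \<Rightarrow> 'e"
  assumes cA: "c \<in> A" and patch: "contact_patch (snd c ` fst c) (local_form A \<alpha> c) W R" and KW: "K \<subseteq> W"
    and off_H: "\<And>x. x \<notin> K \<Longrightarrow> H x = 0"
begin

definition iso :: "real \<Rightarrow> 'm \<Rightarrow> 'm" where
  "iso s = transplant c (flow s)"

lemma iso_in: "q \<in> fst c \<Longrightarrow> iso s q = chart_inv c (flow s (snd c q))"
  and iso_out: "q \<notin> fst c \<Longrightarrow> iso s q = q"
  by (simp_all add: iso_def transplant_def)

lemma iso_dom: "q \<in> fst c \<Longrightarrow> iso s q \<in> fst c"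
  and iso_coord: "q \<in> fst c \<Longrightarrow> snd c (iso s q) = flow s (snd c q)"
  using flow_V[of "snd c q" s] by (simp_all add: iso_in chart_inv_in chart_inv_r)

lemma iso_neg: "iso (- s) (iso s q) = q"
proof (cases "q \<in> fst c")
  case True
  then show ?thesis
    using iso_in[OF iso_dom[OF True], of "- s" s] by (simp add: iso_coord flow_neg chart_inv_l[OF cA])
qed (simp add: iso_out)

lemma iso_neg': "iso s (iso (- s) q) = q"
  using iso_neg[of "- s" q] by simp

lemma iso_0: "iso 0 = id"
proof
  show "iso 0 q = id q" for q
    by (cases "q \<in> fst c") (simp_all add: iso_in iso_out flow_sol sol_0 chart_inv_l[OF cA])
qed

lemma bij_iso: "bij (iso s)"
  by (rule o_bij[of "iso (- s)"]) (simp_all add: fun_eq_iff iso_neg iso_neg')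

lemma inv_iso: "inv (iso s) = iso (- s)"
  by (rule inv_unique_comp) (simp_all add: fun_eq_iff iso_neg iso_neg')

lemma iso_joint_smooth: "joint_smooth A iso"
proof -
  have "joint_smooth A (\<lambda>s. transplant c (flow s))"
    by (rule transplant_joint_smooth[OF cA compact_support K_sub flow_smooth flow_off flow_V])
  then show ?thesis by (simp add: iso_def[abs_def])
qed

lemma iso_diffeomorphism: "diffeomorphism A (iso s)"
  unfolding diffeomorphism_def inv_iso
  using bij_iso joint_smooth_slice[OF iso_joint_smooth] by blast

lemma iso_contactomorphism:
  assumes s: "s \<in> {0..1}"
  shows "iso s \<in> contactomorphisms A \<alpha>"
proof -
  obtain g where g: "sm UNIV g" and off: "\<And>x. x \<notin> K \<Longrightarrow> g x = 0"
    and conf: "\<And>x e. x \<in> snd c ` fst c \<Longrightarrow>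
      local_form A \<alpha> c (flow s x) (ddir (flow s) x e) = exp (g x) * local_form A \<alpha> c x e"
    using flow_conformal[OF patch KW s] by blast
  define G where "G q = (if q \<in> fst c then g (snd c q) else 0)" for q
  have "smooth_map_on A (euclidean_atlas :: (real, real) chart set) UNIV G"
    unfolding G_def[abs_def] by (rule smooth_scalar_extension[OF cA compact_support K_sub g off])
  moreover have "\<alpha> (iso s p) (differential A (iso s) p v) = exp (G p) * \<alpha> p v"
    if v: "v \<in> tangent_space A p" for p v
  proof (cases "p \<in> fst c")
    case True
    have c: "c \<in> charts_at A p" and c': "c \<in> charts_at A (iso s p)"
      using True cA iso_dom by (auto simp: charts_at_iff)
    have "differential A (iso s) p v = coord_vec A c (iso s p) (ddir (flow s) (snd c p) (v c))"
    proof (rule differential_eq[where f="iso s" and u="flow s", OF c c' v img_open[OF cA]])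
      show "snd c p \<in> snd c ` fst c" using True by simp
      show "iso s (chart_inv c x) \<in> fst c" if "x \<in> snd c ` fst c" for x
        by (rule iso_dom[OF chart_inv_in[OF that]])
      show "snd c (iso s (chart_inv c x)) = flow s x" if "x \<in> snd c ` fst c" for x
        using iso_coord[OF chart_inv_in[OF that]] chart_inv_r[OF that] by simp
      show "(flow s has_derivative ddir (flow s) (snd c p)) (at (snd c p))"
        by (rule sm_hd[OF flow_slice_smooth UNIV_I])
    qed simp
    then show ?thesis
      using form_coord_vec[OF c'] form_eq_local[OF v c, of \<alpha>] conf[of "snd c p"] True
      by (simp add: iso_coord G_def)
  next
    case False
    obtain d where d: "d \<in> charts_at A p" using ex_chart by blast
    have idp: "iso s p = p" using False by (simp add: iso_out)
    \<comment> \<open>The differential at \<open>p\<close> depends on a neighbourhood, and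
      \<open>p\<close> may lie on the boundary of the chart domain; on \<open>P\<close> the map is
      the identity.\<close>
    obtain P where P: "open P" "snd d p \<in> P" "P \<subseteq> snd d ` fst d"
      "\<forall>x\<in>P. chart_inv d x \<in> fst c \<longrightarrow> snd c (chart_inv d x) \<notin> K"
      using avoid_support[OF cA compact_support K_sub d False] by blast
    have idP: "iso s (chart_inv d x) = chart_inv d x" if "x \<in> P" for x
      using P(4) that by (cases "chart_inv d x \<in> fst c") (simp_all add: iso_in iso_out flow_off chart_inv_l[OF cA])
    have "differential A (iso s) p v = coord_vec A d (iso s p) ((\<lambda>h. h) (v d))"
      by (rule differential_eq[where f="iso s" and u="\<lambda>x. x" and u'="\<lambda>h. h" and W=P, OF d _ v P(1,2,3)])
        (use d idp P(3) v in \<open>auto simp: idP chart_inv_r chart_inv_in subset_iff\<close>)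
    then have "differential A (iso s) p v = v"
      using tangent_eq_coord_vec[OF v d] idp by simp
    then show ?thesis using idp False by (simp add: G_def)
  qed
  ultimately show ?thesis unfolding contactomorphisms_def using iso_diffeomorphism by blast
qed

lemma iso_isotopy: "contact_isotopy A \<alpha> iso"
  unfolding contact_isotopy_def
  using iso_0 iso_contactomorphism joint_smooth_prod[OF iso_joint_smooth] by blast

text \<open>The image of \<open>{0..1}\<close> is a connected set of contactomorphisms containing
  both \<open>id\<close> and \<open>iso s\<close>.\<close>

lemma iso_Cont0: 
  assumes s: "s \<in> {0..1}"
  shows "iso s \<in> Cont0 A \<alpha>"
proof -
  have "continuous_map (subtopology euclideanreal {0..1}) (smooth_topology A) iso"
    by (rule continuous_map_from_subtopology[OF joint_smooth_path[OF iso_joint_smooth]])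
  then have "continuous_map (subtopology euclideanreal {0..1})
      (subtopology (smooth_topology A) (contactomorphisms A \<alpha>)) iso"
    using iso_contactomorphism by (intro continuous_map_into_subtopology) auto
  moreover have "connectedin (subtopology euclideanreal {0..1}) {0..1::real}"
    by (simp add: connectedin_subtopology connectedin_iff_connected)
  ultimately have "connectedin (subtopology (smooth_topology A) (contactomorphisms A \<alpha>)) (iso ` {0..1})"
    by (rule connectedin_continuous_map_image)
  moreover have "id \<in> iso ` {0..1}" using iso_0 by (intro image_eqI[of _ _ 0]) auto
  moreover have "iso s \<in> iso ` {0..1}" using s by blast
  ultimately show ?thesis unfolding Cont0_def connected_component_of_def by blast
qed

text \<open>The orbit through \<open>q\<close> at time \<open>t\<close> starts at
  \<open>flow (- t)\<close> of its coordinates, and the factor \<open>cos t\<close> is the speed of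
  the time change \<open>sin t\<close>.\<close>

lemma iso_hamiltonian:
  assumes t: "t \<in> {0..1}"
  shows "contact_hamiltonian A \<alpha> iso t q = (if q \<in> fst c then cos t * H (snd c q) else 0)"
proof (cases "q \<in> fst c")
  case True
  define x where "x = flow (- t) (snd c q)"
  have cq: "c \<in> charts_at A q" using True cA by (simp add: charts_at_iff)
  have xt: "flow t x = snd c q" unfolding x_def using flow_neg[of "- t"] by simp
  have y: "iso (- t) q \<in> fst c" "snd c (iso (- t) q) = x"
    using iso_dom[OF True] iso_coord[OF True] by (simp_all add: x_def)
  have "isotopy_field A iso t q = coord_vec A c q (cos t *\<^sub>R X (flow t x))"
    unfolding isotopy_field_def inv_iso
  proof (rule velocity_eq[where u="\<lambda>s. flow s x", OF cq _ t flow_deriv[OF t] xt])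
    show "iso s (iso (- t) q) = chart_inv c (flow s x)" for s
      using iso_in[OF y(1)] y(2) by simp
    show "at t within {0..1} \<noteq> bot" using t by (simp add: trivial_limit_within islimpt_Icc)
  qed
  then have "contact_hamiltonian A \<alpha> iso t q = local_form A \<alpha> c (snd c q) (cos t *\<^sub>R X (snd c q))"
    unfolding contact_hamiltonian_def using form_coord_vec[OF cq] xt by simp
  also have "\<dots> = cos t * H (snd c q)"
    using linear_scale[OF lin[of "snd c q"]] ham[of "snd c q"] True by simp
  finally show ?thesis using True by simp
next
  case False
  obtain d where d: "d \<in> charts_at A q" using ex_chart by blast
  have "isotopy_field A iso t q = coord_vec A d q 0"
    unfolding isotopy_field_def
  proof (rule velocity_eq[where u="\<lambda>_. snd d q", OF d _ t])
    show "iso s (inv (iso t) q) = chart_inv d (snd d q)" for s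
      using False d by (simp add: inv_iso iso_out charts_at_iff chart_inv_l)
    show "at t within {0..1} \<noteq> bot" using t by (simp add: trivial_limit_within islimpt_Icc)
  qed auto
  then show ?thesis
    unfolding contact_hamiltonian_def using coord_vec_0[OF d] form_zero False by simp
qed

lemma shelukhin_norm_iso_le:
  assumes B: "\<And>x. \<bar>H x\<bar> \<le> B"
  shows "shelukhin_norm A \<alpha> (iso 1) \<le> ennreal B"
  unfolding shelukhin_norm_def
proof (rule INF_lower2)
  show "iso \<in> {\<Phi>. contact_isotopy A \<alpha> \<Phi> \<and> \<Phi> 1 = iso 1}" using iso_isotopy by simp
  have B0: "0 \<le> B" using B[of undefined] by linarith
  have "ennreal \<bar>contact_hamiltonian A \<alpha> iso t q\<bar> \<le> ennreal B" if "t \<in> {0..1}" for t q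
  proof (rule ennreal_leI)
    have "\<bar>cos t\<bar> * \<bar>H (snd c q)\<bar> \<le> 1 * B" by (intro mult_mono B) (auto simp: B0)
    then show "\<bar>contact_hamiltonian A \<alpha> iso t q\<bar> \<le> B"
      unfolding iso_hamiltonian[OF that] using B0 by (simp add: abs_mult)
  qed
  then have "(\<integral>\<^sup>+t\<in>{0..1}. (SUP q. ennreal \<bar>contact_hamiltonian A \<alpha> iso t q\<bar>) \<partial>lborel)
     \<le> (\<integral>\<^sup>+t. ennreal B * indicator {0..1::real} t \<partial>lborel)"
    by (intro nn_integral_mono) (auto simp: indicator_def intro!: SUP_least)
  also have "\<dots> = ennreal B" by (simp add: nn_integral_cmult_indicator)
  finally show "(\<integral>\<^sup>+t\<in>{0..1}. (SUP q. ennreal \<bar>contact_hamiltonian A \<alpha> iso t q\<bar>) \<partial>lborel) \<le> ennreal B" .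
qed

text \<open>The Hamiltonian \<open>\<epsilon> sin (H / \<epsilon>)\<close> has the same 1-jet as \<open>H\<close> along \<open>{H = 0}\<close>, hence the same
  contact vector field there, but its energy is at most \<open>\<epsilon>\<close>.\<close>

lemma small_energy_isotopy:
  assumes \<epsilon>: "\<epsilon> > 0" and N: "\<And>q. q \<in> N \<Longrightarrow> q \<in> fst c \<Longrightarrow> H (snd c q) = 0"
  shows "\<exists>f\<in>Cont0 A \<alpha>. f ` N = iso 1 ` N \<and> shelukhin_norm A \<alpha> f \<le> ennreal \<epsilon>"
proof -
  interpret P: contact_patch "snd c ` fst c" "local_form A \<alpha> c" W R by (rule patch)
  define H' where "H' x = \<epsilon> * sin (inverse \<epsilon> * H x)" for x
  have smH': "sm UNIV H'" unfolding H'_def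
    by (intro sm_mult sm_const sm_compose[OF sm_sin] sm_H) auto
  have off': "H' x = 0" if "x \<notin> K" for x using off_H[OF that] by (simp add: H'_def)
  obtain X' \<mu>' where X': "supported_field X' K" "continuous_on UNIV \<mu>'" "\<And>x. x \<notin> K \<Longrightarrow> \<mu>' x = 0"
    and ham': "\<And>x. x \<in> snd c ` fst c \<Longrightarrow> local_form A \<alpha> c x (X' x) = H' x"
    "\<And>x e. x \<in> snd c ` fst c \<Longrightarrow> dform (local_form A \<alpha> c) x (X' x) e = - ddir H' x e + \<mu>' x * local_form A \<alpha> c x e"
    using P.hamiltonian_field_exists[OF smH' compact_support KW off'] by blast
  interpret X': supported_field X' K by (rule X'(1))
  interpret F: chart_flow A \<alpha> c X' K H' \<mu>' W R
    by unfold_locales (rule K_sub smH' ham' X'(2,3) cA KW off' | assumption)+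
  have same_field: "X z = X' z" if z: "z \<in> snd c ` fst c" "H z = 0" for z
  proof (cases "z \<in> K")
    case True
    \<comment> \<open>At a zero of \<open>H\<close> the cosine is 1 and the factors
      \<open>\<epsilon>\<close> and \<open>inverse \<epsilon>\<close> cancel, so there the
      differentials agree.\<close>
    have "(H' has_derivative (\<lambda>e. \<epsilon> * (cos (inverse \<epsilon> * H z) * (inverse \<epsilon> * ddir H z e)))) (at z)"
      unfolding H'_def using sm_hd[OF sm_H, of z] by (auto intro!: derivative_eq_intros)
    from frechet_derivative_at[OF this] have d: "ddir H' z = ddir H z"
      using z(2) less_imp_neq[OF \<epsilon>] by (simp add: fun_eq_iff flip: mult.assoc)
    \<comment> \<open>\<open>\<mu>\<close> and \<open>\<mu>'\<close> come from two separate
      constructions; their difference becomes the unknown multiple that the uniqueness lemma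
      permits.\<close>
    show ?thesis
    proof (rule P.hamiltonian_vector_unique)
      show "z \<in> W" using True KW by blast
      show "local_form A \<alpha> c z (X z) = local_form A \<alpha> c z (X' z)"
        using ham[OF z(1)] ham'(1)[OF z(1)] z(2) by (simp add: H'_def)
      show "dform (local_form A \<alpha> c) z (X z) e - dform (local_form A \<alpha> c) z (X' z) e = (\<mu> z - \<mu>' z) * local_form A \<alpha> c z e" for e
        using ham_d[OF z(1), of e] ham'(2)[OF z(1), of e] by (simp add: d algebra_simps)
    qed
  next
    case False
    then show ?thesis using off_support X'.off_support by simp
  qed
  have same_flow: "X'.flow 1 x = flow 1 x" if x: "x \<in> snd c ` fst c" "H x = 0" for x
  proof -
    have one: "(1::real) \<in> {0..1}" and sin1: "sin (1::real) \<in> {0..1}" using sin_ge_zero[of 1] pi_gt3 by auto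
    \<comment> \<open>The orbit of \<open>X\<close> stays in the zero set of \<open>H\<close>, where
      the fields coincide, so it is an orbit of \<open>X'\<close> as well.\<close>
    have "sol X' x (sin 1) = sol X x (sin 1)"
    proof (rule X'.sol_unique[where w="sol X x", OF sol_0 _ sin1])
      fix t :: real assume t: "t \<in> {0..1}"
      have "X (sol X x t) = X' (sol X x t)"
        by (rule same_field[OF sol_V[OF x(1) t]]) (simp add: sol_hamiltonian[OF x(1) t] x(2))
      then show "(sol X x has_vector_derivative X' (sol X x t)) (at t within {0..1})"
        using sol_deriv[OF t, of x] by simp
    qed
    then show ?thesis unfolding X'.flow_sol[OF one] flow_sol[OF one] .
  qed
  have "F.iso 1 q = iso 1 q" if "q \<in> N" for q
    using same_flow[of "snd c q"] N[OF that] by (cases "q \<in> fst c") (simp_all add: F.iso_in iso_in F.iso_out iso_out)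
  then have "F.iso 1 ` N = iso 1 ` N" by (rule image_cong[OF refl])
  moreover have "\<bar>H' x\<bar> \<le> \<epsilon>" for x
    using \<epsilon> mult_left_mono[OF abs_sin_le_one[of "inverse \<epsilon> * H x"], of \<epsilon>] by (simp add: H'_def abs_mult)
  then have "shelukhin_norm A \<alpha> (F.iso 1) \<le> ennreal \<epsilon>" by (rule F.shelukhin_norm_iso_le)
  moreover have "F.iso 1 \<in> Cont0 A \<alpha>" by (rule F.iso_Cont0) simp
  ultimately show ?thesis by blast
qed

lemma iso_1_invariant:
  assumes nd: "delta_nondegenerate A \<alpha> N" and N: "\<And>q. q \<in> N \<Longrightarrow> q \<in> fst c \<Longrightarrow> H (snd c q) = 0"
  shows "iso 1 ` N = N"
proof -
  have "delta A \<alpha> N (iso 1 ` N) \<le> ennreal \<epsilon>" if \<epsilon>: "\<epsilon> > 0" for \<epsilon>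
  proof -
    obtain f where f: "f \<in> Cont0 A \<alpha>" "f ` N = iso 1 ` N" "shelukhin_norm A \<alpha> f \<le> ennreal \<epsilon>"
      using small_energy_isotopy[OF \<epsilon> N] by blast
    show ?thesis unfolding delta_def by (rule INF_lower2[where i=f]) (simp_all add: f)
  qed
  then have "delta A \<alpha> N (iso 1 ` N) = 0"
    using ennreal_le_epsilon[of 0 "delta A \<alpha> N (iso 1 ` N)"] by (simp add: le_zero_eq)
  moreover have "N \<in> orbit A \<alpha> N"
    unfolding orbit_def using iso_Cont0[of 0] by (intro image_eqI[of _ _ id]) (simp_all add: iso_0)
  moreover have "iso 1 ` N \<in> orbit A \<alpha> N"
    unfolding orbit_def using iso_Cont0[of 1] by (intro image_eqI[of _ _ "iso 1"]) simp_all
  ultimately show ?thesis using nd unfolding delta_nondegenerate_def by metis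
qed

text \<open>With \<open>\<tau> = sin s / sin 1\<close> the Hamiltonian \<open>\<tau> * H\<close>
  still vanishes on \<open>N\<close>, and since \<open>sin 1 * \<tau> = sin s\<close> its map at
  parameter 1 is \<open>iso s\<close>. This covers every real \<open>s\<close>, also
  negative.\<close>

lemma iso_invariant:
  assumes nd: "delta_nondegenerate A \<alpha> N" and N: "\<And>q. q \<in> N \<Longrightarrow> q \<in> fst c \<Longrightarrow> H (snd c q) = 0"
  shows "iso s ` N = N"
proof -
  define \<tau> where "\<tau> = sin s / sin 1"
  have sin1: "sin (1::real) > 0" using sin_gt_zero[of 1] pi_gt3 by simp
  interpret T: supported_field "\<lambda>x. \<tau> *\<^sub>R X x" K
    by unfold_locales
      (auto intro: lipschitz_field.smX[OF lipschitz_field_scale] simp: compact_support off_support)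
  have d: "ddir (\<lambda>x. \<tau> * H x) x e = \<tau> * ddir H x e" for x e
  proof -
    have "((\<lambda>x. \<tau> * H x) has_derivative (\<lambda>e. \<tau> * ddir H x e)) (at x)"
      by (rule has_derivative_mult_right[OF sm_hd[OF sm_H UNIV_I]])
    from fun_cong[OF frechet_derivative_at[OF this]] show ?thesis by simp
  qed
  interpret P: contact_patch "snd c ` fst c" "local_form A \<alpha> c" W R by (rule patch)
  interpret S: chart_flow A \<alpha> c "\<lambda>x. \<tau> *\<^sub>R X x" K "\<lambda>x. \<tau> * H x" "\<lambda>x. \<tau> * \<mu> x" W R
  proof unfold_locales
    show "sm UNIV (\<lambda>x. \<tau> * H x)" by (intro sm_mult sm_const sm_H) auto
    show "local_form A \<alpha> c x (\<tau> *\<^sub>R X x) = \<tau> * H x" if "x \<in> snd c ` fst c" for x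
      using linear_scale[OF lin[OF that]] ham[OF that] by simp
    show "dform (local_form A \<alpha> c) x (\<tau> *\<^sub>R X x) e = - ddir (\<lambda>x. \<tau> * H x) x e + \<tau> * \<mu> x * local_form A \<alpha> c x e"
      if "x \<in> snd c ` fst c" for x e
      by (simp only: linear_scale[OF linear_dform1[OF that]] ham_d[OF that] d) (simp add: algebra_simps)
    show "continuous_on UNIV (\<lambda>x. \<tau> * \<mu> x)" by (intro continuous_intros cont_\<mu>)
  qed (use K_sub off_\<mu> off_H cA KW in simp_all)
  have "T.flow 1 x = flow s x" for x
  proof -
    have "sin 1 * \<tau> = sin s" using sin1 by (simp add: \<tau>_def)
    then show ?thesis by (simp add: T.flow_def flow_def)
  qed
  then have "S.iso 1 = iso s" by (simp add: S.iso_def iso_def fun_eq_iff transplant_def)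
  moreover have "S.iso 1 ` N = N" by (rule S.iso_1_invariant[OF nd]) (simp add: N)
  ultimately show ?thesis by simp
qed

lemma hamiltonian_vector_tangent:
  assumes nd: "delta_nondegenerate A \<alpha> N" and N: "\<And>q. q \<in> N \<Longrightarrow> q \<in> fst c \<Longrightarrow> H (snd c q) = 0"
    and p: "p \<in> N" "p \<in> fst c"
  shows "coord_vec A c p (X (snd c p)) \<in> sub_tangent_space A N p"
proof -
  define x where "x = snd c p"
  have cp: "c \<in> charts_at A p" using p cA by (simp add: charts_at_iff)
  have f0: "flow 0 x = x" by (simp add: flow_sol sol_0)
  \<comment> \<open>\<open>flow_deriv\<close> gives a one-sided derivative at 0, but a tangent
    vector of \<open>N\<close> needs a curve on both sides. Joint smoothness provides the two-sided
    derivative \<open>D\<close>, which must equal the one-sided one.\<close>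
  have "(\<lambda>s. flow s x) differentiable (at 0)"
  proof -
    have "((\<lambda>s. (\<lambda>q. flow (snd q) (fst q)) (x, s)) has_derivative (\<lambda>h. ddir (\<lambda>q. flow (snd q) (fst q)) (x, 0) (0, h))) (at 0)"
      by (rule has_derivative_compose[where f="\<lambda>s. (x, s)" and f'="\<lambda>h. (0, h)", OF _ sm_hd[OF flow_smooth UNIV_I]])
        (intro derivative_intros)
    then show ?thesis by (auto simp: differentiable_def)
  qed
  then obtain D where D: "((\<lambda>s. flow s x) has_vector_derivative D) (at 0)"
    using vector_derivative_works by blast
  have "((\<lambda>s. flow s x) has_vector_derivative X x) (at 0 within {0..1})"
    using flow_deriv[of 0 x] f0 by simp
  with has_vector_derivative_at_within[OF D, of "{0..1}"] have "D = X x"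
    using vector_derivative_unique_within[of 0 "{0..1}" "\<lambda>s. flow s x" D "X x"] by (simp add: trivial_limit_within islimpt_Icc)
  then have u: "((\<lambda>s. flow s x) has_vector_derivative X x) (at 0 within {-1<..<1})"
    using has_vector_derivative_at_within[OF D] by simp
  have "velocity A {-1<..<1} (\<lambda>s. iso s p) 0 = coord_vec A c p (X x)"
  proof (rule velocity_eq[where u="\<lambda>s. flow s x", OF cp _ _ u])
    show "iso s p = chart_inv c (flow s x)" for s using iso_in[OF p(2)] by (simp add: x_def)
    show "at (0::real) within {-1<..<1} \<noteq> bot"
      using at_within_open[of "0::real" "{-1<..<1}"] by simp
    show "flow 0 x = snd c p" unfolding f0 by (rule x_def)
  qed simp
  moreover have "(\<lambda>s. iso s p) ` {-1<..<1} \<subseteq> N" using iso_invariant[OF nd N] p(1) by blast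
  moreover have "smooth_map_on (euclidean_atlas :: (real, real) chart set) A {-1<..<1} (\<lambda>s. iso s p)"
    by (rule joint_smooth_curve[OF iso_joint_smooth])
  ultimately show ?thesis
    unfolding sub_tangent_space_def x_def[symmetric]
    by (intro CollectI exI[of _ "\<lambda>s. iso s p"] exI[of _ 1]) (simp add: iso_0)
qed

end

section \<open>Realising a vector of the symplectic orthogonal\<close>

context manifold
begin

text \<open>In a slice chart the straight line through the point in direction \<open>f\<close> stays
  in the linear slice, so its image is a smooth curve in \<open>N\<close>.\<close>

lemma sub_tangent_space_slice:
  assumes c: "c \<in> charts_at A p" and p: "p \<in> N" and S: "subspace S" "snd c ` (fst c \<inter> N) = snd c ` fst c \<inter> S" and f: "f \<in> S"
  shows "coord_vec A c p f \<in> sub_tangent_space A N p"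
proof -
  note cA = c[unfolded charts_at_iff]
  have pS: "snd c p \<in> S" using S(2) cA p by blast
  obtain r where r: "r > 0" "ball (snd c p) r \<subseteq> snd c ` fst c"
    using img_open[of c] cA openE by blast
  \<comment> \<open>Keeps the segment inside the ball of radius \<open>r\<close>; the summand 1
    covers \<open>f = 0\<close>.\<close>
  define \<epsilon> where "\<epsilon> = r / (norm f + 1)"
  have \<epsilon>: "\<epsilon> > 0" using r(1) by (simp add: \<epsilon>_def add_nonneg_pos)
  define u where "u t = snd c p + t *\<^sub>R f" for t
  define I where "I = {-\<epsilon><..<\<epsilon>}"
  define \<gamma> where "\<gamma> t = chart_inv c (u t)" for t
  have u_img: "u t \<in> snd c ` fst c" if "t \<in> I" for t
  proof -
    have "\<bar>t\<bar> * norm f \<le> \<bar>t\<bar> * (norm f + 1)" by (simp add: mult_left_mono)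
    also have "\<dots> < \<epsilon> * (norm f + 1)" using that by (intro mult_strict_right_mono) (auto simp: I_def abs_less_iff add_nonneg_pos)
    also have "\<dots> = r" by (simp add: \<epsilon>_def add_nonneg_eq_0_iff)
    finally have "u t \<in> ball (snd c p) r" by (simp add: u_def dist_norm)
    then show ?thesis using r(2) by blast
  qed
  have u_S: "u t \<in> S" for t unfolding u_def by (intro subspace_add subspace_scale S(1) pS f)
  have \<gamma>N: "\<gamma> t \<in> N" if "t \<in> I" for t
  proof -
    have "u t \<in> snd c ` (fst c \<inter> N)" using S(2) u_img[OF that] u_S by blast
    then show ?thesis unfolding \<gamma>_def using chart_inv_l cA by auto
  qed
  have uc: "continuous_on I u" unfolding u_def by (intro continuous_intros)
  have usm: "sm UNIV u" unfolding u_def by (intro sm_add sm_scaleR sm_const sm_ident) auto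
  have "smooth_map_on (euclidean_atlas :: (real, real) chart set) A I \<gamma>"
    unfolding smooth_map_on_def euclidean_atlas_def
  proof (intro conjI ballI)
    show "continuous_on I \<gamma>" unfolding \<gamma>_def
      by (rule continuous_on_compose2[OF chart_inv_cont uc]) (use cA u_img in auto)
    fix e d assume "e \<in> {(UNIV :: real set, id :: real \<Rightarrow> real)}" and d: "d \<in> A"
    then have e: "fst e = UNIV" "snd e = id" by auto
    have ei: "chart_inv e = id" unfolding e by (simp add: inv_into_def fun_eq_iff)
    define O' where "O' = snd c ` (fst c \<inter> fst d)"
    have O': "open O'" unfolding O'_def by (rule chart_image_open[OF conjunct1[OF cA] dom_open[OF d]])
    have oW: "open (u -` O')" by (rule open_vimage[OF O' sm_continuous_on[OF usm]])
    have sW: "sm (u -` O') (\<lambda>t. (snd d \<circ> chart_inv c) (u t))"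
      by (rule sm_compose[OF trans_sm[OF conjunct1[OF cA] d] sm_subset[OF usm oW]]) (auto simp: O'_def)
    show "smooth_on (snd e ` (I \<inter> fst e \<inter> \<gamma> -` fst d)) (snd d \<circ> \<gamma> \<circ> chart_inv e)"
    proof (rule smooth_onI)
      fix s assume "s \<in> snd e ` (I \<inter> fst e \<inter> \<gamma> -` fst d)"
      then have s: "s \<in> I" "\<gamma> s \<in> fst d" by (auto simp: e)
      have "u s \<in> O'" unfolding O'_def
        using s(2) chart_inv_in[OF u_img[OF s(1)]] chart_inv_r[OF u_img[OF s(1)]] unfolding \<gamma>_def by (metis IntI imageI)
      then show "\<exists>W g. s \<in> W \<and> sm W g \<and> (\<forall>y\<in>snd e ` (I \<inter> fst e \<inter> \<gamma> -` fst d) \<inter> W. (snd d \<circ> \<gamma> \<circ> chart_inv e) y = g y)"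
        by (intro exI[where x="u -` O'"] exI[where x="\<lambda>t. (snd d \<circ> chart_inv c) (u t)"]) (simp add: sW[unfolded o_def] ei \<gamma>_def)
    qed
  qed
  moreover have "velocity A I \<gamma> 0 = coord_vec A c p f"
  proof (rule velocity_eq[where u=u, OF c \<gamma>_def])
    show "(u has_vector_derivative f) (at 0 within I)" unfolding u_def by (auto intro!: derivative_eq_intros)
    show "0 \<in> I" using \<epsilon> by (simp add: I_def)
    then show "at 0 within I \<noteq> bot" using at_within_open[of 0 I] by (simp add: I_def)
  qed (simp add: u_def)
  moreover have "\<gamma> ` I \<subseteq> N" using \<gamma>N by blast
  moreover have "\<gamma> 0 = p" using cA by (simp add: \<gamma>_def u_def chart_inv_l)
  ultimately show ?thesis unfolding sub_tangent_space_def
    by (intro CollectI exI[of _ \<gamma>] exI[of _ \<epsilon>]) (simp add: I_def \<epsilon>)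
qed

end

text \<open>Subtracting a multiple of \<open>b\<close> changes nothing on the kernel of
  \<open>b\<close>. If \<open>b\<close> is non-zero at some \<open>s\<close> in \<open>S\<close>,
  the multiple that kills \<open>s\<close> kills all of \<open>S\<close>, since \<open>S\<close> is
  spanned by \<open>s\<close> and its intersection with the kernel. If \<open>b\<close> vanishes on
  \<open>S\<close>, then \<open>\<phi>\<close> itself serves.\<close>

lemma extend_functional:
  fixes \<phi> b :: "'a::real_vector \<Rightarrow> real"
  assumes l: "linear \<phi>" "linear b" and S: "subspace S" and z: "\<And>e. e \<in> S \<Longrightarrow> b e = 0 \<Longrightarrow> \<phi> e = 0"
  shows "\<exists>\<psi>. linear \<psi> \<and> (\<forall>e\<in>S. \<psi> e = 0) \<and> (\<forall>e. b e = 0 \<longrightarrow> \<psi> e = \<phi> e)"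
proof (cases "\<exists>s\<in>S. b s \<noteq> 0")
  case True
  then obtain s where s: "s \<in> S" "b s \<noteq> 0" by blast
  define \<psi> where "\<psi> e = \<phi> e - b e / b s * \<phi> s" for e
  have "linear \<psi>" unfolding \<psi>_def
    by (rule linearI) (simp_all add: linear_add[OF l(1)] linear_add[OF l(2)] linear_scale[OF l(1)] linear_scale[OF l(2)]
      add_divide_distrib algebra_simps)
  moreover have "\<psi> e = 0" if "e \<in> S" for e
  proof -
    have "e - (b e / b s) *\<^sub>R s \<in> S" by (intro subspace_diff subspace_scale S that s)
    moreover have "b (e - (b e / b s) *\<^sub>R s) = 0" using s by (simp add: linear_diff[OF l(2)] linear_scale[OF l(2)])
    ultimately have "\<phi> (e - (b e / b s) *\<^sub>R s) = 0" by (rule z)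
    then show ?thesis by (simp add: \<psi>_def linear_diff[OF l(1)] linear_scale[OF l(1)])
  qed
  ultimately show ?thesis by (intro exI[of _ \<psi>]) (simp add: \<psi>_def)
next
  case False
  then show ?thesis using l z by (intro exI[of _ \<phi>]) auto
qed

context contact_manifold
begin

lemma coisotropic_at:
  assumes sub: "submanifold A N" and nd: "delta_nondegenerate A \<alpha> N" and p: "p \<in> N"
    and v: "v \<in> symplectic_orth A \<alpha> p (sub_tangent_space A N p \<inter> contact_plane A \<alpha> p)"
  shows "v \<in> sub_tangent_space A N p"
proof -
  define c where "c = chart_at A p"
  have c: "c \<in> charts_at A p" unfolding c_def by (rule chart_at_in)
  note cA = c[unfolded charts_at_iff]
  define x0 where "x0 = snd c p"
  define a where "a = local_form A \<alpha> c"
  define V where "V = snd c ` fst c"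
  have x0V: "x0 \<in> V" using cA by (simp add: x0_def V_def)
  interpret E: euclidean_form V a
    unfolding V_def a_def by (rule euclidean_form_chart[OF conjunct1[OF cA]])
  have vpl: "v \<in> tangent_space A p" "\<alpha> p v = 0" using v by (auto simp: symplectic_orth_def contact_plane_def)
  have av: "a x0 (v c) = 0" using form_eq_local[OF vpl(1) c, of \<alpha>] vpl(2) by (simp add: a_def x0_def)
  have "\<exists>W R. open W \<and> x0 \<in> W \<and> W \<subseteq> V \<and> sm W R
     \<and> (\<forall>x\<in>W. a x (R x) = 1 \<and> (\<forall>w. dform a x (R x) w = 0) \<and> (\<forall>v. E.flat x v = 0 \<longrightarrow> v = 0))"
  proof (rule E.reeb_exists[OF x0V])
    show "\<exists>v. a x0 v \<noteq> 0" by (rule contact_nondegenerate(1)[of p, folded c_def, folded x0_def a_def])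
    show "v = 0" if "a x0 v = 0" "\<And>w. a x0 w = 0 \<Longrightarrow> dform a x0 v w = 0" for v
      using that by (rule contact_nondegenerate(2)[of p, folded c_def, folded x0_def a_def])
  qed
  then obtain W R where W: "open W" "x0 \<in> W" "W \<subseteq> V" "sm W R"
    "\<And>x. x \<in> W \<Longrightarrow> a x (R x) = 1" "\<And>x w. x \<in> W \<Longrightarrow> dform a x (R x) w = 0" "\<And>x v. x \<in> W \<Longrightarrow> E.flat x v = 0 \<Longrightarrow> v = 0"
    by blast
  interpret P: contact_patch V a W R by unfold_locales (assumption | rule W)+
  from sub p obtain d S where d: "d \<in> charts_at A p" and S: "subspace S" "snd d ` (fst d \<inter> N) = snd d ` fst d \<inter> S"
    unfolding submanifold_def by blast
  note dA = d[unfolded charts_at_iff]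
  define \<tau> where "\<tau> = snd d \<circ> chart_inv c"
  define Q where "Q = snd c ` (fst c \<inter> fst d)"
  have oQ: "open Q" unfolding Q_def by (rule chart_image_open[OF conjunct1[OF cA] dom_open[OF conjunct1[OF dA]]])
  have \<tau>: "sm Q \<tau>" unfolding \<tau>_def Q_def by (rule trans_sm[OF conjunct1[OF cA] conjunct1[OF dA]])
  have x0Q: "x0 \<in> Q" using cA dA by (auto simp: x0_def Q_def)
  have \<tau>0: "\<tau> x0 = snd d p" unfolding \<tau>_def x0_def by (rule trans_app[OF conjunct1[OF cA] conjunct2[OF cA]])
  define T where "T = ddir \<tau> x0"
  \<comment> \<open>Two charts are in play: \<open>c\<close> fixed by \<open>ext_deriv\<close>, and
    the slice chart \<open>d\<close>. \<open>T\<close> and \<open>T'\<close> are the mutually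
    inverse transition derivatives at the point.\<close>
  define T' where "T' = ddir (snd c \<circ> chart_inv d) (snd d p)"
  have T'T: "T' (T e) = e" for e
    unfolding T_def T'_def \<tau>_def x0_def using trans_deriv_comp[OF c d c, of e] trans_deriv_self[OF c, of e] by (simp only:)
  have TT': "T (T' e) = e" for e
    unfolding T_def T'_def \<tau>_def x0_def using trans_deriv_comp[OF d c d, of e] trans_deriv_self[OF d, of e] by (simp only:)
  have linT: "linear T" unfolding T_def by (rule has_derivative_linear[OF sm_hd[OF \<tau> x0Q]])
  have linT': "linear T'" unfolding T'_def by (rule has_derivative_linear[OF trans_hd[OF d c]])
  \<comment> \<open>The slice directions of \<open>N\<close> at the point, expressed in the chart
    \<open>c\<close>.\<close>
  define S' where "S' = T' ` S"
  have S': "subspace S'" unfolding S'_def by (rule linear_subspace_image[OF linT' S(1)])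
  \<comment> \<open>The sign is that of \<open>- dH\<close> in the equation of a Hamiltonian field:
    on the contact plane \<open>dH\<close> has to be \<open>\<phi>\<close> for the field to take the
    value \<open>v\<close>.\<close>
  define \<phi> where "\<phi> e = - dform a x0 (v c) e" for e
  have lin\<phi>: "linear \<phi>" unfolding \<phi>_def by (intro linear_compose_neg E.linear_dform2 x0V)
  have "\<phi> e = 0" if e: "e \<in> S'" "a x0 e = 0" for e
  proof -
    obtain f where f: "f \<in> S" "e = T' f" using e(1) by (auto simp: S'_def)
    have "coord_vec A c p e = coord_vec A d p (T e)"
      unfolding T_def \<tau>_def x0_def by (rule coord_vec_change[OF c d])
    also have "T e = f" using f(2) TT' by simp
    finally have cv: "coord_vec A c p e \<in> sub_tangent_space A N p"
      using sub_tangent_space_slice[OF d p S f(1)] by simp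
    have "coord_vec A c p e \<in> contact_plane A \<alpha> p"
      using coord_vec_tangent[OF c] form_coord_vec[OF c, of e] e(2) by (simp add: contact_plane_def a_def x0_def)
    with cv v have "ext_deriv A \<alpha> p v (coord_vec A c p e) = 0" by (simp add: symplectic_orth_def)
    then show ?thesis
      unfolding ext_deriv_eq c_def[symmetric] coord_vec_self[OF c] by (simp add: \<phi>_def a_def x0_def)
  qed
  from extend_functional[OF lin\<phi> E.lin[OF x0V] S' this]
  obtain \<Lambda> where \<Lambda>: "linear \<Lambda>" "\<And>e. e \<in> S' \<Longrightarrow> \<Lambda> e = 0" "\<And>e. a x0 e = 0 \<Longrightarrow> \<Lambda> e = \<phi> e" by blast
  obtain r where r: "r > 0" "cball x0 r \<subseteq> W \<inter> Q"
    using open_contains_cball[of "W \<inter> Q"] open_Int[OF W(1) oQ] W(2) x0Q by blast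
  define K where "K = cball x0 r"
  obtain \<rho> :: "'e \<Rightarrow> real" where \<rho>: "sm UNIV \<rho>" "\<rho> x0 = 1" "\<And>x. x \<notin> K \<Longrightarrow> \<rho> x = 0"
    using exists_bump[OF r(1), of x0] unfolding K_def by blast
  \<comment> \<open>A linear function in the slice coordinates, centred at the point. Since
    \<open>\<tau>\<close> sends points of \<open>N\<close> into the linear slice, \<open>h\<close>
    vanishes exactly on \<open>N\<close> near the point and not just to first order; its
    differential there is \<open>\<Lambda>\<close>, because \<open>T'\<close> inverts
    \<open>T\<close>.\<close>
  define h where "h x = \<Lambda> (T' (\<tau> x - \<tau> x0))" for x
  define H where "H x = (if x \<in> Q then \<rho> x * h x else 0)" for x
  have K: "compact K" "K \<subseteq> W" "K \<subseteq> Q" "x0 \<in> K" using r by (auto simp: K_def)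
  have blL: "bounded_linear (\<lambda>y. \<Lambda> (T' y))"
    using linear_compose[OF linT' \<Lambda>(1)] by (simp add: linear_conv_bounded_linear o_def)
  have hQ: "sm Q h" unfolding h_def
    by (rule sm_linear_comp[OF blL]) (intro sm_diff \<tau> sm_const oQ)
  have \<rho>Q: "sm Q \<rho>" by (rule sm_subset[OF \<rho>(1) oQ]) simp
  have HQ: "sm Q H" by (rule sm_cong[OF sm_mult[OF \<rho>Q hQ]]) (simp add: H_def)
  have offH: "H x = 0" if "x \<notin> K" for x using \<rho>(3)[OF that] by (simp add: H_def)
  have smH: "sm UNIV H" by (rule sm_extend_zero[OF HQ compact_imp_closed[OF K(1)] K(3) offH])
  have dH: "ddir H x0 = \<Lambda>"
  proof -
    have "(h has_derivative (\<lambda>e. \<Lambda> (T' (T e - 0)))) (at x0)" unfolding h_def T_def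
      by (rule bounded_linear.has_derivative[OF blL]) (intro has_derivative_diff sm_hd[OF \<tau> x0Q] has_derivative_const)
    then have dh: "(h has_derivative \<Lambda>) (at x0)" by (simp add: T'T)
    have "((\<lambda>x. \<rho> x * h x) has_derivative (\<lambda>e. \<rho> x0 * \<Lambda> e + ddir \<rho> x0 e * h x0)) (at x0)"
      by (rule has_derivative_mult[OF sm_hd[OF \<rho>(1) UNIV_I] dh])
    moreover have "h x0 = 0" using linear_0[OF linear_compose[OF linT' \<Lambda>(1)]] by (simp add: h_def)
    ultimately have "((\<lambda>x. \<rho> x * h x) has_derivative \<Lambda>) (at x0)" by (simp add: \<rho>(2))
    then have "(H has_derivative \<Lambda>) (at x0)"
      by (rule has_derivative_transform_within_open[OF _ oQ x0Q]) (simp add: H_def)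
    from frechet_derivative_at[OF this] show ?thesis by simp
  qed
  have HN: "H (snd c q) = 0" if q: "q \<in> N" "q \<in> fst c" for q
  proof (cases "snd c q \<in> Q")
    case True
    then have qd: "q \<in> fst d" using q cA chart_inv_l by (auto simp: Q_def) (metis prod.collapse chart_inv_l)
    have "\<tau> (snd c q) = snd d q" unfolding \<tau>_def by (rule trans_app[OF conjunct1[OF cA] q(2)])
    moreover have "snd d q \<in> S" "snd d p \<in> S" using S(2) q(1) qd p dA by blast+
    ultimately have "\<tau> (snd c q) - \<tau> x0 \<in> S" using S(1) \<tau>0 by (simp add: subspace_diff)
    then show ?thesis using \<Lambda>(2) by (simp add: H_def h_def S'_def)
  qed (simp add: H_def)
  obtain X \<mu> where X: "supported_field X K" "continuous_on UNIV \<mu>" "\<And>x. x \<notin> K \<Longrightarrow> \<mu> x = 0"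
    and ham: "\<And>x. x \<in> V \<Longrightarrow> a x (X x) = H x" "\<And>x e. x \<in> V \<Longrightarrow> dform a x (X x) e = - ddir H x e + \<mu> x * a x e"
    using P.hamiltonian_field_exists[OF smH K(1,2) offH] by blast
  interpret X: supported_field X K by (rule X(1))
  have KV: "K \<subseteq> V" using K(2) W(3) by blast
  interpret P': contact_patch "snd c ` fst c" "local_form A \<alpha> c" W R
    using P.contact_patch_axioms unfolding V_def a_def .
  interpret F: chart_flow A \<alpha> c X K H \<mu> W R
    by unfold_locales
      (rule KV[unfolded V_def] smH ham[unfolded V_def a_def] X(2,3) conjunct1[OF cA] K(2) offH | assumption)+
  have "X x0 = v c"
  proof (rule P.hamiltonian_vector_unique[OF W(2)])
    have "h x0 = 0" using linear_0[OF linear_compose[OF linT' \<Lambda>(1)]] by (simp add: h_def)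
    then show "a x0 (X x0) = a x0 (v c)" using ham(1)[OF x0V] av by (simp add: H_def)
    fix e
    \<comment> \<open>Projecting \<open>e\<close> to the contact plane along the Reeb vector shows
      that \<open>\<Lambda> - \<phi>\<close> is a multiple of the form, so \<open>X x0\<close> and
      \<open>v c\<close> satisfy the same equation up to such a multiple.\<close>
    have "a x0 (e - a x0 e *\<^sub>R R x0) = 0"
      using W(5)[OF W(2)] by (simp add: linear_diff[OF E.lin[OF x0V]] linear_scale[OF E.lin[OF x0V]])
    from \<Lambda>(3)[OF this] have "\<Lambda> e - \<phi> e = a x0 e * (\<Lambda> (R x0) - \<phi> (R x0))"
      by (simp add: linear_diff[OF \<Lambda>(1)] linear_scale[OF \<Lambda>(1)] linear_diff[OF lin\<phi>] linear_scale[OF lin\<phi>] algebra_simps)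
    then show "dform a x0 (X x0) e - dform a x0 (v c) e = (\<mu> x0 - (\<Lambda> (R x0) - \<phi> (R x0))) * a x0 e"
      using ham(2)[OF x0V, of e] by (simp add: dH \<phi>_def algebra_simps)
  qed
  then have "v = coord_vec A c p (X (snd c p))"
    using tangent_eq_coord_vec[OF vpl(1) c] by (simp add: x0_def)
  then show ?thesis
    using F.hamiltonian_vector_tangent[OF nd HN p conjunct2[OF cA]] by simp
qed

end

theorem proposition8p6:
  fixes A :: "('m::{t2_space,second_countable_topology}, 'e::euclidean_space) chart set"
    and \<alpha> :: "('m, 'e) form1"
    and N :: "'m set"
  assumes "smooth_manifold A"
    and "contact_form A \<alpha>"
    and "submanifold A N"
    and "delta_nondegenerate A \<alpha> N"
  shows "contact_coisotropic A \<alpha> N"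
proof -
  interpret contact_manifold A \<alpha> by unfold_locales (rule assms)+
  show ?thesis
    unfolding contact_coisotropic_def
  proof (intro ballI subsetI IntI)
    fix p v assume p: "p \<in> N"
      and v: "v \<in> symplectic_orth A \<alpha> p (sub_tangent_space A N p \<inter> contact_plane A \<alpha> p)"
    show "v \<in> sub_tangent_space A N p" by (rule coisotropic_at[OF assms(3,4) p v])
    show "v \<in> contact_plane A \<alpha> p" using v by (simp add: symplectic_orth_def)
  qed
qed

end
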